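(* Let $\hbar>0$, $a>0$ and $0<\eta<1$, and let $R$ and $S$ be the density matrices on $L^2(\mathbf R)$ given by $$R=\tfrac{1+\eta}2|a,0\rangle\langle a,0|+\tfrac{1-\eta}2|-a,0\rangle\langle -a,0|,\qquad S=\tfrac12|a,0\rangle\langle a,0|+\tfrac12|-a,0\rangle\langle -a,0|.$$ Then no optimal coupling of $R$ and $S$ is a Töplitz operator: if $Q$ is a coupling of $R$ and $S$ with $\operatorname{trace}(CQ)=MK_2(R,S)^2$, then there is no probability measure $\Pi$ on $\mathbf R^2\times\mathbf R^2$ such that $$Q=\int_{\mathbf R^2\times\mathbf R^2}|q,p\rangle\langle q,p|\otimes|q',p'\rangle\langle q',p'|\;\Pi(dq,dp,dq',dp').$$
   Context: Let $\mathfrak H=L^2(\mathbf R)$ and $\hbar>0$. For $(q,p)\in\mathbf R^2$, $|q,p\rangle\in\mathfrak H$ is the (normalized) coherent state $x\mapsto(\pi\hbar)^{-1/4}e^{-(x-q)^2/2\hbar}e^{ipx/\hbar}$, and $|q,p\rangle\langle q,p|$ is the orthogonal projection onto its span. A density matrix on a Hilbert space is a self-adjoint nonnegative operator of trace $1$. A coupling of two density matrices $R,S$ on $\mathfrak H$ is a density matrix $Q$ on $\mathfrak H\otimes\mathfrak H\cong L^2(\mathbf R^2)$ such that $\operatorname{trace}((A\otimes I)Q)=\operatorname{trace}(AR)$ and $\operatorname{trace}((I\otimes B)Q)=\operatorname{trace}(BS)$ for all bounded operators $A,B$ on $\mathfrak H$. The quantum transport cost is the self-adjoint nonnegative operator on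 $L^2(\mathbf R^2,dx\,dy)$ $$C=(x-y)^2-\hbar^2(\partial_x-\partial_y)^2-2\hbar,$$ and $$MK_2(R,S)^2:=\inf_{Q\text{ coupling of }R\text{ and }S}\operatorname{trace}(CQ),\qquad MK_2\ge 0,$$ where, for $Q\ge0$, $\operatorname{trace}(CQ)\in[0,+\infty]$ is understood as $\operatorname{trace}(C^{1/2}QC^{1/2})$. An optimal coupling is a coupling attaining this infimum. *)

theory Defs
  imports "HOL-Probability.Probability"
begin

section \<open>The Hilbert space $L^2$\<close>

definition sq_integrable :: "('a::euclidean_space \<Rightarrow> complex) \<Rightarrow> bool" where
  "sq_integrable f \<longleftrightarrow>
     f \<in> borel_measurable lborel \<and> integrable lborel (\<lambda>x. (cmod (f x))\<^sup>2)"

definition l2_eq :: "('a::euclidean_space \<Rightarrow> complex) \<Rightarrow> ('a \<Rightarrow> complex) \<Rightarrow> bool" where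
  "l2_eq f g \<longleftrightarrow> sq_integrable f \<and> sq_integrable g \<and> (AE x in lborel. f x = g x)"

lemma sq_integrable_zero: "sq_integrable (\<lambda>x. 0)"
  by (simp add: sq_integrable_def)

lemma sq_integrable_scale:
  assumes "sq_integrable f"
  shows "sq_integrable (\<lambda>x. c * f x)"
  using assms unfolding sq_integrable_def
  by (auto simp: norm_mult power_mult_distrib)

lemma sq_integrable_add:
  assumes f: "sq_integrable f" and g: "sq_integrable g"
  shows "sq_integrable (\<lambda>x. f x + g x)"
proof -
  have [measurable]: "f \<in> borel_measurable lborel" "g \<in> borel_measurable lborel"
    using f g by (auto simp: sq_integrable_def)
  have "integrable lborel (\<lambda>x. 2 * (cmod (f x))\<^sup>2 + 2 * (cmod (g x))\<^sup>2)"
    using f g by (auto simp: sq_integrable_def)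
  then have "integrable lborel (\<lambda>x. (cmod (f x + g x))\<^sup>2)"
  proof (rule Bochner_Integration.integrable_bound)
    show "AE x in lborel. norm ((cmod (f x + g x))\<^sup>2)
            \<le> norm (2 * (cmod (f x))\<^sup>2 + 2 * (cmod (g x))\<^sup>2)"
    proof (rule AE_I2)
      fix x
      have "(cmod (f x + g x))\<^sup>2 \<le> (cmod (f x) + cmod (g x))\<^sup>2"
        by (intro power_mono norm_triangle_ineq) simp
      also have "\<dots> \<le> 2 * (cmod (f x))\<^sup>2 + 2 * (cmod (g x))\<^sup>2"
        using sum_squares_bound[of "cmod (f x)" "cmod (g x)"] by (simp add: power2_sum)
      finally show "norm ((cmod (f x + g x))\<^sup>2)
          \<le> norm (2 * (cmod (f x))\<^sup>2 + 2 * (cmod (g x))\<^sup>2)"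
        by simp
    qed
  qed measurable
  then show ?thesis
    by (simp add: sq_integrable_def)
qed

lemma sq_integrable_mult:
  assumes f: "sq_integrable f" and g: "sq_integrable g"
  shows "integrable lborel (\<lambda>x. cnj (f x) * g x)"
proof -
  have [measurable]: "f \<in> borel_measurable lborel" "g \<in> borel_measurable lborel"
    using f g by (auto simp: sq_integrable_def)
  have [measurable]: "cnj \<in> borel_measurable borel"
    by (intro borel_measurable_continuous_onI continuous_intros)
  have "integrable lborel (\<lambda>x. (cmod (f x))\<^sup>2 + (cmod (g x))\<^sup>2)"
    using f g by (auto simp: sq_integrable_def)
  then show ?thesis
  proof (rule Bochner_Integration.integrable_bound)
    show "AE x in lborel. norm (cnj (f x) * g x)
            \<le> norm ((cmod (f x))\<^sup>2 + (cmod (g x))\<^sup>2)"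
    proof (rule AE_I2)
      fix x
      have "2 * (cmod (f x) * cmod (g x)) \<le> (cmod (f x))\<^sup>2 + (cmod (g x))\<^sup>2"
        using sum_squares_bound[of "cmod (f x)" "cmod (g x)"] by (simp add: mult.assoc)
      moreover have "0 \<le> cmod (f x) * cmod (g x)"
        by simp
      ultimately have "cmod (f x) * cmod (g x) \<le> (cmod (f x))\<^sup>2 + (cmod (g x))\<^sup>2"
        by linarith
      then show "norm (cnj (f x) * g x) \<le> norm ((cmod (f x))\<^sup>2 + (cmod (g x))\<^sup>2)"
        by (simp add: norm_mult)
    qed
  qed measurable
qed

lemma l2_eq_refl: "sq_integrable f \<Longrightarrow> l2_eq f f"
  by (simp add: l2_eq_def)

quotient_type (overloaded) 'a L2 = "'a::euclidean_space \<Rightarrow> complex" / partial: l2_eq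
proof (rule part_equivpI)
  show "\<exists>f. l2_eq f f"
    using l2_eq_refl[OF sq_integrable_zero] by blast
  show "symp l2_eq"
    by (auto simp: symp_def l2_eq_def elim: eventually_mono)
  show "transp l2_eq"
    unfolding transp_def l2_eq_def by (auto elim!: eventually_elim2)
qed

lift_definition cinner :: "'a::euclidean_space L2 \<Rightarrow> 'a L2 \<Rightarrow> complex"
  is "\<lambda>f g. \<integral>x. cnj (f x) * g x \<partial>lborel"
proof -
  fix f f' g g' :: "'a \<Rightarrow> complex"
  assume a: "l2_eq f f'" "l2_eq g g'"
  then have ae: "AE x in lborel. cnj (f x) * g x = cnj (f' x) * g' x"
    unfolding l2_eq_def by (auto elim!: eventually_elim2)
  show "(\<integral>x. cnj (f x) * g x \<partial>lborel) = (\<integral>x. cnj (f' x) * g' x \<partial>lborel)"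
    using a ae unfolding l2_eq_def
    by (intro integral_cong_AE borel_measurable_integrable sq_integrable_mult) auto
qed

lift_definition scaleC :: "complex \<Rightarrow> 'a::euclidean_space L2 \<Rightarrow> 'a L2" (infixr "*\<^sub>C" 75)
  is "\<lambda>c f x. c * f x"
  by (auto simp: l2_eq_def sq_integrable_scale elim: eventually_mono)

instantiation L2 :: (euclidean_space) real_inner
begin

lift_definition zero_L2 :: "'a L2" is "\<lambda>x. 0"
  by (rule l2_eq_refl[OF sq_integrable_zero])

lift_definition plus_L2 :: "'a L2 \<Rightarrow> 'a L2 \<Rightarrow> 'a L2" is "\<lambda>f g x. f x + g x"
  by (auto simp: l2_eq_def sq_integrable_add elim: eventually_elim2)

definition uminus_L2 :: "'a L2 \<Rightarrow> 'a L2" where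
  "uminus_L2 f = (- 1) *\<^sub>C f"

definition minus_L2 :: "'a L2 \<Rightarrow> 'a L2 \<Rightarrow> 'a L2" where
  "minus_L2 f g = f + (- 1) *\<^sub>C g"

definition scaleR_L2 :: "real \<Rightarrow> 'a L2 \<Rightarrow> 'a L2" where
  "scaleR_L2 r f = complex_of_real r *\<^sub>C f"

definition inner_L2 :: "'a L2 \<Rightarrow> 'a L2 \<Rightarrow> real" where
  "inner_L2 f g = Re (cinner f g)"

definition norm_L2 :: "'a L2 \<Rightarrow> real" where
  "norm_L2 f = sqrt (inner f f)"

definition sgn_L2 :: "'a L2 \<Rightarrow> 'a L2" where
  "sgn_L2 f = scaleR (inverse (norm f)) f"

definition dist_L2 :: "'a L2 \<Rightarrow> 'a L2 \<Rightarrow> real" where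
  "dist_L2 f g = norm (f - g)"

definition uniformity_L2 :: "('a L2 \<times> 'a L2) filter" where
  "uniformity_L2 = (INF e\<in>{0<..}. principal {(x, y). dist x y < e})"

definition open_L2 :: "'a L2 set \<Rightarrow> bool" where
  "open_L2 U \<longleftrightarrow> (\<forall>x\<in>U. eventually (\<lambda>(x', y). x' = x \<longrightarrow> y \<in> U) uniformity)"

instance
proof
  fix a b c f g h :: "'a L2" and r s :: real
  show "a + b + c = a + (b + c)"
    by transfer (auto simp: l2_eq_def algebra_simps intro!: sq_integrable_add)
  show "a + b = b + a"
    by transfer (auto simp: l2_eq_def algebra_simps intro!: sq_integrable_add)
  show "0 + a = a"
    by transfer (auto simp: l2_eq_def)
  show "- a + a = 0"
    unfolding uminus_L2_def
    by transfer (auto simp: l2_eq_def sq_integrable_zero)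
  show "a - b = a + - b"
    by (simp add: minus_L2_def uminus_L2_def)
  show "r *\<^sub>R (a + b) = r *\<^sub>R a + r *\<^sub>R b"
    unfolding scaleR_L2_def
    by transfer (auto simp: l2_eq_def ring_distribs intro!: sq_integrable_add sq_integrable_scale)
  show "(r + s) *\<^sub>R a = r *\<^sub>R a + s *\<^sub>R a"
    unfolding scaleR_L2_def
    by transfer (auto simp: l2_eq_def ring_distribs intro!: sq_integrable_add sq_integrable_scale)
  show "r *\<^sub>R s *\<^sub>R a = (r * s) *\<^sub>R a"
    unfolding scaleR_L2_def
    by transfer (auto simp: l2_eq_def mult.assoc intro!: sq_integrable_scale)
  show "1 *\<^sub>R a = a"
    unfolding scaleR_L2_def
    by transfer (auto simp: l2_eq_def)
  show "sgn a = inverse (norm a) *\<^sub>R a"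
    by (simp add: sgn_L2_def)
  show "dist a b = norm (a - b)"
    by (simp add: dist_L2_def)
  show "(uniformity :: ('a L2 \<times> 'a L2) filter)
      = (INF e\<in>{0<..}. principal {(x, y). dist x y < e})"
    by (rule uniformity_L2_def)
  show "open U \<longleftrightarrow> (\<forall>x\<in>U. eventually (\<lambda>(x', y). x' = x \<longrightarrow> y \<in> U) uniformity)" for U :: "'a L2 set"
    by (rule open_L2_def)
  show "norm a = sqrt (inner a a)"
    by (rule norm_L2_def)
  have "cinner b a = cnj (cinner a b)"
    proof transfer
    fix f g :: "'a \<Rightarrow> complex"
    have "(\<lambda>x. cnj (g x) * f x) = (\<lambda>x. cnj (cnj (f x) * g x))"
      by (simp add: mult.commute)
    then show "(\<integral>x. cnj (g x) * f x \<partial>lborel) = cnj (\<integral>x. cnj (f x) * g x \<partial>lborel)"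
      by (simp only: Bochner_Integration.integral_cnj)
  qed
  then show "inner a b = inner b a"
    by (simp add: inner_L2_def)
  have "cinner (a + b) c = cinner a c + cinner b c"
    by transfer (simp add: ring_distribs l2_eq_def sq_integrable_mult)
  then show "inner (a + b) c = inner a c + inner b c"
    by (simp add: inner_L2_def)
  have "cinner (complex_of_real r *\<^sub>C a) b = complex_of_real r * cinner a b"
    by transfer (simp add: mult.assoc)
  then show "inner (r *\<^sub>R a) b = r * inner a b"
    by (simp add: inner_L2_def scaleR_L2_def)
  have "\<exists>t. cinner a a = complex_of_real t \<and> 0 \<le> t \<and> (t = 0 \<longrightarrow> a = 0)"
  proof transfer
    fix f :: "'a \<Rightarrow> complex"
    assume "l2_eq f f"
    then have [measurable]: "f \<in> borel_measurable lborel"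
      and int: "integrable lborel (\<lambda>x. (cmod (f x))\<^sup>2)" and sq: "sq_integrable f"
      by (auto simp: l2_eq_def sq_integrable_def)
    have "(\<integral>x. cnj (f x) * f x \<partial>lborel) = (\<integral>x. complex_of_real ((cmod (f x))\<^sup>2) \<partial>lborel)"
      by (intro Bochner_Integration.integral_cong refl)
         (subst mult.commute, simp add: complex_norm_square[symmetric] del: of_real_power)
    also have "\<dots> = complex_of_real (\<integral>x. (cmod (f x))\<^sup>2 \<partial>lborel)"
      by (rule integral_complex_of_real)
    finally have eq: "(\<integral>x. cnj (f x) * f x \<partial>lborel)
        = complex_of_real (\<integral>x. (cmod (f x))\<^sup>2 \<partial>lborel)" .
    have "l2_eq f (\<lambda>x. 0)" if "(\<integral>x. (cmod (f x))\<^sup>2 \<partial>lborel) = 0"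
      using that int sq sq_integrable_zero
      by (auto simp: l2_eq_def integral_nonneg_eq_0_iff_AE)
    then show "\<exists>t. (\<integral>x. cnj (f x) * f x \<partial>lborel) = complex_of_real t \<and> 0 \<le> t
        \<and> (t = 0 \<longrightarrow> l2_eq f (\<lambda>x. 0))"
      using eq by (intro exI[of _ "\<integral>x. (cmod (f x))\<^sup>2 \<partial>lborel"]) auto
  qed
  moreover have "cinner (0::'a L2) 0 = 0"
    by transfer simp
  ultimately show "0 \<le> inner a a" and "inner a a = 0 \<longleftrightarrow> a = 0"
    by (auto simp: inner_L2_def)
qed

end

text \<open>\<^const>\<open>cinner\<close> is antilinear in its first argument. The real inner product of the class
  instance is its real part, so norm and topology are those of the complex Hilbert space.\<close>


section \<open>Operators, traces and tensor products\<close>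

definition bounded_op :: "('a::euclidean_space L2 \<Rightarrow> 'b::euclidean_space L2) \<Rightarrow> bool" where
  "bounded_op A \<longleftrightarrow> bounded_linear A \<and> (\<forall>c f. A (c *\<^sub>C f) = c *\<^sub>C A f)"

definition orthonormal :: "'a::euclidean_space L2 set \<Rightarrow> bool" where
  "orthonormal B \<longleftrightarrow> (\<forall>e\<in>B. \<forall>f\<in>B. cinner e f = (if e = f then 1 else 0))"

definition orthonormal_basis :: "'a::euclidean_space L2 set \<Rightarrow> bool" where
  "orthonormal_basis B \<longleftrightarrow> orthonormal B \<and> (\<forall>f. (\<forall>e\<in>B. cinner e f = 0) \<longrightarrow> f = 0)"

text \<open>\<open>A\<close> is of trace class with trace \<open>t\<close>: a bounded operator is of trace class iff its diagonal
  sum converges unconditionally in every orthonormal basis, and the sum is then basis independent.\<close>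
definition has_trace :: "('a::euclidean_space L2 \<Rightarrow> 'a L2) \<Rightarrow> complex \<Rightarrow> bool" where
  "has_trace A t \<longleftrightarrow>
     bounded_op A \<and> (\<forall>B. orthonormal_basis B \<longrightarrow> ((\<lambda>e. cinner e (A e)) has_sum t) B)"

definition density_matrix :: "('a::euclidean_space L2 \<Rightarrow> 'a L2) \<Rightarrow> bool" where
  "density_matrix R \<longleftrightarrow>
     bounded_op R \<and> (\<forall>f g. cinner f (R g) = cinner (R f) g) \<and>
     (\<forall>f. 0 \<le> Re (cinner f (R f))) \<and> has_trace R 1"

lift_definition tensor_vec ::
    "'a::euclidean_space L2 \<Rightarrow> 'b::euclidean_space L2 \<Rightarrow> ('a \<times> 'b) L2" (infixr "\<otimes>\<^sub>v" 70)
  is "\<lambda>f g (x, y). f x * g y"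
proof -
  fix f f' :: "'a \<Rightarrow> complex" and g g' :: "'b \<Rightarrow> complex"
  have sq: "sq_integrable (\<lambda>(x, y). f x * g y)"
    if f: "sq_integrable f" and g: "sq_integrable g" for f :: "'a \<Rightarrow> complex" and g :: "'b \<Rightarrow> complex"
  proof -
    have [measurable]: "f \<in> borel_measurable lborel" "g \<in> borel_measurable lborel"
      using f g by (auto simp: sq_integrable_def)
    have "integrable (lborel \<Otimes>\<^sub>M lborel) (\<lambda>(x, y). (cmod (f x))\<^sup>2 * (cmod (g y))\<^sup>2)"
    proof (rule lborel_pair.Fubini_integrable)
      show "integrable lborel
          (\<lambda>x. \<integral>y. norm (case (x, y) of (x, y) \<Rightarrow> (cmod (f x))\<^sup>2 * (cmod (g y))\<^sup>2) \<partial>lborel)"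
        using f by (simp add: sq_integrable_def)
    qed (use f g in \<open>auto simp: sq_integrable_def\<close>)
    moreover have "(\<lambda>(x, y). (cmod (f x))\<^sup>2 * (cmod (g y))\<^sup>2)
        = (\<lambda>z. (cmod (case z of (x, y) \<Rightarrow> f x * g y))\<^sup>2)"
      by (auto simp: norm_mult power_mult_distrib)
    moreover have "(\<lambda>(x, y). f x * g y) \<in> borel_measurable (lborel \<Otimes>\<^sub>M lborel)"
      by measurable
    ultimately show ?thesis
      by (simp add: sq_integrable_def flip: lborel_prod)
  qed
  assume a: "l2_eq f f'" "l2_eq g g'"
  then have [measurable]: "f \<in> borel_measurable lborel" "g \<in> borel_measurable lborel"
      "f' \<in> borel_measurable lborel" "g' \<in> borel_measurable lborel"
    by (auto simp: l2_eq_def sq_integrable_def)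
  have "AE x in lborel. AE y in lborel. f x * g y = f' x * g' y"
    using a unfolding l2_eq_def by (auto elim!: eventually_mono)
  moreover have "{z \<in> space (lborel \<Otimes>\<^sub>M lborel). f (fst z) * g (snd z) - f' (fst z) * g' (snd z) = 0}
      \<in> sets (lborel \<Otimes>\<^sub>M lborel)"
    by measurable
  ultimately have "AE z in lborel \<Otimes>\<^sub>M lborel. f (fst z) * g (snd z) = f' (fst z) * g' (snd z)"
    by (intro lborel_pair.AE_pair_measure) auto
  then have "AE z in lborel. f (fst z) * g (snd z) = f' (fst z) * g' (snd z)"
    by (simp only: lborel_prod)
  then show "l2_eq (\<lambda>(x, y). f x * g y) (\<lambda>(x, y). f' x * g' y)"
    using a sq by (auto simp: l2_eq_def case_prod_beta lborel_prod)
qed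

text \<open>The bounded operator on \<open>L\<^sup>2\<close> of the product that extends
  \<open>f \<otimes> g \<mapsto> A f \<otimes> B g\<close>; it exists for bounded \<open>A\<close> and \<open>B\<close>, and is unique because product
  vectors are total.\<close>
definition tensor_op ::
    "('a::euclidean_space L2 \<Rightarrow> 'a L2) \<Rightarrow> ('b::euclidean_space L2 \<Rightarrow> 'b L2)
      \<Rightarrow> ('a \<times> 'b) L2 \<Rightarrow> ('a \<times> 'b) L2" (infixr "\<otimes>\<^sub>o" 70) where
  "A \<otimes>\<^sub>o B = (THE T. bounded_op T \<and> (\<forall>f g. T (f \<otimes>\<^sub>v g) = A f \<otimes>\<^sub>v B g))"

definition coupling ::
    "('a::euclidean_space L2 \<Rightarrow> 'a L2) \<Rightarrow> ('b::euclidean_space L2 \<Rightarrow> 'b L2)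
      \<Rightarrow> (('a \<times> 'b) L2 \<Rightarrow> ('a \<times> 'b) L2) \<Rightarrow> bool" where
  "coupling R S Q \<longleftrightarrow> density_matrix Q \<and>
     (\<forall>A. bounded_op A \<longrightarrow> (\<exists>t. has_trace ((A \<otimes>\<^sub>o id) \<circ> Q) t \<and> has_trace (A \<circ> R) t)) \<and>
     (\<forall>B. bounded_op B \<longrightarrow> (\<exists>t. has_trace ((id \<otimes>\<^sub>o B) \<circ> Q) t \<and> has_trace (B \<circ> S) t))"


section \<open>Unbounded operators\<close>

text \<open>A possibly unbounded operator is identified with its graph.\<close>
type_synonym 'a graph_op = "('a L2 \<times> 'a L2) set"

definition adjoint_op :: "'a::euclidean_space graph_op \<Rightarrow> 'a graph_op" where
  "adjoint_op T = {(u, v). \<forall>(f, g)\<in>T. cinner u g = cinner v f}"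

definition pos_selfadjoint :: "'a::euclidean_space graph_op \<Rightarrow> bool" where
  "pos_selfadjoint T \<longleftrightarrow>
     closure (Domain T) = UNIV \<and> adjoint_op T = T \<and> (\<forall>(f, g)\<in>T. 0 \<le> Re (cinner f g))"

text \<open>The nonnegative self-adjoint \<open>D\<close> with \<open>D\<^sup>2 = T\<close>, domains included.\<close>
definition sqrt_op :: "'a::euclidean_space graph_op \<Rightarrow> 'a graph_op" where
  "sqrt_op T = (THE D. pos_selfadjoint D \<and> D O D = T)"

definition app_op :: "'a::euclidean_space graph_op \<Rightarrow> 'a L2 \<Rightarrow> 'a L2" where
  "app_op T f = (THE g. (f, g) \<in> T)"

text \<open>The trace of \<open>T\<^bsup>1/2\<^esup> Q T\<^bsup>1/2\<^esup>\<close> in \<open>[0, \<infinity>]\<close>, that is, of the nonnegative quadratic form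
  \<open>e \<mapsto> \<langle>T\<^bsup>1/2\<^esup> e, Q T\<^bsup>1/2\<^esup> e\<rangle>\<close> on the domain of \<open>T\<^bsup>1/2\<^esup>\<close>. The supremum runs over all finite
  orthonormal families of that domain: the sum over a single orthonormal basis contained in the
  domain may be finite although \<open>T\<^bsup>1/2\<^esup> Q T\<^bsup>1/2\<^esup>\<close> is not even bounded.\<close>
definition trace_sandwich ::
    "'a::euclidean_space graph_op \<Rightarrow> ('a L2 \<Rightarrow> 'a L2) \<Rightarrow> ennreal" where
  "trace_sandwich T Q =
     (let D = sqrt_op T in
      SUP F\<in>{F. finite F \<and> orthonormal F \<and> F \<subseteq> Domain D}.
        ennreal (\<Sum>e\<in>F. Re (cinner (app_op D e) (Q (app_op D e)))))"


section \<open>The quantum transport cost\<close>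

text \<open>The Schwartz space of \<open>\<real>\<^sup>2\<close>: the functions \<open>f1\<close> and \<open>f2\<close> are the partial derivatives.\<close>
coinductive schwartz :: "(real \<times> real \<Rightarrow> complex) \<Rightarrow> bool" where
  "\<lbrakk>\<forall>k. bounded (range (\<lambda>z. norm z ^ k *\<^sub>R f z));
    \<forall>z. (f has_derivative (\<lambda>h. fst h *\<^sub>R f1 z + snd h *\<^sub>R f2 z)) (at z);
    schwartz f1; schwartz f2\<rbrakk> \<Longrightarrow> schwartz f"

text \<open>\<open>\<partial>\<^sub>x - \<partial>\<^sub>y\<close>\<close>
definition rel_deriv :: "(real \<times> real \<Rightarrow> complex) \<Rightarrow> real \<times> real \<Rightarrow> complex" where
  "rel_deriv f z = frechet_derivative f (at z) (1, 0) - frechet_derivative f (at z) (0, 1)"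

definition cost_expr :: "real \<Rightarrow> (real \<times> real \<Rightarrow> complex) \<Rightarrow> real \<times> real \<Rightarrow> complex" where
  "cost_expr hbar f = (\<lambda>(x, y). of_real ((x - y)\<^sup>2) * f (x, y)
     - of_real (hbar\<^sup>2) * rel_deriv (rel_deriv f) (x, y) - of_real (2 * hbar) * f (x, y))"

text \<open>The differential expression is essentially self-adjoint on the Schwartz space; its
  self-adjoint realization is the closure.\<close>
definition cost_op :: "real \<Rightarrow> (real \<times> real) graph_op" where
  "cost_op hbar = closure {(abs_L2 f, abs_L2 (cost_expr hbar f)) | f. schwartz f}"

definition transport_cost :: "real \<Rightarrow> ((real \<times> real) L2 \<Rightarrow> (real \<times> real) L2) \<Rightarrow> ennreal" where
  "transport_cost hbar Q = trace_sandwich (cost_op hbar) Q"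

definition ennreal_sqrt :: "ennreal \<Rightarrow> ennreal" where
  "ennreal_sqrt x = (if x = \<infinity> then \<infinity> else ennreal (sqrt (enn2real x)))"

definition MK2 :: "real \<Rightarrow> (real L2 \<Rightarrow> real L2) \<Rightarrow> (real L2 \<Rightarrow> real L2) \<Rightarrow> ennreal" where
  "MK2 hbar R S = ennreal_sqrt (INF Q\<in>{Q. coupling R S Q}. transport_cost hbar Q)"


section \<open>Coherent states and Toeplitz operators\<close>

definition coherent :: "real \<Rightarrow> real \<times> real \<Rightarrow> real L2" where
  "coherent hbar = (\<lambda>(q, p). abs_L2 (\<lambda>x.
     of_real ((pi * hbar) powr (- 1 / 4)) * of_real (exp (- (x - q)\<^sup>2 / (2 * hbar)))
       * exp (\<i> * of_real (p * x / hbar))))"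

text \<open>\<open>|u\<rangle>\<langle>u|\<close>, the orthogonal projection onto the span of \<open>u\<close> if \<open>u\<close> is normalized.\<close>
definition ket_bra :: "'a::euclidean_space L2 \<Rightarrow> 'a L2 \<Rightarrow> 'a L2" where
  "ket_bra u f = cinner u f *\<^sub>C u"

text \<open>The operator-valued integral is understood weakly, through its matrix elements.\<close>
definition toeplitz_of ::
    "real \<Rightarrow> ((real \<times> real) \<times> (real \<times> real)) measure \<Rightarrow> ((real \<times> real) L2 \<Rightarrow> (real \<times> real) L2) \<Rightarrow> bool"
  where
  "toeplitz_of hbar \<mu> Q \<longleftrightarrow>
     (\<forall>F G. cinner F (Q G) =
       (\<integral>(z, z'). cinner F ((ket_bra (coherent hbar z) \<otimes>\<^sub>o ket_bra (coherent hbar z')) G) \<partial>\<mu>))"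

definition is_toeplitz :: "real \<Rightarrow> ((real \<times> real) L2 \<Rightarrow> (real \<times> real) L2) \<Rightarrow> bool" where
  "is_toeplitz hbar Q \<longleftrightarrow>
     (\<exists>\<mu>. prob_space \<mu> \<and> sets \<mu> = sets borel \<and> toeplitz_of hbar \<mu> Q)"

end

theory Submission
  imports Defs "HOL-Computational_Algebra.Polynomial"
begin

text \<open>Let \<open>u\<close> and \<open>v\<close> be the coherent states at \<open>(a, 0)\<close> and \<open>(- a, 0)\<close>.
  If a Toeplitz operator with measure \<open>\<mu>\<close> couples \<open>R\<close> and \<open>S\<close>, the marginal of \<open>\<mu>\<close> only charges
  phase space points whose coherent states lie in the span of \<open>u\<close> and \<open>v\<close>, that is, the two points
  themselves. Hence the operator is a mixture of the projections onto \<open>u \<otimes> u\<close>, \<open>u \<otimes> v\<close>,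
  \<open>v \<otimes> u\<close>, \<open>v \<otimes> v\<close>, and the marginals force weight at least \<open>\<eta>/2\<close> on \<open>u \<otimes> v\<close>. The cost
  operator annihilates \<open>u \<otimes> u\<close> and \<open>v \<otimes> v\<close> but not \<open>u \<otimes> v\<close>. As \<open>u\<close> and \<open>v\<close> are not orthogonal,
  off-diagonal terms with vanishing partial traces can lower the weight of \<open>u \<otimes> v\<close> below \<open>\<eta>/2\<close>,
  which gives a strictly cheaper coupling.

  The square root of the cost operator is accessible because the cost operator is diagonal in the
  basis of Hermite functions in \<open>x - y\<close> and \<open>x + y\<close>.\<close>

section \<open>The Hilbert space $L^2$ is complete\<close>

text \<open>\<open>sqrt_op\<close> is a definite description, so the cost of an operator can be
  evaluated only after a square root \<open>D\<close> of the cost has been exhibited and shown to be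
  unique. For a diagonal operator both follow from the eigenvectors alone.

  The two couplings are compared through one vector \<open>y\<close>, the image of u (x) v under
  \<open>D\<close>; its norm is 2a. Since \<open>D\<close> annihilates u (x) u and v (x) v, the form
  of the competitor at D e is \<open>(\<eta> / 2 - 2 * \<tau> * s\<^sup>2)\<close> times |<y, e>|^2,
  and Bessel's inequality bounds all finite orthonormal families at once. For the Toeplitz coupling
  a lower bound suffices, and the family consisting of y / |y| alone gives \<open>\<eta> / 2\<close>
  times |y|^2. It is admissible because u (x) v lies in the domain of the cost itself, so that y is
  again in the domain of \<open>D\<close>.

  The support of the measure is located by an explicit test vector orthogonal to u and v, a
  quadratic polynomial times a Gaussian. Its overlap with a coherent state is, up to a nonvanishing
  factor, a quadratic polynomial in q - i p, whose only zeros are the two given points.\<close>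

lemma sq_integrable_rep: "sq_integrable (rep_L2 f)"
  using Quotient3_rep_reflp[OF Quotient3_L2] by (simp add: l2_eq_def)

lemma abs_rep_L2 [simp]: "abs_L2 (rep_L2 f) = f"
  by (rule Quotient3_abs_rep[OF Quotient3_L2])

lemma abs_L2_eq_iff:
  assumes "sq_integrable f" "sq_integrable g"
  shows "abs_L2 f = abs_L2 g \<longleftrightarrow> (AE x in lborel. f x = g x)"
  using Quotient3_rel[OF Quotient3_L2, of f g] assms by (auto simp: l2_eq_def)

lemma cinner_abs:
  assumes "sq_integrable f" "sq_integrable g"
  shows "cinner (abs_L2 f) (abs_L2 g) = (\<integral>x. cnj (f x) * g x \<partial>lborel)"
  using assms by (intro cinner.abs_eq) (auto simp: l2_eq_refl)

lemma add_abs: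
  assumes "sq_integrable f" "sq_integrable g"
  shows "abs_L2 f + abs_L2 g = abs_L2 (\<lambda>x. f x + g x)"
  using assms by (intro plus_L2.abs_eq) (auto simp: l2_eq_refl)

lemma scaleC_abs:
  assumes "sq_integrable f"
  shows "c *\<^sub>C abs_L2 f = abs_L2 (\<lambda>x. c * f x)"
  using assms by (intro scaleC.abs_eq) (auto simp: l2_eq_refl)

lemma sq_integrable_diff:
  assumes "sq_integrable f" "sq_integrable g"
  shows "sq_integrable (\<lambda>x. f x - g x)"
  using sq_integrable_add[OF assms(1) sq_integrable_scale[OF assms(2), of "-1"]] by simp

lemma diff_abs:
  assumes "sq_integrable f" "sq_integrable g"
  shows "abs_L2 f - abs_L2 g = abs_L2 (\<lambda>x. f x - g x)"
  unfolding minus_L2_def using assms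
  by (simp add: scaleC_abs add_abs sq_integrable_scale[of g "-1", simplified])

lemma zero_abs: "(0 :: 'a::euclidean_space L2) = abs_L2 (\<lambda>x. 0)"
  by (rule zero_L2.abs_eq)

lemma cinner_commute: "cinner b a = cnj (cinner a b)"
proof transfer
  fix f g :: "'a \<Rightarrow> complex"
  have "(\<lambda>x. cnj (g x) * f x) = (\<lambda>x. cnj (cnj (f x) * g x))"
    by (simp add: mult.commute)
  then show "(\<integral>x. cnj (g x) * f x \<partial>lborel) = cnj (\<integral>x. cnj (f x) * g x \<partial>lborel)"
    by (simp only: Bochner_Integration.integral_cnj)
qed

lemma cinner_add_right: "cinner a (b + c) = cinner a b + cinner a c"
  by transfer (simp add: ring_distribs l2_eq_def sq_integrable_mult)

lemma cinner_add_left: "cinner (a + b) c = cinner a c + cinner b c"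
  by (metis cinner_commute cinner_add_right complex_cnj_add)

lemma cinner_scaleC_right: "cinner a (k *\<^sub>C b) = k * cinner a b"
proof transfer
  fix f g :: "'a \<Rightarrow> complex" and k
  have "(\<lambda>x. cnj (f x) * (k * g x)) = (\<lambda>x. k * (cnj (f x) * g x))"
    by (simp add: mult.left_commute)
  then show "(\<integral>x. cnj (f x) * (k * g x) \<partial>lborel) = k * (\<integral>x. cnj (f x) * g x \<partial>lborel)"
    by simp
qed

lemma cinner_scaleC_left: "cinner (k *\<^sub>C a) b = cnj k * cinner a b"
  by (metis cinner_commute cinner_scaleC_right complex_cnj_mult)

lemma scaleR_scaleC: "r *\<^sub>R a = complex_of_real r *\<^sub>C a"
  by (rule scaleR_L2_def)

lemma uminus_scaleC: "- a = (- 1) *\<^sub>C a"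
  by (rule uminus_L2_def)

lemma cinner_scaleR_right: "cinner a (r *\<^sub>R b) = of_real r * cinner a b"
  by (simp add: scaleR_scaleC cinner_scaleC_right)

lemma cinner_scaleR_left: "cinner (r *\<^sub>R a) b = of_real r * cinner a b"
  by (simp add: scaleR_scaleC cinner_scaleC_left)

lemma cinner_minus_right: "cinner a (- b) = - cinner a b"
  by (simp add: uminus_scaleC cinner_scaleC_right)

lemma cinner_minus_left: "cinner (- a) b = - cinner a b"
  by (simp add: uminus_scaleC cinner_scaleC_left)

lemma cinner_diff_right: "cinner a (b - c) = cinner a b - cinner a c"
  using cinner_add_right[of a b "- c"] by (simp add: cinner_minus_right)

lemma cinner_diff_left: "cinner (a - b) c = cinner a c - cinner b c"
  using cinner_add_left[of a "- b" c] by (simp add: cinner_minus_left)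

lemma cinner_zero_right [simp]: "cinner a 0 = 0"
  using cinner_add_right[of a 0 0] by simp

lemma cinner_zero_left [simp]: "cinner 0 a = 0"
  using cinner_add_left[of 0 0 a] by simp

lemmas cinner_simps = cinner_add_right cinner_add_left cinner_scaleC_right cinner_scaleC_left
  cinner_scaleR_right cinner_scaleR_left cinner_minus_right cinner_minus_left
  cinner_diff_right cinner_diff_left

lemma Re_cinner: "Re (cinner a b) = inner a b"
  by (simp add: inner_L2_def)

lemma cinner_self: "cinner a a = of_real ((norm a)\<^sup>2)"
proof -
  have "Im (cinner a a) = 0"
    using arg_cong[OF cinner_commute[of a a], of Im] by simp
  then show ?thesis
    by (simp add: complex_eq_iff Re_cinner power2_norm_eq_inner del: of_real_power)
qed

lemma scaleC_one [simp]: "1 *\<^sub>C a = a"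
  using scaleR_scaleC[of 1 a] by simp

lemma scaleC_scaleC: "k *\<^sub>C l *\<^sub>C a = (k * l) *\<^sub>C a"
  by transfer (auto simp: l2_eq_def mult.assoc intro!: sq_integrable_scale)

lemma scaleC_add_right: "k *\<^sub>C (a + b) = k *\<^sub>C a + k *\<^sub>C b"
  by transfer (auto simp: l2_eq_def ring_distribs intro!: sq_integrable_add sq_integrable_scale)

lemma scaleC_add_left: "(k + l) *\<^sub>C a = k *\<^sub>C a + l *\<^sub>C a"
  by transfer (auto simp: l2_eq_def ring_distribs intro!: sq_integrable_add sq_integrable_scale)

lemma scaleC_zero_left [simp]: "0 *\<^sub>C a = 0"
  using scaleR_scaleC[of 0 a] by simp

lemma scaleC_zero_right [simp]: "k *\<^sub>C 0 = 0"
  using scaleC_add_right[of k 0 0] by simp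

lemma scaleR_scaleC_commute: "r *\<^sub>R k *\<^sub>C a = k *\<^sub>C r *\<^sub>R a"
  by (simp add: scaleR_scaleC scaleC_scaleC mult.commute)

lemma norm_scaleC: "norm (k *\<^sub>C a) = cmod k * norm a"
proof -
  have "complex_of_real ((norm (k *\<^sub>C a))\<^sup>2) = of_real ((cmod k * norm a)\<^sup>2)"
    unfolding cinner_self[symmetric] power_mult_distrib of_real_mult complex_norm_square
    by (simp add: cinner_simps cinner_self[of a, unfolded complex_norm_square[symmetric]] mult_ac)
  then have "(norm (k *\<^sub>C a))\<^sup>2 = (cmod k * norm a)\<^sup>2"
    using of_real_eq_iff by blast
  then show ?thesis
    by (simp add: power2_eq_iff_nonneg)
qed

text \<open>Multiplying \<open>b\<close> by a phase makes the inner product real and nonnegative,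
  which reduces the claim to Cauchy-Schwarz for the real inner product of the type class.\<close>

lemma norm_cinner_le: "cmod (cinner a b) \<le> norm a * norm b"
proof -
  obtain k where k: "cmod k = 1" "k * cinner a b = of_real (cmod (cinner a b))"
  proof (cases "cinner a b = 0")
    case True
    then show ?thesis using that[of 1] by simp
  next
    case False
    define k where "k = cnj (cinner a b) / of_real (cmod (cinner a b))"
    have "cnj (cinner a b) * cinner a b = of_real (cmod (cinner a b)) * of_real (cmod (cinner a b))"
      by (subst mult.commute) (simp add: complex_norm_square[symmetric] power2_eq_square)
    then have "k * cinner a b = of_real (cmod (cinner a b))"
      using False by (simp add: k_def field_simps)
    moreover have "cmod k = 1"
      using False by (simp add: k_def norm_divide)
    ultimately show ?thesis using that by blast
  qed
  have "cmod (cinner a b) = inner a (k *\<^sub>C b)"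
    by (simp add: inner_L2_def cinner_scaleC_right k)
  also have "\<dots> \<le> norm a * norm b"
    using norm_cauchy_schwarz[of a "k *\<^sub>C b"] by (simp add: norm_scaleC k)
  finally show ?thesis .
qed

lemma bounded_linear_cinner_right: "bounded_linear (cinner a)"
  by (rule bounded_linear_intro[where K = "norm a"])
    (simp_all add: cinner_simps norm_cinner_le scaleR_conv_of_real mult.commute[of _ "norm a"])

lemma bounded_linear_cinner_left: "bounded_linear (\<lambda>a. cinner a b)"
  by (rule bounded_linear_intro[where K = "norm b"])
    (simp_all add: cinner_simps norm_cinner_le scaleR_conv_of_real)

lemma cinner_sum_right: "cinner a (\<Sum>i\<in>I. f i) = (\<Sum>i\<in>I. cinner a (f i))"
  by (rule linear_sum[OF bounded_linear.linear[OF bounded_linear_cinner_right]])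

lemma cinner_sum_left: "cinner (\<Sum>i\<in>I. f i) a = (\<Sum>i\<in>I. cinner (f i) a)"
  by (rule linear_sum[OF bounded_linear.linear[OF bounded_linear_cinner_left]])

section \<open>Completeness by the Riesz-Fischer argument\<close>

lemma nn_integral_norm_L2:
  assumes "sq_integrable f"
  shows "(\<integral>\<^sup>+x. ennreal ((cmod (f x))\<^sup>2) \<partial>lborel) = ennreal ((norm (abs_L2 f))\<^sup>2)"
proof -
  have "of_real ((norm (abs_L2 f))\<^sup>2) = (\<integral>x. complex_of_real ((cmod (f x))\<^sup>2) \<partial>lborel)"
    unfolding cinner_self[symmetric] cinner_abs[OF assms assms]
    by (intro Bochner_Integration.integral_cong refl)
       (subst mult.commute, simp add: complex_norm_square[symmetric] del: of_real_power)
  then have "(norm (abs_L2 f))\<^sup>2 = (\<integral>x. (cmod (f x))\<^sup>2 \<partial>lborel)"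
    using of_real_eq_iff by (metis integral_complex_of_real)
  then show ?thesis
    using assms by (subst nn_integral_eq_integral) (auto simp: sq_integrable_def)
qed

lemma sq_integrable_iff_nn_integral:
  assumes [measurable]: "f \<in> borel_measurable lborel"
  shows "sq_integrable f \<longleftrightarrow> (\<integral>\<^sup>+x. ennreal ((cmod (f x))\<^sup>2) \<partial>lborel) < \<infinity>"
  unfolding sq_integrable_def by (auto simp: integrable_iff_bounded)

text \<open>The weights make \<open>d\<close> decay like the k-th power of 1 / sqrt 2. Weighted
  squares can be integrated term by term, so this yields pointwise summability without a triangle
  inequality for infinite sums of norms.\<close>

lemma summable_of_weighted_squares:
  fixes d :: "nat \<Rightarrow> complex"
  assumes "(\<Sum>k. ennreal (2 ^ k * (cmod (d k))\<^sup>2)) < \<infinity>"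
  shows "summable d"
proof -
  have s: "summable (\<lambda>k. 2 ^ k * (cmod (d k))\<^sup>2)"
    using assms by (intro summable_suminf_not_top) auto
  obtain M where M: "\<And>k. norm (2 ^ k * (cmod (d k))\<^sup>2) \<le> M"
    using BseqE[OF summable_imp_Bseq[OF s]] by blast
  have "norm (d k) \<le> sqrt M * (1 / sqrt 2) ^ k" for k
  proof -
    have "2 ^ k * (cmod (d k))\<^sup>2 \<le> M"
      using M[of k] by simp
    then have "(cmod (d k))\<^sup>2 \<le> M / 2 ^ k"
      by (simp add: pos_le_divide_eq mult.commute)
    then have "cmod (d k) \<le> sqrt (M / 2 ^ k)"
      by (simp add: real_le_rsqrt)
    then show ?thesis
      by (simp add: real_sqrt_divide real_sqrt_power power_divide)
  qed
  then show ?thesis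
    by (intro summable_comparison_test'[OF summable_mult[OF summable_geometric], of "1 / sqrt 2" 0 d "sqrt M"])
      auto
qed

text \<open>The squared increments are at most \<open>(1 / 4) ^ k\<close>, so they remain summable
  after weighting by \<open>2 ^ k\<close>. The representatives therefore converge almost everywhere,
  and the pointwise limit is the limit in norm.\<close>

lemma fast_Cauchy_convergent_L2:
  fixes X :: "nat \<Rightarrow> 'a::euclidean_space L2"
  assumes fast: "\<And>k m. k \<le> m \<Longrightarrow> norm (X m - X k) \<le> (1 / 2) ^ k"
  shows "convergent X"
proof -
  define g where "g k = rep_L2 (X k)" for k
  have sq: "sq_integrable (g k)" for k
    by (simp add: g_def sq_integrable_rep)
  then have [measurable]: "g k \<in> borel_measurable lborel" for k
    by (simp add: sq_integrable_def)
  have X: "X k = abs_L2 (g k)" for k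
    by (simp add: g_def)
  have nn: "(\<integral>\<^sup>+x. ennreal ((cmod (g m x - g k x))\<^sup>2) \<partial>lborel) = ennreal ((norm (X m - X k))\<^sup>2)" for m k
    unfolding X diff_abs[OF sq sq] by (rule nn_integral_norm_L2[OF sq_integrable_diff[OF sq sq]])
  have "(\<integral>\<^sup>+x. (\<Sum>k. ennreal (2 ^ k * (cmod (g (Suc k) x - g k x))\<^sup>2)) \<partial>lborel)
      = (\<Sum>k. ennreal (2 ^ k) * ennreal ((norm (X (Suc k) - X k))\<^sup>2))"
    by (subst nn_integral_suminf) (auto simp: ennreal_mult nn_integral_cmult nn)
  also have "\<dots> \<le> (\<Sum>k. ennreal ((1 / 2) ^ k))"
  proof (rule suminf_le)
    show "ennreal (2 ^ k) * ennreal ((norm (X (Suc k) - X k))\<^sup>2) \<le> ennreal ((1 / 2) ^ k)" for k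
    proof -
      have "2 ^ k * (norm (X (Suc k) - X k))\<^sup>2 \<le> 2 ^ k * ((1 / 2) ^ k)\<^sup>2"
        using fast[of k "Suc k"] by (intro mult_left_mono power_mono) auto
      also have "\<dots> = (1 / 2) ^ k"
        by (simp add: power2_eq_square field_simps)
      finally show ?thesis
        by (simp add: ennreal_mult[symmetric] ennreal_leI)
    qed
  qed auto
  also have "\<dots> < \<infinity>"
    by (subst suminf_ennreal2) (auto simp: summable_geometric)
  finally have "AE x in lborel. (\<Sum>k. ennreal (2 ^ k * (cmod (g (Suc k) x - g k x))\<^sup>2)) \<noteq> \<infinity>"
    by (intro nn_integral_PInf_AE) auto
  then have "AE x in lborel. convergent (\<lambda>k. g k x)"
  proof eventually_elim
    case (elim x)
    then have "summable (\<lambda>k. g (Suc k) x - g k x)"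
      by (intro summable_of_weighted_squares) (simp add: less_top)
    then have "convergent (\<lambda>n. \<Sum>k<n. g (Suc k) x - g k x)"
      by (simp add: summable_iff_convergent)
    then have "convergent (\<lambda>n. g n x - g 0 x)"
      by (simp add: sum_lessThan_telescope[where f = "\<lambda>k. g k x"])
    then show ?case
      using convergent_add[OF _ convergent_const[of "g 0 x"]] by fastforce
  qed
  then have lim: "AE x in lborel. (\<lambda>k. g k x) \<longlonglongrightarrow> lim (\<lambda>k. g k x)"
    by eventually_elim (simp add: convergent_LIMSEQ_iff)
  define h where "h x = lim (\<lambda>k. g k x)" for x
  have [measurable]: "h \<in> borel_measurable lborel"
    unfolding h_def by measurable
  \<comment> \<open>Fatou's lemma in \<open>m\<close> carries the Cauchy bound over to the limit. It
    yields both that \<open>h\<close> is square integrable and the rate of convergence.\<close>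
  have bound: "(\<integral>\<^sup>+x. ennreal ((cmod (h x - g k x))\<^sup>2) \<partial>lborel) \<le> ennreal (((1 / 2) ^ k)\<^sup>2)" for k
  proof -
    have "(\<integral>\<^sup>+x. ennreal ((cmod (h x - g k x))\<^sup>2) \<partial>lborel)
        = (\<integral>\<^sup>+x. liminf (\<lambda>m. ennreal ((cmod (g m x - g k x))\<^sup>2)) \<partial>lborel)"
    proof (rule nn_integral_cong_AE)
      show "AE x in lborel. ennreal ((cmod (h x - g k x))\<^sup>2)
          = liminf (\<lambda>m. ennreal ((cmod (g m x - g k x))\<^sup>2))"
        using lim
      proof eventually_elim
        case (elim x)
        then have "(\<lambda>m. ennreal ((cmod (g m x - g k x))\<^sup>2)) \<longlonglongrightarrow> ennreal ((cmod (h x - g k x))\<^sup>2)"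
          unfolding h_def by (intro tendsto_intros tendsto_ennrealI)
        then show ?case
          by (intro lim_imp_Liminf[symmetric]) auto
      qed
    qed
    also have "\<dots> \<le> liminf (\<lambda>m. \<integral>\<^sup>+x. ennreal ((cmod (g m x - g k x))\<^sup>2) \<partial>lborel)"
      by (rule nn_integral_liminf) auto
    also have "\<dots> \<le> liminf (\<lambda>m. ennreal (((1 / 2) ^ k)\<^sup>2))"
      unfolding nn by (intro Liminf_mono eventually_sequentiallyI[of k] ennreal_leI power_mono fast) auto
    also have "\<dots> = ennreal (((1 / 2) ^ k)\<^sup>2)"
      by (simp add: Liminf_const)
    finally show ?thesis .
  qed
  have sqd: "sq_integrable (\<lambda>x. h x - g k x)" for k
    using bound[of k] by (subst sq_integrable_iff_nn_integral) (auto intro: le_less_trans)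
  then have sqh: "sq_integrable h"
    using sq_integrable_add[OF sqd[of 0] sq[of 0]] by simp
  have le: "norm (X k - abs_L2 h) \<le> (1 / 2) ^ k" for k
  proof -
    have "ennreal ((norm (abs_L2 h - X k))\<^sup>2) \<le> ennreal (((1 / 2) ^ k)\<^sup>2)"
      using bound[of k] unfolding X diff_abs[OF sqh sq] nn_integral_norm_L2[OF sqd] .
    then have "norm (abs_L2 h - X k) \<le> (1 / 2) ^ k"
      by (subst (asm) ennreal_le_iff) (auto simp: power2_le_iff_abs_le)
    then show ?thesis
      by (simp add: norm_minus_commute)
  qed
  have "(\<lambda>k. (1 / 2 :: real) ^ k) \<longlonglongrightarrow> 0"
    by (simp add: LIMSEQ_power_zero)
  then have "(\<lambda>k. X k - abs_L2 h) \<longlonglongrightarrow> 0"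
    by (rule Lim_null_comparison[OF always_eventually[OF allI[OF le]]])
  then show ?thesis
    using LIM_zero_iff convergent_def by blast
qed

instance L2 :: (euclidean_space) banach
proof
  fix X :: "nat \<Rightarrow> 'a L2"
  assume C: "Cauchy X"
  have "\<exists>N. \<forall>m\<ge>N. \<forall>n\<ge>N. norm (X m - X n) < (1 / 2) ^ k" for k
    using C by (intro CauchyD) auto
  then obtain N where N: "\<And>k m n. m \<ge> N k \<Longrightarrow> n \<ge> N k \<Longrightarrow> norm (X m - X n) < (1 / 2) ^ k"
    by metis
  \<comment> \<open>The sum dominates each \<open>N i\<close> with \<open>i \<le> k\<close>, and the
    summand \<open>k\<close> makes \<open>r\<close> strictly increasing.\<close>
  define r where "r k = (\<Sum>i\<le>k. N i) + k" for k
  have r: "strict_mono r"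
    by (rule strict_monoI_Suc) (simp add: r_def)
  have rN: "r m \<ge> N k" if "k \<le> m" for k m
    using member_le_sum[of k "{..m}" N] that by (simp add: r_def)
  have "convergent (X \<circ> r)"
    by (rule fast_Cauchy_convergent_L2) (auto intro!: less_imp_le N rN)
  then obtain l where "(X \<circ> r) \<longlonglongrightarrow> l"
    by (auto simp: convergent_def)
  then have "X \<longlonglongrightarrow> l"
    by (rule Cauchy_converges_subseq[OF C r])
  then show "convergent X"
    by (auto simp: convergent_def)
qed

section \<open>Orthonormal bases and traces\<close>

lemma orthonormal_subset: "orthonormal B \<Longrightarrow> F \<subseteq> B \<Longrightarrow> orthonormal F"
  unfolding orthonormal_def by blast

lemma orthonormalD: "orthonormal B \<Longrightarrow> e \<in> B \<Longrightarrow> f \<in> B \<Longrightarrow> cinner e f = (if e = f then 1 else 0)"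
  by (auto simp: orthonormal_def)

lemma orthonormal_norm: "orthonormal B \<Longrightarrow> e \<in> B \<Longrightarrow> norm e = 1"
  using orthonormalD[of B e e] cinner_self[of e]
  by (metis norm_ge_zero of_real_eq_1_iff one_power2 power2_eq_imp_eq zero_le_one)

lemma cinner_orthonormal_sum:
  assumes "orthonormal F" "finite F" "e \<in> F"
  shows "cinner e (\<Sum>x\<in>F. c x *\<^sub>C x) = c e"
proof -
  have "cinner e (\<Sum>x\<in>F. c x *\<^sub>C x) = (\<Sum>x\<in>F. if x = e then c x else 0)"
    unfolding cinner_sum_right using assms
    by (intro sum.cong refl) (auto simp: cinner_simps orthonormalD)
  then show ?thesis
    using assms by simp
qed

lemma norm_orthonormal_sum:
  assumes "orthonormal F" "finite F"
  shows "(norm (\<Sum>x\<in>F. c x *\<^sub>C x))\<^sup>2 = (\<Sum>x\<in>F. (cmod (c x))\<^sup>2)"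
proof -
  have "complex_of_real ((norm (\<Sum>x\<in>F. c x *\<^sub>C x))\<^sup>2)
      = (\<Sum>x\<in>F. cnj (c x) * cinner x (\<Sum>x\<in>F. c x *\<^sub>C x))"
    unfolding cinner_self[symmetric] cinner_sum_left by (simp add: cinner_simps)
  also have "\<dots> = (\<Sum>x\<in>F. complex_of_real ((cmod (c x))\<^sup>2))"
    using assms
    by (intro sum.cong refl) (simp add: cinner_orthonormal_sum complex_norm_square mult.commute del: of_real_power)
  finally show ?thesis
    by (simp only: of_real_sum[symmetric] of_real_eq_iff)
qed

lemma bessel:
  assumes "orthonormal F" "finite F"
  shows "(\<Sum>e\<in>F. (cmod (cinner e f))\<^sup>2) \<le> (norm f)\<^sup>2"
proof -
  define g where "g = (\<Sum>e\<in>F. cinner e f *\<^sub>C e)"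
  have g: "cinner g h = (\<Sum>e\<in>F. cnj (cinner e f) * cinner e h)" for h
    by (simp add: g_def cinner_sum_left cinner_simps)
  have "cinner e (f - g) = 0" if "e \<in> F" for e
    using that assms by (simp add: g_def cinner_simps cinner_orthonormal_sum)
  then have "cinner g (f - g) = 0"
    unfolding g by (intro sum.neutral) simp
  then have "inner g (f - g) = 0"
    by (simp add: inner_L2_def)
  then have "(norm f)\<^sup>2 = (norm g)\<^sup>2 + (norm (f - g))\<^sup>2"
    unfolding power2_norm_eq_inner by (simp add: inner_diff_left inner_diff_right inner_commute)
  then show ?thesis
    using norm_orthonormal_sum[OF assms, of "\<lambda>e. cinner e f"] by (simp add: g_def)
qed

text \<open>By Pythagoras the squared norm of a finite partial sum is the sum of the squared
  coefficients, so the net of partial sums is Cauchy. Nets over finite subsets are used since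
  \<open>B\<close> is an unordered set.\<close>

lemma orthonormal_summable:
  assumes B: "orthonormal B" and c: "(\<lambda>e. (cmod (c e))\<^sup>2) summable_on B"
  shows "(\<lambda>e. c e *\<^sub>C e) summable_on B"
proof -
  have "\<exists>P. eventually P (finite_subsets_at_top B) \<and>
      (\<forall>F G. P F \<and> P G \<longrightarrow> dist (\<Sum>e\<in>F. c e *\<^sub>C e) (\<Sum>e\<in>G. c e *\<^sub>C e) < \<epsilon>)" if "\<epsilon> > 0" for \<epsilon>
  proof -
    from c obtain s where "((\<lambda>e. (cmod (c e))\<^sup>2) has_sum s) B"
      by (auto simp: summable_on_def)
    \<comment> \<open>Two partial sums this close to \<open>s\<close> differ by less than
      \<open>(\<epsilon> / 2)\<^sup>2\<close>, which bounds a squared norm and so gives distance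
      \<open>\<epsilon> / 2\<close> after taking the root.\<close>
    then have "eventually (\<lambda>F. dist (\<Sum>e\<in>F. (cmod (c e))\<^sup>2) s < (\<epsilon> / 2)\<^sup>2 / 2) (finite_subsets_at_top B)"
      unfolding has_sum_def using that by (intro tendstoD) auto
    then have "\<exists>F0. finite F0 \<and> F0 \<subseteq> B \<and> (\<forall>F. finite F \<and> F0 \<subseteq> F \<and> F \<subseteq> B \<longrightarrow>
        dist (\<Sum>e\<in>F. (cmod (c e))\<^sup>2) s < (\<epsilon> / 2)\<^sup>2 / 2)"
      unfolding eventually_finite_subsets_at_top .
    then obtain F0 where F0: "finite F0" "F0 \<subseteq> B"
      and close: "\<And>F. finite F \<Longrightarrow> F0 \<subseteq> F \<Longrightarrow> F \<subseteq> B \<Longrightarrow>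
          dist (\<Sum>e\<in>F. (cmod (c e))\<^sup>2) s < (\<epsilon> / 2)\<^sup>2 / 2"
      by metis
    have near: "dist (\<Sum>e\<in>F. c e *\<^sub>C e) (\<Sum>e\<in>F0. c e *\<^sub>C e) < \<epsilon> / 2"
      if F: "finite F" "F0 \<subseteq> F" "F \<subseteq> B" for F
    proof -
      have "(norm (\<Sum>e\<in>F - F0. c e *\<^sub>C e))\<^sup>2 = (\<Sum>e\<in>F - F0. (cmod (c e))\<^sup>2)"
        using F B by (intro norm_orthonormal_sum) (auto intro: orthonormal_subset)
      also have "\<dots> = (\<Sum>e\<in>F. (cmod (c e))\<^sup>2) - (\<Sum>e\<in>F0. (cmod (c e))\<^sup>2)"
        using F by (simp add: sum_diff)
      also have "\<dots> < (\<epsilon> / 2)\<^sup>2"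
        using close[OF F] close[OF F0(1) order_refl F0(2)] unfolding dist_real_def by linarith
      finally have "norm (\<Sum>e\<in>F - F0. c e *\<^sub>C e) < \<epsilon> / 2"
        using \<open>\<epsilon> > 0\<close> by (intro power2_less_imp_less[of _ "\<epsilon> / 2"]) auto
      then show ?thesis
        using F by (simp add: dist_norm sum_diff)
    qed
    show ?thesis
    proof (intro exI[of _ "\<lambda>F. finite F \<and> F0 \<subseteq> F \<and> F \<subseteq> B"] conjI allI impI)
      show "eventually (\<lambda>F. finite F \<and> F0 \<subseteq> F \<and> F \<subseteq> B) (finite_subsets_at_top B)"
        using F0 unfolding eventually_finite_subsets_at_top by blast
      fix F G assume "(finite F \<and> F0 \<subseteq> F \<and> F \<subseteq> B) \<and> (finite G \<and> F0 \<subseteq> G \<and> G \<subseteq> B)"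
      then show "dist (\<Sum>e\<in>F. c e *\<^sub>C e) (\<Sum>e\<in>G. c e *\<^sub>C e) < \<epsilon>"
        by (intro dist_triangle_half_l[OF near near]) auto
    qed
  qed
  then have "cauchy_filter (filtermap (sum (\<lambda>e. c e *\<^sub>C e)) (finite_subsets_at_top B))"
    by (simp add: cauchy_filter_metric_filtermap)
  moreover have "uniform_space_class.complete (UNIV :: 'a L2 set)"
    by (meson Cauchy_convergent UNIV_I complete_def convergent_def)
  ultimately obtain L where "(sum (\<lambda>e. c e *\<^sub>C e) \<longlongrightarrow> L) (finite_subsets_at_top B)"
    using complete_uniform[where S = "UNIV :: 'a L2 set"] by (force simp add: filterlim_def)
  then show ?thesis
    using summable_on_def has_sum_def by blast
qed

lemma cinner_orthonormal_has_sum: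
  assumes "orthonormal B" "((\<lambda>e. c e *\<^sub>C e) has_sum g) B" "e \<in> B"
  shows "cinner e g = c e"
proof -
  have "((\<lambda>x. cinner e (c x *\<^sub>C x)) has_sum cinner e g) B"
    using has_sum_bounded_linear[OF bounded_linear_cinner_right assms(2)] .
  moreover have "((\<lambda>x. cinner e (c x *\<^sub>C x)) has_sum c e) B"
    by (rule has_sum_finite_neutralI[of "{e}"])
      (use assms in \<open>auto simp: cinner_simps orthonormalD\<close>)
  ultimately show ?thesis
    by (rule has_sum_unique)
qed

lemma riesz_fischer:
  assumes "orthonormal B" "(\<lambda>e. (cmod (c e))\<^sup>2) summable_on B"
  obtains g where "((\<lambda>e. c e *\<^sub>C e) has_sum g) B" "\<And>e. e \<in> B \<Longrightarrow> cinner e g = c e"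
  using orthonormal_summable[OF assms] cinner_orthonormal_has_sum[OF assms(1)]
  by (auto simp: summable_on_def)

lemma bessel_summable:
  assumes "orthonormal B"
  shows "(\<lambda>e. (cmod (cinner e f))\<^sup>2) summable_on B"
  by (rule nonneg_bdd_above_summable_on)
    (auto intro!: bdd_aboveI[of _ "(norm f)\<^sup>2"] bessel orthonormal_subset[OF assms])

lemma onb_orthonormal: "orthonormal_basis B \<Longrightarrow> orthonormal B"
  by (simp add: orthonormal_basis_def)

lemma onb_eqI:
  assumes "orthonormal_basis B" "\<And>e. e \<in> B \<Longrightarrow> cinner e f = cinner e g"
  shows "f = g"
proof -
  have "f - g = 0"
    using assms unfolding orthonormal_basis_def by (metis cinner_diff_right eq_iff_diff_eq_0)
  then show ?thesis by simp
qed

lemma onb_expansion: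
  assumes "orthonormal_basis B"
  shows "((\<lambda>e. cinner e f *\<^sub>C e) has_sum f) B"
proof -
  obtain g where g: "((\<lambda>e. cinner e f *\<^sub>C e) has_sum g) B" "\<And>e. e \<in> B \<Longrightarrow> cinner e g = cinner e f"
    using riesz_fischer[OF onb_orthonormal[OF assms] bessel_summable[OF onb_orthonormal[OF assms]]] by blast
  then show ?thesis
    using onb_eqI[OF assms g(2)] by simp
qed

lemma parseval:
  assumes "orthonormal_basis B"
  shows "((\<lambda>e. cinner f e * cinner e g) has_sum cinner f g) B"
  using has_sum_bounded_linear[OF bounded_linear_cinner_right[of f] onb_expansion[OF assms, of g]]
  by (simp add: cinner_simps mult.commute)

lemma orthonormal_empty: "orthonormal {}"
  by (simp add: orthonormal_def)

lemma orthonormal_singleton: "norm e = 1 \<Longrightarrow> orthonormal {e}"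
  by (simp add: orthonormal_def cinner_self)

lemma orthonormal_insert:
  assumes "orthonormal B" "norm e = 1" "\<And>f. f \<in> B \<Longrightarrow> cinner f e = 0"
  shows "orthonormal (insert e B)"
  unfolding orthonormal_def
proof (intro ballI)
  fix x y assume *: "x \<in> insert e B" "y \<in> insert e B"
  have e: "e \<notin> B"
    using assms(2) assms(3)[of e] by (auto simp: cinner_self)
  have "cinner e f = 0" if "f \<in> B" for f
    using assms(3)[OF that] cinner_commute[of e f] by simp
  then show "cinner x y = (if x = y then 1 else 0)"
    using * e assms by (auto simp: cinner_self orthonormalD orthonormal_norm)
qed

text \<open>A maximal orthonormal set is a basis, since a nonzero vector orthogonal to it could be
  normalised and added. Used with the empty set for the existence of a basis, and with a singleton
  for a basis adapted to a given unit vector.\<close>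

lemma orthonormal_extend_basis:
  fixes A :: "'a::euclidean_space L2 set"
  assumes "orthonormal A"
  obtains B where "A \<subseteq> B" "orthonormal_basis B"
proof -
  have "\<exists>M\<in>{B. orthonormal B \<and> A \<subseteq> B}. \<forall>X\<in>{B. orthonormal B \<and> A \<subseteq> B}. M \<subseteq> X \<longrightarrow> X = M"
  proof (rule subset_Zorn_nonempty)
    show "{B. orthonormal B \<and> A \<subseteq> B} \<noteq> {}"
      using assms by blast
    fix C assume C: "C \<noteq> {}" "subset.chain {B. orthonormal B \<and> A \<subseteq> B} C"
    have "orthonormal (\<Union>C)"
      unfolding orthonormal_def
    proof (intro ballI)
      fix e f assume "e \<in> \<Union>C" "f \<in> \<Union>C"
      then obtain X where "X \<in> C" "e \<in> X" "f \<in> X"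
        using C(2) unfolding subset_chain_def by blast
      then show "cinner e f = (if e = f then 1 else 0)"
        using C(2) orthonormalD[of X e f] unfolding subset_chain_def by blast
    qed
    then show "\<Union>C \<in> {B. orthonormal B \<and> A \<subseteq> B}"
      using C unfolding subset_chain_def by blast
  qed
  then obtain M where M: "orthonormal M" "A \<subseteq> M"
    and max: "\<And>X. orthonormal X \<Longrightarrow> M \<subseteq> X \<Longrightarrow> X = M"
    by auto
  have "f = 0" if f: "\<forall>e\<in>M. cinner e f = 0" for f
  proof (rule ccontr)
    assume "f \<noteq> 0"
    define e where "e = inverse (norm f) *\<^sub>R f"
    have "norm e = 1" "\<And>x. x \<in> M \<Longrightarrow> cinner x e = 0"
      using f \<open>f \<noteq> 0\<close> by (auto simp: e_def cinner_simps)
    then have "orthonormal (insert e M)"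
      using M(1) orthonormal_insert by blast
    then have "e \<in> M"
      using max by blast
    then have "cinner e e = 0"
      using \<open>\<And>x. x \<in> M \<Longrightarrow> cinner x e = 0\<close> by blast
    then show False
      using \<open>norm e = 1\<close> by (simp add: cinner_self)
  qed
  then show ?thesis
    using that M by (auto simp: orthonormal_basis_def)
qed

section \<open>Bounded operators and their traces\<close>

lemma bounded_op_bounded_linear: "bounded_op A \<Longrightarrow> bounded_linear A"
  by (simp add: bounded_op_def)

lemma bounded_op_add: "bounded_op A \<Longrightarrow> A (f + g) = A f + A g"
  by (simp add: bounded_op_def linear_add bounded_linear.linear)

lemma bounded_op_scaleC: "bounded_op A \<Longrightarrow> A (c *\<^sub>C f) = c *\<^sub>C A f"
  by (simp add: bounded_op_def)

lemma bounded_op_id: "bounded_op id"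
  using bounded_linear_ident by (simp add: bounded_op_def id_def)

lemma bounded_op_rank_one: "bounded_op (\<lambda>f. cinner v f *\<^sub>C u)"
  unfolding bounded_op_def
proof (intro conjI allI)
  show "bounded_linear (\<lambda>f. cinner v f *\<^sub>C u)"
    by (rule bounded_linear_intro[where K = "norm v * norm u"])
      (auto simp: cinner_simps scaleC_add_left scaleR_scaleC scaleC_scaleC norm_scaleC mult_ac
        intro!: mult_right_mono norm_cinner_le[of v, unfolded mult.commute[of "norm v"]]
          order_trans[OF mult_left_mono[OF norm_cinner_le]])
qed (simp add: cinner_simps scaleC_scaleC)

lemma bounded_op_plus: "bounded_op A \<Longrightarrow> bounded_op B \<Longrightarrow> bounded_op (\<lambda>f. A f + B f)"
  by (auto simp: bounded_op_def bounded_linear_add scaleC_add_right)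

lemma bounded_op_ket_bra: "bounded_op (ket_bra u)"
  unfolding ket_bra_def[abs_def] by (rule bounded_op_rank_one)

lemma bounded_op_eq_on_onb:
  fixes A A' :: "'a::euclidean_space L2 \<Rightarrow> 'b::euclidean_space L2"
  assumes "bounded_op A" "bounded_op A'" "orthonormal_basis B" "\<And>e. e \<in> B \<Longrightarrow> A e = A' e"
  shows "A = A'"
proof
  fix f
  have "((\<lambda>e. cinner e f *\<^sub>C T e) has_sum T f) B" if "bounded_op T" for T :: "'a L2 \<Rightarrow> 'b L2"
    using has_sum_bounded_linear[OF bounded_op_bounded_linear[OF that] onb_expansion[OF assms(3), of f]]
    by (simp add: bounded_op_scaleC[OF that])
  from this[OF assms(1)] this[OF assms(2)]
  have "((\<lambda>e. cinner e f *\<^sub>C A e) has_sum A f) B" "((\<lambda>e. cinner e f *\<^sub>C A' e) has_sum A' f) B" .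
  moreover have "((\<lambda>e. cinner e f *\<^sub>C A e) has_sum A f) B \<longleftrightarrow> ((\<lambda>e. cinner e f *\<^sub>C A' e) has_sum A f) B"
    using assms(4) by (intro has_sum_cong) simp
  ultimately show "A f = A' f"
    using has_sum_unique by blast
qed

lemma has_trace_rank_one: "has_trace (\<lambda>f. cinner v f *\<^sub>C u) (cinner v u)"
  unfolding has_trace_def
  using parseval[of _ v u] by (simp add: bounded_op_rank_one cinner_simps)

lemma has_trace_plus:
  "has_trace A s \<Longrightarrow> has_trace B t \<Longrightarrow> has_trace (\<lambda>f. A f + B f) (s + t)"
  unfolding has_trace_def by (auto simp: bounded_op_plus cinner_simps intro: has_sum_add)

text \<open>\<open>has_trace\<close> quantifies over all orthonormal bases, so the value is
  determined only because a basis exists.\<close>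

lemma has_trace_unique: "has_trace A s \<Longrightarrow> has_trace A t \<Longrightarrow> s = t"
  unfolding has_trace_def
  by (metis has_sum_unique orthonormal_empty orthonormal_extend_basis)

section \<open>Diagonal operators and their square roots\<close>

text \<open>The multiplication operator with its maximal domain. That the vector \<open>g\<close>
  exists in \<open>L2\<close> already expresses the square summability of the products of
  \<open>\<mu> e\<close> with the coefficients of \<open>f\<close>.\<close>

definition diag_op :: "'a::euclidean_space L2 set \<Rightarrow> ('a L2 \<Rightarrow> real) \<Rightarrow> 'a graph_op" where
  "diag_op B \<mu> = {(f, g). \<forall>e\<in>B. cinner e g = of_real (\<mu> e) * cinner e f}"

lemma diag_op_unique:
  assumes "orthonormal_basis B" "(f, g) \<in> diag_op B \<mu>" "(f, h) \<in> diag_op B \<mu>"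
  shows "g = h"
  using assms by (intro onb_eqI[OF assms(1)]) (simp add: diag_op_def)

lemma diag_op_basis:
  assumes "orthonormal B" "e \<in> B"
  shows "(e, \<mu> e *\<^sub>R e) \<in> diag_op B \<mu>"
  using assms by (auto simp: diag_op_def cinner_simps orthonormalD)

lemma diag_op_add:
  "(f, g) \<in> diag_op B \<mu> \<Longrightarrow> (f', g') \<in> diag_op B \<mu> \<Longrightarrow> (f + f', g + g') \<in> diag_op B \<mu>"
  by (auto simp: diag_op_def cinner_simps ring_distribs)

lemma diag_op_scale: "(f, g) \<in> diag_op B \<mu> \<Longrightarrow> (k *\<^sub>C f, k *\<^sub>C g) \<in> diag_op B \<mu>"
  by (auto simp: diag_op_def cinner_simps)

lemma graph_op_sum:
  assumes "(0, 0) \<in> T"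
    and "\<And>f g f' g'. (f, g) \<in> T \<Longrightarrow> (f', g') \<in> T \<Longrightarrow> (f + f', g + g') \<in> T"
    and "\<And>i. i \<in> I \<Longrightarrow> (u i, v i) \<in> T"
  shows "((\<Sum>i\<in>I. u i), (\<Sum>i\<in>I. v i)) \<in> T"
  using assms(3) by (induction I rule: infinite_finite_induct) (auto simp: assms)

lemma closed_diag_op: "closed (diag_op B \<mu>)"
proof -
  have "diag_op B \<mu> = (\<Inter>e\<in>B. {p. cinner e (snd p) = of_real (\<mu> e) * cinner e (fst p)})"
    by (auto simp: diag_op_def)
  moreover have "closed {p. cinner e (snd p) = of_real (\<mu> e) * cinner e (fst p)}" for e
    by (intro closed_Collect_eq continuous_intros
        bounded_linear.continuous_on[OF bounded_linear_cinner_right])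
  ultimately show ?thesis
    by auto
qed

text \<open>The partial sums of the expansions of \<open>f\<close> and \<open>g\<close> form pairs
  that lie in \<open>T\<close> and converge to \<open>(f, g)\<close> in the graph topology. This is
  the essential self-adjointness of a symmetric operator with a total set of eigenvectors.\<close>

lemma closure_eq_diag_op:
  fixes T :: "'a::euclidean_space graph_op"
  assumes B: "orthonormal_basis B"
    and zero: "(0, 0) \<in> T"
    and add: "\<And>f g f' g'. (f, g) \<in> T \<Longrightarrow> (f', g') \<in> T \<Longrightarrow> (f + f', g + g') \<in> T"
    and scale: "\<And>k f g. (f, g) \<in> T \<Longrightarrow> (k *\<^sub>C f, k *\<^sub>C g) \<in> T"
    and eig: "\<And>e. e \<in> B \<Longrightarrow> (e, \<mu> e *\<^sub>R e) \<in> T"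
    and sym: "T \<subseteq> diag_op B \<mu>"
  shows "closure T = diag_op B \<mu>"
proof
  show "closure T \<subseteq> diag_op B \<mu>"
    using sym closed_diag_op by (rule closure_minimal)
  show "diag_op B \<mu> \<subseteq> closure T"
  proof clarify
    fix f g assume fg: "(f, g) \<in> diag_op B \<mu>"
    have *: "((\<lambda>e. cinner e f *\<^sub>C \<mu> e *\<^sub>R e) has_sum g) B"
    proof -
      have "cinner e f *\<^sub>C \<mu> e *\<^sub>R e = cinner e g *\<^sub>C e" if "e \<in> B" for e
        using fg that by (simp add: diag_op_def scaleR_scaleC scaleC_scaleC mult.commute)
      then show ?thesis
        using onb_expansion[OF B, of g] by (simp cong: has_sum_cong)
    qed
    have "((\<lambda>F. (\<Sum>e\<in>F. cinner e f *\<^sub>C e, \<Sum>e\<in>F. cinner e f *\<^sub>C \<mu> e *\<^sub>R e)) \<longlongrightarrow> (f, g))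
        (finite_subsets_at_top B)"
      using onb_expansion[OF B, of f] * unfolding has_sum_def by (rule tendsto_Pair)
    moreover have "\<forall>\<^sub>F F in finite_subsets_at_top B.
        (\<Sum>e\<in>F. cinner e f *\<^sub>C e, \<Sum>e\<in>F. cinner e f *\<^sub>C \<mu> e *\<^sub>R e) \<in> closure T"
    proof (rule eventually_finite_subsets_at_top_weakI)
      fix F assume "finite F" "F \<subseteq> B"
      then show "(\<Sum>e\<in>F. cinner e f *\<^sub>C e, \<Sum>e\<in>F. cinner e f *\<^sub>C \<mu> e *\<^sub>R e) \<in> closure T"
        by (intro subsetD[OF closure_subset] graph_op_sum zero add scale eig) auto
    qed
    ultimately show "(f, g) \<in> closure T"
      by (intro Lim_in_closed_set[OF closed_closure, where F = "finite_subsets_at_top B"]) auto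
  qed
qed

text \<open>Testing an element of the adjoint against the basis vectors yields its coefficients, and
  since the domain is maximal this is already membership. The converse is Parseval's
  identity.\<close>

lemma adjoint_diag_op:
  assumes B: "orthonormal_basis B"
  shows "adjoint_op (diag_op B \<mu>) = diag_op B \<mu>"
proof (intro equalityI subrelI)
  fix u v assume uv: "(u, v) \<in> adjoint_op (diag_op B \<mu>)"
  have "cinner e v = of_real (\<mu> e) * cinner e u" if "e \<in> B" for e
  proof -
    have "cinner u (\<mu> e *\<^sub>R e) = cinner v e"
      using uv diag_op_basis[OF onb_orthonormal[OF B] that] by (auto simp: adjoint_op_def)
    then have "cnj (of_real (\<mu> e) * cinner u e) = cnj (cinner v e)"
      by (simp add: cinner_simps)
    then show ?thesis
      by (simp add: cinner_commute[of e])
  qed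
  then show "(u, v) \<in> diag_op B \<mu>"
    by (simp add: diag_op_def)
next
  fix u v assume uv: "(u, v) \<in> diag_op B \<mu>"
  have "cinner u g = cinner v f" if fg: "(f, g) \<in> diag_op B \<mu>" for f g
  proof -
    have "cinner u e * cinner e g = cinner v e * cinner e f" if "e \<in> B" for e
    proof -
      have "cinner e g = of_real (\<mu> e) * cinner e f" "cinner v e = of_real (\<mu> e) * cinner u e"
        using that uv fg cinner_commute[of u e] cinner_commute[of v e] by (auto simp: diag_op_def)
      then show ?thesis
        by simp
    qed
    then have "((\<lambda>e. cinner u e * cinner e g) has_sum cinner v f) B"
      using parseval[OF B, of v f] by (simp cong: has_sum_cong)
    with parseval[OF B, of u g] show ?thesis
      by (rule has_sum_unique)
  qed
  then show "(u, v) \<in> adjoint_op (diag_op B \<mu>)"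
    by (auto simp: adjoint_op_def)
qed

lemma pos_selfadjoint_diag_op:
  assumes B: "orthonormal_basis B" and pos: "\<And>e. e \<in> B \<Longrightarrow> 0 \<le> \<mu> e"
  shows "pos_selfadjoint (diag_op B \<mu>)"
  unfolding pos_selfadjoint_def
proof (intro conjI)
  show "closure (Domain (diag_op B \<mu>)) = UNIV"
  proof (rule UNIV_eq_I[symmetric])
    fix f :: "'a L2"
    have "(\<Sum>e\<in>F. cinner e f *\<^sub>C e) \<in> closure (Domain (diag_op B \<mu>))" if "F \<subseteq> B" for F
    proof -
      have "((\<Sum>e\<in>F. cinner e f *\<^sub>C e), (\<Sum>e\<in>F. cinner e f *\<^sub>C \<mu> e *\<^sub>R e)) \<in> diag_op B \<mu>"
        using that onb_orthonormal[OF B]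
        by (intro graph_op_sum diag_op_add diag_op_scale diag_op_basis) (auto simp: diag_op_def)
      then show ?thesis
        by (intro subsetD[OF closure_subset] DomainI)
    qed
    then have "\<forall>\<^sub>F F in finite_subsets_at_top B.
        (\<Sum>e\<in>F. cinner e f *\<^sub>C e) \<in> closure (Domain (diag_op B \<mu>))"
      by (intro eventually_finite_subsets_at_top_weakI) simp
    then show "f \<in> closure (Domain (diag_op B \<mu>))"
      using onb_expansion[OF B, of f] unfolding has_sum_def
      by (intro Lim_in_closed_set[OF closed_closure, where F = "finite_subsets_at_top B"]) auto
  qed
  show "adjoint_op (diag_op B \<mu>) = diag_op B \<mu>"
    by (rule adjoint_diag_op[OF B])
  show "\<forall>(f, g)\<in>diag_op B \<mu>. 0 \<le> Re (cinner f g)"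
  proof clarify
    fix f g assume "(f, g) \<in> diag_op B \<mu>"
    have "0 \<le> Re (cinner f e * cinner e g)" if "e \<in> B" for e
    proof -
      have "cinner f e * cinner e g = of_real (\<mu> e * (cmod (cinner e f))\<^sup>2)"
        using \<open>(f, g) \<in> diag_op B \<mu>\<close> that
        by (simp add: diag_op_def cinner_commute[of f e] of_real_mult complex_norm_square mult_ac del: of_real_power)
      then show ?thesis
        using pos[OF that] by simp
    qed
    then show "0 \<le> Re (cinner f g)"
      by (rule has_sum_nonneg[OF has_sum_Re[OF parseval[OF B, of f g]]])
  qed
qed

text \<open>The intermediate vector must have the coefficients \<open>l e\<close> times those of
  \<open>f\<close>. Their squared moduli are products of moduli of coefficients of \<open>f\<close>
  and of \<open>g\<close>, hence summable, and the vector exists by Riesz-Fischer.\<close>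

lemma diag_op_comp:
  assumes B: "orthonormal_basis B"
  shows "diag_op B l O diag_op B l = diag_op B (\<lambda>e. (l e)\<^sup>2)"
proof (intro equalityI subrelI)
  fix f g assume "(f, g) \<in> diag_op B l O diag_op B l"
  then show "(f, g) \<in> diag_op B (\<lambda>e. (l e)\<^sup>2)"
    by (auto simp: diag_op_def power2_eq_square mult.assoc)
next
  fix f g assume fg: "(f, g) \<in> diag_op B (\<lambda>e. (l e)\<^sup>2)"
  have bound: "(cmod (of_real (l e) * cinner e f))\<^sup>2 \<le> (cmod (cinner e f))\<^sup>2 + (cmod (cinner e g))\<^sup>2"
    if "e \<in> B" for e
  proof -
    have "cmod (cinner e g) = (l e)\<^sup>2 * cmod (cinner e f)"
      using fg that by (simp add: diag_op_def norm_mult norm_power)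
    then have "(cmod (of_real (l e) * cinner e f))\<^sup>2 = cmod (cinner e f) * cmod (cinner e g)"
      by (simp add: norm_mult power_mult_distrib power2_eq_square)
    moreover have "2 * (cmod (cinner e f) * cmod (cinner e g)) \<le> (cmod (cinner e f))\<^sup>2 + (cmod (cinner e g))\<^sup>2"
      using sum_squares_bound[of "cmod (cinner e f)" "cmod (cinner e g)"] by (simp add: mult.assoc)
    moreover have "0 \<le> cmod (cinner e f) * cmod (cinner e g)"
      by simp
    ultimately show ?thesis
      by linarith
  qed
  have "(\<lambda>e. (cmod (cinner e f))\<^sup>2 + (cmod (cinner e g))\<^sup>2) summable_on B"
    by (intro summable_on_add bessel_summable onb_orthonormal B)
  then have "(\<lambda>e. (cmod (of_real (l e) * cinner e f))\<^sup>2) summable_on B"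
    by (rule summable_on_comparison_test) (auto intro: bound)
  from riesz_fischer[OF onb_orthonormal[OF B] this]
  obtain h where h: "\<And>e. e \<in> B \<Longrightarrow> cinner e h = of_real (l e) * cinner e f"
    by metis
  then have "(f, h) \<in> diag_op B l" "(h, g) \<in> diag_op B l"
    using fg h by (auto simp: diag_op_def power2_eq_square mult.assoc)
  then show "(f, g) \<in> diag_op B l O diag_op B l"
    by blast
qed

lemma adjoint_op_diff:
  "(u, v) \<in> adjoint_op T \<Longrightarrow> (u', v') \<in> adjoint_op T \<Longrightarrow> (u - k *\<^sub>R u', v - k *\<^sub>R v') \<in> adjoint_op T"
  unfolding adjoint_op_def by (simp add: cinner_simps split_beta)

text \<open>On an eigenvector \<open>e\<close> of \<open>D\<^sup>2\<close> with eigenvalue \<open>l\<^sup>2\<close>, the vector \<open>D e - l e\<close> is an eigenvector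
  of the nonnegative \<open>D\<close> with eigenvalue \<open>- l\<close>, hence zero.\<close>
lemma pos_selfadjoint_sqrt_eigenvector:
  assumes D: "pos_selfadjoint D" and e: "(e, l\<^sup>2 *\<^sub>R e) \<in> D O D" and l: "0 \<le> l"
  shows "(e, l *\<^sub>R e) \<in> D"
proof -
  have adj: "adjoint_op D = D" and pos: "\<And>f g. (f, g) \<in> D \<Longrightarrow> 0 \<le> Re (cinner f g)"
    using D by (auto simp: pos_selfadjoint_def)
  obtain y where y: "(e, y) \<in> D" "(y, l\<^sup>2 *\<^sub>R e) \<in> D"
    using e by blast
  have "y = l *\<^sub>R e"
  proof (cases "l = 0")
    \<comment> \<open>With \<open>l = 0\<close> the eigenvalue argument is empty. Symmetry gives
      |y|^2 = <e, D y> = 0 instead.\<close>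
    case True
    have "cinner e (l\<^sup>2 *\<^sub>R e) = cinner y y"
      using y adj unfolding adjoint_op_def by blast
    then show ?thesis
      using True by (simp add: cinner_self)
  next
    case False
    define w where "w = y - l *\<^sub>R e"
    have "(w, l\<^sup>2 *\<^sub>R e - l *\<^sub>R y) \<in> D"
      using adjoint_op_diff[of y "l\<^sup>2 *\<^sub>R e" D e y l] y adj by (simp add: w_def)
    moreover have "l\<^sup>2 *\<^sub>R e - l *\<^sub>R y = - l *\<^sub>R w"
      by (simp add: w_def scaleR_diff_right power2_eq_square)
    ultimately have "0 \<le> Re (cinner w (- l *\<^sub>R w))"
      using pos by simp
    then have "l * (norm w)\<^sup>2 \<le> 0"
      by (simp add: Re_cinner power2_norm_eq_inner)
    then have "w = 0"
      using False l by (simp add: mult_le_0_iff)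
    then show ?thesis
      by (simp add: w_def)
  qed
  then show ?thesis
    using y by simp
qed

lemma sqrt_op_diag_op:
  assumes B: "orthonormal_basis B" and l: "\<And>e. e \<in> B \<Longrightarrow> 0 \<le> l e"
  shows "sqrt_op (diag_op B (\<lambda>e. (l e)\<^sup>2)) = diag_op B l"
  unfolding sqrt_op_def
proof (rule the_equality)
  show "pos_selfadjoint (diag_op B l) \<and> diag_op B l O diag_op B l = diag_op B (\<lambda>e. (l e)\<^sup>2)"
    using pos_selfadjoint_diag_op[OF B l] diag_op_comp[OF B] by simp
  fix D assume "pos_selfadjoint D \<and> D O D = diag_op B (\<lambda>e. (l e)\<^sup>2)"
  then have D: "pos_selfadjoint D" "D O D = diag_op B (\<lambda>e. (l e)\<^sup>2)" and adj: "adjoint_op D = D"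
    by (auto simp: pos_selfadjoint_def)
  have eig: "(e, l e *\<^sub>R e) \<in> D" if "e \<in> B" for e
  proof (rule pos_selfadjoint_sqrt_eigenvector[OF D(1) _ l[OF that]])
    show "(e, (l e)\<^sup>2 *\<^sub>R e) \<in> D O D"
      unfolding D(2) using diag_op_basis[OF onb_orthonormal[OF B] that, of "\<lambda>e. (l e)\<^sup>2"] .
  qed
  have sub: "D \<subseteq> diag_op B l"
  proof (rule subrelI)
    fix f g assume fg: "(f, g) \<in> D"
    have "cinner e g = cinner (l e *\<^sub>R e) f" if "e \<in> B" for e
      using eig[OF that] fg adj unfolding adjoint_op_def by blast
    then show "(f, g) \<in> diag_op B l"
      by (simp add: diag_op_def cinner_simps)
  qed
  \<comment> \<open>Taking adjoints reverses inclusions and leaves both operators fixed, so a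
    self-adjoint operator has no proper self-adjoint restriction.\<close>
  have "adjoint_op (diag_op B l) \<subseteq> adjoint_op D"
    using sub unfolding adjoint_op_def by blast
  then have "diag_op B l \<subseteq> D"
    using adjoint_diag_op[OF B] adj by auto
  with sub show "D = diag_op B l"
    by blast
qed

lemma diag_op_sym:
  assumes "orthonormal_basis B" "(f, g) \<in> diag_op B \<mu>" "(u, v) \<in> diag_op B \<mu>"
  shows "cinner u g = cinner v f"
  using assms(2,3) adjoint_diag_op[OF assms(1), of \<mu>] unfolding adjoint_op_def by blast

lemma app_op_diag_op:
  assumes "orthonormal_basis B" "f \<in> Domain (diag_op B \<mu>)"
  shows "(f, app_op (diag_op B \<mu>) f) \<in> diag_op B \<mu>"
proof -
  obtain g where g: "(f, g) \<in> diag_op B \<mu>"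
    using assms(2) by blast
  then have "app_op (diag_op B \<mu>) f = g"
    unfolding app_op_def using diag_op_unique[OF assms(1)] by (intro the_equality) auto
  then show ?thesis
    using g by simp
qed

section \<open>Gaussian monomials are total\<close>

text \<open>The positive and negative parts of \<open>g\<close> have the same Fourier transform.
  After normalisation they are densities of probability measures with equal characteristic
  functions, so Levy's uniqueness theorem identifies them.\<close>

lemma fourier_zero_imp_AE_zero:
  fixes g :: "real \<Rightarrow> real"
  assumes g: "integrable lborel g"
    and zero: "\<And>t. (\<integral>x. of_real (g x) * iexp (t * x) \<partial>lborel) = 0"
  shows "AE x in lborel. g x = 0"
proof -
  have [measurable]: "g \<in> borel_measurable borel"
    using g by auto
  define p where "p x = max 0 (g x)" for x
  define n where "n x = max 0 (- g x)" for x
  have [measurable]: "p \<in> borel_measurable borel" "n \<in> borel_measurable borel"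
    unfolding p_def n_def by measurable
  have pn: "g x = p x - n x" for x
    by (auto simp: p_def n_def)
  have ip: "integrable lborel p" and "integrable lborel n"
    using g unfolding p_def n_def by (auto intro!: integrable_max)
  then have intn: "integrable lborel n" by simp
  have ipe: "integrable lborel (\<lambda>x. of_real (p x) * iexp (t * x))" for t
    by (rule Bochner_Integration.integrable_bound[OF ip]) (auto simp: norm_mult p_def)
  have ine: "integrable lborel (\<lambda>x. of_real (n x) * iexp (t * x))" for t
    by (rule Bochner_Integration.integrable_bound[OF intn]) (auto simp: norm_mult n_def)
  have eq: "(\<integral>x. of_real (p x) * iexp (t * x) \<partial>lborel) = (\<integral>x. of_real (n x) * iexp (t * x) \<partial>lborel)" for t
    using zero[of t] Bochner_Integration.integral_diff[OF ipe[of t] ine[of t]]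
    by (simp add: pn ring_distribs)
  define c where "c = (\<integral>x. p x \<partial>lborel)"
  \<comment> \<open>The transform at \<open>t = 0\<close> shows that both parts have the same mass,
    so one constant normalises both.\<close>
  have cn: "c = (\<integral>x. n x \<partial>lborel)"
  proof -
    have "complex_of_real (\<integral>x. p x \<partial>lborel) = complex_of_real (\<integral>x. n x \<partial>lborel)"
      using eq[of 0] by (simp flip: integral_complex_of_real)
    then show ?thesis
      by (simp add: c_def)
  qed
  have c0: "c \<ge> 0"
    unfolding c_def p_def by (intro integral_nonneg_AE) auto
  show ?thesis
  proof (cases "c = 0")
    case True
    have "AE x in lborel. p x = 0" "AE x in lborel. n x = 0"
      using True cn c_def integral_nonneg_eq_0_iff_AE[OF ip] integral_nonneg_eq_0_iff_AE[OF intn]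
      by (auto simp: p_def[abs_def] n_def[abs_def])
    then show ?thesis
      by eventually_elim (simp add: pn)
  next
    case False
    with c0 have c: "c > 0" by simp
    have dist: "real_distribution (density lborel (\<lambda>x. ennreal (q x / c)))"
      if "integrable lborel q" "(\<integral>x. q x \<partial>lborel) = c" "\<And>x. q x \<ge> 0" for q :: "real \<Rightarrow> real"
    proof -
      have [measurable]: "q \<in> borel_measurable borel"
        using that by auto
      have "(\<integral>\<^sup>+x. ennreal (q x / c) \<partial>lborel) = ennreal (\<integral>x. q x / c \<partial>lborel)"
        using that c by (intro nn_integral_eq_integral) auto
      then have "prob_space (density lborel (\<lambda>x. ennreal (q x / c)))"
        using that c by (intro prob_spaceI) (simp add: emeasure_density)
      then show ?thesis
        by (simp add: real_distribution_def real_distribution_axioms_def)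
    qed
    have ch: "char (density lborel (\<lambda>x. ennreal (q x / c))) t
        = (\<integral>x. of_real (q x) * iexp (t * x) \<partial>lborel) / of_real c"
      if "integrable lborel q" "\<And>x. q x \<ge> 0" for q :: "real \<Rightarrow> real" and t
    proof -
      have [measurable]: "q \<in> borel_measurable borel"
        using that by auto
      have "char (density lborel (\<lambda>x. ennreal (q x / c))) t
          = (\<integral>x. (q x / c) *\<^sub>R iexp (t * x) \<partial>lborel)"
        unfolding char_def using that c by (subst integral_density) auto
      also have "\<dots> = (\<integral>x. (of_real (q x) * iexp (t * x)) / of_real c \<partial>lborel)"
        by (simp add: scaleR_conv_of_real)
      finally show ?thesis
        by simp
    qed
    have "density lborel (\<lambda>x. ennreal (p x / c)) = density lborel (\<lambda>x. ennreal (n x / c))"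
    proof (rule Levy_uniqueness)
      show "real_distribution (density lborel (\<lambda>x. ennreal (p x / c)))"
        by (intro dist ip) (simp_all only: c_def, simp add: p_def)
      show "real_distribution (density lborel (\<lambda>x. ennreal (n x / c)))"
        by (intro dist intn) (simp_all only: cn, simp add: n_def)
      show "char (density lborel (\<lambda>x. ennreal (p x / c))) = char (density lborel (\<lambda>x. ennreal (n x / c)))"
        using ch[OF ip] ch[OF intn] eq by (auto simp: p_def n_def fun_eq_iff)
    qed
    then have "AE x in lborel. ennreal (p x / c) = ennreal (n x / c)"
      by (intro sigma_finite_measure.density_unique[OF lborel.sigma_finite_measure_axioms]) auto
    then show ?thesis
    proof eventually_elim
      case (elim x)
      then have "p x / c = n x / c"
        using c by (subst (asm) ennreal_inj) (auto simp: p_def n_def)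
      then show ?case
        using c by (simp add: pn)
    qed
  qed
qed

text \<open>A single term of the exponential series is at most its sum. This bound absorbs
  polynomial factors into exponentials throughout.\<close>

lemma power_le_fact_exp:
  fixes x :: real
  shows "\<bar>x\<bar> ^ k \<le> fact k * exp \<bar>x\<bar>"
proof -
  have "(\<Sum>i\<in>{k}. inverse (fact i) *\<^sub>R \<bar>x\<bar> ^ i) \<le> (\<Sum>i. inverse (fact i) *\<^sub>R \<bar>x\<bar> ^ i)"
    by (rule sum_le_suminf[OF summable_exp_generic]) auto
  then show ?thesis
    by (simp add: exp_def field_simps)
qed

lemma norm_exp_partial_sum_le:
  fixes z :: complex
  shows "norm (\<Sum>k<n. z ^ k /\<^sub>R fact k) \<le> exp (norm z)"
proof -
  have "norm (\<Sum>k<n. z ^ k /\<^sub>R fact k) \<le> (\<Sum>k<n. norm z ^ k /\<^sub>R fact k)"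
    by (rule order_trans[OF norm_sum]) (simp add: norm_power)
  also have "\<dots> \<le> (\<Sum>k. norm z ^ k /\<^sub>R fact k)"
    by (rule sum_le_suminf[OF summable_exp_generic]) auto
  finally show ?thesis
    by (simp add: exp_def)
qed

text \<open>The exponential moments dominate all partial sums of the power series of
  \<open>iexp (t * x)\<close>, so the Fourier transform can be computed term by term from the
  moments.\<close>

lemma moments_zero_imp_AE_zero:
  fixes g :: "real \<Rightarrow> real"
  assumes int: "\<And>n::nat. integrable lborel (\<lambda>x. exp (n * \<bar>x\<bar>) * g x)"
    and zero: "\<And>n. (\<integral>x. g x * x ^ n \<partial>lborel) = 0"
  shows "AE x in lborel. g x = 0"
proof (rule fourier_zero_imp_AE_zero)
  show g: "integrable lborel g"
    using int[of 0] by simp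
  then have [measurable]: "g \<in> borel_measurable borel"
    by auto
  have mom: "integrable lborel (\<lambda>x. g x * x ^ k)" for k
  proof (rule Bochner_Integration.integrable_bound[OF integrable_mult_right[OF int[of 1], of "fact k"]])
    show "AE x in lborel. norm (g x * x ^ k) \<le> norm (fact k * (exp (real 1 * \<bar>x\<bar>) * g x))"
    proof (rule AE_I2)
      fix x
      show "norm (g x * x ^ k) \<le> norm (fact k * (exp (real 1 * \<bar>x\<bar>) * g x))"
        using mult_right_mono[OF power_le_fact_exp[of x k], of "\<bar>g x\<bar>"]
        by (simp add: abs_mult power_abs mult_ac)
    qed
  qed measurable
  fix t :: real
  define s where "s n x = of_real (g x) * (\<Sum>k<n. (\<i> * of_real (t * x)) ^ k /\<^sub>R fact k)" for n x
  \<comment> \<open>Integrability is assumed for integer exponents, so \<open>t\<close> is dominated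
    by an integer.\<close>
  obtain N :: nat where N: "\<bar>t\<bar> \<le> N"
    using real_arch_simple by blast
  have "(\<lambda>n. integral\<^sup>L lborel (s n)) \<longlonglongrightarrow> (\<integral>x. of_real (g x) * iexp (t * x) \<partial>lborel)"
  proof (rule integral_dominated_convergence)
    show "integrable lborel (\<lambda>x. \<bar>exp (N * \<bar>x\<bar>) * g x\<bar>)"
      using int[of N] by (rule integrable_abs)
    show "AE x in lborel. (\<lambda>n. s n x) \<longlonglongrightarrow> of_real (g x) * iexp (t * x)"
      unfolding s_def
      by (intro AE_I2 tendsto_mult tendsto_const) (rule exp_converges[unfolded sums_def])
    show "AE x in lborel. norm (s n x) \<le> \<bar>exp (N * \<bar>x\<bar>) * g x\<bar>" for n
    proof (rule AE_I2)
      fix x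
      have "norm (s n x) \<le> \<bar>g x\<bar> * exp (\<bar>t\<bar> * \<bar>x\<bar>)"
        unfolding s_def norm_mult
        using norm_exp_partial_sum_le[where n = n and z = "\<i> * of_real (t * x)"]
        by (intro mult_mono) (auto simp: norm_mult abs_mult)
      also have "\<dots> \<le> \<bar>g x\<bar> * exp (N * \<bar>x\<bar>)"
        using N by (intro mult_left_mono) (auto intro: mult_right_mono)
      finally show "norm (s n x) \<le> \<bar>exp (N * \<bar>x\<bar>) * g x\<bar>"
        by (simp add: abs_mult mult.commute)
    qed
  qed (auto simp: s_def[abs_def])
  moreover have "integral\<^sup>L lborel (s n) = 0" for n
  proof -
    have "s n x = (\<Sum>k<n. ((\<i> * of_real t) ^ k /\<^sub>R fact k) * of_real (g x * x ^ k))" for x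
      by (simp add: s_def sum_distrib_left power_mult_distrib mult_ac scaleR_conv_of_real)
    then have "s n = (\<lambda>x. \<Sum>k<n. ((\<i> * of_real t) ^ k /\<^sub>R fact k) * of_real (g x * x ^ k))"
      by blast
    then have "integral\<^sup>L lborel (s n)
        = (\<Sum>k<n. (\<integral>x. ((\<i> * of_real t) ^ k /\<^sub>R fact k) * of_real (g x * x ^ k) \<partial>lborel))"
      by (simp only:) (intro Bochner_Integration.integral_sum integrable_mult_right integrable_of_real mom)
    also have "\<dots> = 0"
      by (intro sum.neutral ballI) (simp only: integral_mult_right_zero integral_complex_of_real zero, simp)
    finally show ?thesis .
  qed
  ultimately show "(\<integral>x. of_real (g x) * iexp (t * x) \<partial>lborel) = 0"
    by (simp add: LIMSEQ_const_iff)
qed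

text \<open>The one-dimensional result is applied twice. For fixed \<open>j\<close> it shows that
  the \<open>j\<close>-th moment in \<open>y\<close> vanishes for almost every \<open>x\<close>; as
  there are countably many \<open>j\<close>, almost every section has all moments zero and is itself
  null.\<close>

lemma moments_zero_imp_AE_zero_pair:
  fixes g :: "real \<times> real \<Rightarrow> real"
  assumes int: "\<And>n::nat. integrable lborel (\<lambda>(x, y). exp (n * (\<bar>x\<bar> + \<bar>y\<bar>)) * g (x, y))"
    and zero: "\<And>i j. (\<integral>(x, y). g (x, y) * x ^ i * y ^ j \<partial>lborel) = 0"
  shows "AE z in lborel. g z = 0"
proof -
  have g: "integrable (lborel \<Otimes>\<^sub>M lborel) g"
    using int[of 0] by (simp add: case_prod_beta' lborel_prod)
  then have [measurable]: "g \<in> borel_measurable (borel \<Otimes>\<^sub>M borel)"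
    by (auto simp: borel_measurable_integrable measurable_cong_sets[OF sets_pair_measure_cong[OF sets_lborel sets_lborel] refl]
        dest!: borel_measurable_integrable)
  \<comment> \<open>A common majorant for all product weights of at most exponential growth.\<close>
  have dom: "integrable (lborel \<Otimes>\<^sub>M lborel) (\<lambda>(x, y). u x * v y * g (x, y))"
    if [measurable]: "u \<in> borel_measurable borel" "v \<in> borel_measurable borel"
      and u: "\<And>x::real. \<bar>u x\<bar> \<le> K * exp (n * \<bar>x\<bar>)" and v: "\<And>y::real. \<bar>v y\<bar> \<le> L * exp (n * \<bar>y\<bar>)"
    for u v :: "real \<Rightarrow> real" and K L and n :: nat
  proof (rule Bochner_Integration.integrable_bound)
    show "integrable (lborel \<Otimes>\<^sub>M lborel) (\<lambda>z. (K * L) * (case z of (x, y) \<Rightarrow> exp (n * (\<bar>x\<bar> + \<bar>y\<bar>)) * g (x, y)))"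
      using int[of n] by (intro integrable_mult_right) (simp add: lborel_prod)
    have "\<bar>u x * v y * g (x, y)\<bar> \<le> \<bar>K * L * (exp (n * (\<bar>x\<bar> + \<bar>y\<bar>)) * g (x, y))\<bar>" for x y :: real
    proof -
      have "\<bar>u x\<bar> * \<bar>v y\<bar> \<le> (K * exp (n * \<bar>x\<bar>)) * (L * exp (n * \<bar>y\<bar>))"
        using order_trans[OF abs_ge_zero u] by (intro mult_mono u v) auto
      also have "\<dots> = (K * L) * exp (n * (\<bar>x\<bar> + \<bar>y\<bar>))"
        by (simp add: exp_add ring_distribs)
      also have "\<dots> \<le> \<bar>K * L\<bar> * exp (n * (\<bar>x\<bar> + \<bar>y\<bar>))"
        by (intro mult_right_mono) auto
      finally have "\<bar>u x\<bar> * \<bar>v y\<bar> * \<bar>g (x, y)\<bar> \<le> \<bar>K * L\<bar> * exp (n * (\<bar>x\<bar> + \<bar>y\<bar>)) * \<bar>g (x, y)\<bar>"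
        by (rule mult_right_mono) simp
      then show ?thesis
        by (simp add: abs_mult mult.assoc)
    qed
    then show "AE z in lborel \<Otimes>\<^sub>M lborel. norm (case z of (x, y) \<Rightarrow> u x * v y * g (x, y))
        \<le> norm (K * L * (case z of (x, y) \<Rightarrow> exp (n * (\<bar>x\<bar> + \<bar>y\<bar>)) * g (x, y)))"
      by auto
  qed measurable
  \<comment> \<open>The exponent \<open>Suc n\<close> is at least 1, as the bound of a power by
    \<open>exp \<bar>y\<bar>\<close> requires.\<close>
  have pw: "\<bar>y ^ j\<bar> \<le> fact j * exp (real (Suc n) * \<bar>y\<bar>)" for y :: real and j n
  proof -
    have "exp \<bar>y\<bar> \<le> exp (real (Suc n) * \<bar>y\<bar>)"
      by (simp add: algebra_simps)
    then have "fact j * exp \<bar>y\<bar> \<le> fact j * exp (real (Suc n) * \<bar>y\<bar>)"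
      by (intro mult_left_mono) auto
    then show ?thesis
      using power_le_fact_exp[of y j] unfolding power_abs by (rule order_trans[rotated])
  qed
  have "AE x in lborel. (\<integral>y. g (x, y) * y ^ j \<partial>lborel) = 0" for j
  proof (rule moments_zero_imp_AE_zero)
    fix n :: nat
    have "integrable (lborel \<Otimes>\<^sub>M lborel) (\<lambda>(x, y). exp (n * \<bar>x\<bar>) * y ^ j * g (x, y))"
    proof (rule dom[where K = 1 and L = "fact j" and n = "Suc n"])
      show "\<bar>y ^ j\<bar> \<le> fact j * exp (real (Suc n) * \<bar>y\<bar>)" for y :: real
        by (rule pw)
    qed (auto simp: algebra_simps)
    from lborel_pair.integrable_fst'[OF this]
    show "integrable lborel (\<lambda>x. exp (n * \<bar>x\<bar>) * (\<integral>y. g (x, y) * y ^ j \<partial>lborel))"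
      by (simp add: mult.assoc mult.commute[of "g _"])
    have i: "integrable (lborel \<Otimes>\<^sub>M lborel) (\<lambda>(x, y). x ^ n * y ^ j * g (x, y))"
      by (rule dom[where K = "fact n" and L = "fact j" and n = "Suc 0"]) (measurable, rule pw, rule pw)
    have "(\<integral>x. (\<integral>y. g (x, y) * y ^ j \<partial>lborel) * x ^ n \<partial>lborel)
        = (\<integral>x. \<integral>y. (case (x, y) of (x, y) \<Rightarrow> x ^ n * y ^ j * g (x, y)) \<partial>lborel \<partial>lborel)"
      by (simp add: mult.assoc mult.commute[of _ "_ ^ n"] mult.commute[of "g _"])
    also have "\<dots> = (\<integral>(x, y). x ^ n * y ^ j * g (x, y) \<partial>(lborel \<Otimes>\<^sub>M lborel))"
      by (rule lborel_pair.integral_fst'[OF i])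
    also have "\<dots> = 0"
      using zero[of n j] by (simp add: lborel_prod mult_ac)
    finally show "(\<integral>x. (\<integral>y. g (x, y) * y ^ j \<partial>lborel) * x ^ n \<partial>lborel) = 0" .
  qed
  then have "AE x in lborel. \<forall>j. (\<integral>y. g (x, y) * y ^ j \<partial>lborel) = 0"
    by (simp add: AE_all_countable)
  moreover have "AE x in lborel. \<forall>n::nat. integrable lborel (\<lambda>y. exp (n * \<bar>y\<bar>) * g (x, y))"
  proof (subst AE_all_countable, intro allI)
    fix n :: nat
    have "integrable (lborel \<Otimes>\<^sub>M lborel) (\<lambda>(x, y). 1 * exp (n * \<bar>y\<bar>) * g (x, y))"
      by (rule dom[where K = 1 and L = 1 and n = n]) auto
    from lborel_pair.AE_integrable_fst'[OF this]
    show "AE x in lborel. integrable lborel (\<lambda>y. exp (n * \<bar>y\<bar>) * g (x, y))"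
      by simp
  qed
  ultimately have "AE x in lborel. AE y in lborel. g (x, y) = 0"
    by eventually_elim (auto intro: moments_zero_imp_AE_zero)
  moreover have "{z \<in> space (lborel \<Otimes>\<^sub>M lborel). g z = 0} \<in> sets (lborel \<Otimes>\<^sub>M lborel)"
    using borel_measurable_integrable[OF g] by measurable
  ultimately have "AE z in lborel \<Otimes>\<^sub>M lborel. g z = 0"
    by (intro lborel_pair.AE_pair_measure) auto
  then show ?thesis
    by (simp only: lborel_prod)
qed

section \<open>Integrability of Gaussians and totality of the monomials\<close>

lemma integrable_exp_gauss:
  fixes h b :: real
  assumes "h > 0"
  shows "integrable lborel (\<lambda>x. exp (b * x - x\<^sup>2 / h))"
proof -
  \<comment> \<open>Completing the square produces a normal density of mean \<open>b * h / 2\<close>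
    and variance \<open>h / 2\<close>.\<close>
  have "exp (b * x - x\<^sup>2 / h)
      = (exp (b\<^sup>2 * h / 4) * sqrt (pi * h)) * normal_density (b * h / 2) (sqrt (h / 2)) x" for x
  proof -
    have "b * x - x\<^sup>2 / h = b\<^sup>2 * h / 4 + (- (x - b * h / 2)\<^sup>2 / h)"
      using assms by (simp add: field_simps power2_eq_square)
    then show ?thesis
      using assms by (simp add: normal_density_def exp_add[symmetric] mult_ac)
  qed
  then show ?thesis
    using assms by simp
qed

lemma integrable_exp_abs_gauss:
  fixes h b :: real
  assumes "h > 0"
  shows "integrable lborel (\<lambda>x. exp (b * \<bar>x\<bar> - x\<^sup>2 / h))"
proof (rule Bochner_Integration.integrable_bound)
  show "integrable lborel (\<lambda>x. exp (b * x - x\<^sup>2 / h) + exp (- b * x - x\<^sup>2 / h))"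
    by (intro Bochner_Integration.integrable_add integrable_exp_gauss assms)
  show "AE x in lborel. norm (exp (b * \<bar>x\<bar> - x\<^sup>2 / h)) \<le> norm (exp (b * x - x\<^sup>2 / h) + exp (- b * x - x\<^sup>2 / h))"
  proof (rule AE_I2)
    fix x :: real
    have "0 < exp (b * x - x\<^sup>2 / h)" "0 < exp (- b * x - x\<^sup>2 / h)"
      by (rule exp_gt_zero)+
    then show "norm (exp (b * \<bar>x\<bar> - x\<^sup>2 / h)) \<le> norm (exp (b * x - x\<^sup>2 / h) + exp (- b * x - x\<^sup>2 / h))"
      by (cases "0 \<le> x") (simp_all add: abs_of_nonneg abs_of_neg)
  qed
qed measurable

lemma sq_integrable_gauss_bound:
  fixes f :: "real \<times> real \<Rightarrow> complex"
  assumes h: "h > 0" and [measurable]: "f \<in> borel_measurable borel"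
    and bound: "\<And>x y. cmod (f (x, y)) \<le> K * exp (b * (\<bar>x\<bar> + \<bar>y\<bar>)) * exp (- (x\<^sup>2 + y\<^sup>2) / (2 * h))"
  shows "sq_integrable f"
proof -
  let ?e = "\<lambda>x::real. exp ((2 * b) * \<bar>x\<bar> - x\<^sup>2 / h)"
  have "integrable (lborel \<Otimes>\<^sub>M lborel) (\<lambda>(x, y). ?e x * ?e y)"
  proof (rule lborel_pair.Fubini_integrable)
    show "integrable lborel (\<lambda>x. \<integral>y. norm (case (x, y) of (x, y) \<Rightarrow> ?e x * ?e y) \<partial>lborel)"
      using integrable_exp_abs_gauss[OF h, of "2 * b"] by simp
    show "AE x in lborel. integrable lborel (\<lambda>y. case (x, y) of (x, y) \<Rightarrow> ?e x * ?e y)"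
      using integrable_exp_abs_gauss[OF h, of "2 * b"] by simp
  qed measurable
  then have i: "integrable lborel (\<lambda>z. K\<^sup>2 * (case z of (x, y) \<Rightarrow> ?e x * ?e y))"
    by (simp add: lborel_prod)
  have "integrable lborel (\<lambda>z. (cmod (f z))\<^sup>2)"
  proof (rule Bochner_Integration.integrable_bound[OF i])
    have "(cmod (f (x, y)))\<^sup>2 \<le> K\<^sup>2 * (?e x * ?e y)" for x y
    proof -
      have "(cmod (f (x, y)))\<^sup>2 \<le> (K * exp (b * (\<bar>x\<bar> + \<bar>y\<bar>)) * exp (- (x\<^sup>2 + y\<^sup>2) / (2 * h)))\<^sup>2"
        by (rule power_mono[OF bound]) simp
      also have "\<dots> = K\<^sup>2 * exp (2 * (b * (\<bar>x\<bar> + \<bar>y\<bar>)) + 2 * (- (x\<^sup>2 + y\<^sup>2) / (2 * h)))"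
        by (simp only: power_mult_distrib exp_add exp_double mult.assoc)
      also have "2 * (b * (\<bar>x\<bar> + \<bar>y\<bar>)) + 2 * (- (x\<^sup>2 + y\<^sup>2) / (2 * h)) = ((2 * b) * \<bar>x\<bar> - x\<^sup>2 / h) + ((2 * b) * \<bar>y\<bar> - y\<^sup>2 / h)"
        using h by (simp add: field_simps)
      finally show ?thesis
        by (simp add: exp_add)
    qed
    then show "AE z in lborel. norm ((cmod (f z))\<^sup>2) \<le> norm (K\<^sup>2 * (case z of (x, y) \<Rightarrow> ?e x * ?e y))"
      by (intro AE_I2) (auto split: prod.split)
  qed measurable
  then show ?thesis
    by (simp add: sq_integrable_def)
qed

text \<open>A Gaussian with any exponential weight is in \<open>L2\<close>, so its product with
  \<open>F\<close> is integrable. Real and imaginary parts of Gaussian times \<open>F\<close> thus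
  have all exponential moments, and orthogonality says that their moments vanish.\<close>

lemma gauss_monomials_total:
  fixes f :: "(real \<times> real) L2"
  assumes h: "h > 0"
    and orth: "\<And>i j. cinner (abs_L2 (\<lambda>(x, y). of_real (x ^ i * y ^ j * exp (- (x\<^sup>2 + y\<^sup>2) / (2 * h))))) f = 0"
  shows "f = 0"
proof -
  define F where "F = rep_L2 f"
  have F: "sq_integrable F" "f = abs_L2 F"
    by (simp_all add: F_def sq_integrable_rep)
  then have [measurable]: "F \<in> borel_measurable borel"
    by (simp add: sq_integrable_def)
  let ?G = "\<lambda>x y::real. exp (- (x\<^sup>2 + y\<^sup>2) / (2 * h))"
  have mono: "sq_integrable (\<lambda>(x, y). of_real (x ^ i * y ^ j * ?G x y))" for i j
  proof (rule sq_integrable_gauss_bound[OF h])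
    show "(\<lambda>(x, y). complex_of_real (x ^ i * y ^ j * ?G x y)) \<in> borel_measurable borel"
      unfolding borel_prod[symmetric] by measurable
    show "cmod (case (x, y) of (x, y) \<Rightarrow> complex_of_real (x ^ i * y ^ j * ?G x y))
        \<le> (fact i * fact j) * exp (1 * (\<bar>x\<bar> + \<bar>y\<bar>)) * ?G x y" for x y
    proof -
      have "\<bar>x\<bar> ^ i * \<bar>y\<bar> ^ j \<le> (fact i * exp \<bar>x\<bar>) * (fact j * exp \<bar>y\<bar>)"
        by (intro mult_mono power_le_fact_exp) auto
      then show ?thesis
        by (simp add: norm_mult norm_power exp_add mult_ac)
    qed
  qed
  have ex: "sq_integrable (\<lambda>(x, y). of_real (exp (n * (\<bar>x\<bar> + \<bar>y\<bar>)) * ?G x y))" for n :: nat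
    by (rule sq_integrable_gauss_bound[OF h, where K = 1 and b = n])
      (auto simp: norm_mult simp flip: borel_prod)
  have int: "integrable lborel (\<lambda>(x, y). of_real (exp (n * (\<bar>x\<bar> + \<bar>y\<bar>)) * ?G x y) * F (x, y))" for n :: nat
    using sq_integrable_mult[OF ex[of n] F(1)] by (simp add: case_prod_beta')
  have zero: "(\<integral>(x, y). of_real (x ^ i * y ^ j * ?G x y) * F (x, y) \<partial>lborel) = 0"
    and imono: "integrable lborel (\<lambda>(x, y). of_real (x ^ i * y ^ j * ?G x y) * F (x, y))" for i j
    using orth[of i j] sq_integrable_mult[OF mono[of i j] F(1)]
    unfolding F(2) cinner_abs[OF mono F(1)] by (simp_all add: case_prod_beta')
  have "AE z in lborel. (case z of (x, y) \<Rightarrow> ?G x y * Re (F (x, y))) = 0"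
  proof (rule moments_zero_imp_AE_zero_pair)
    show "integrable lborel (\<lambda>(x, y). exp (n * (\<bar>x\<bar> + \<bar>y\<bar>)) * (case (x, y) of (x, y) \<Rightarrow> ?G x y * Re (F (x, y))))" for n :: nat
      using integrable_Re[OF int[of n]] by (simp add: case_prod_beta' mult_ac)
    show "(\<integral>(x, y). (case (x, y) of (x, y) \<Rightarrow> ?G x y * Re (F (x, y))) * x ^ i * y ^ j \<partial>lborel) = 0" for i j
      using arg_cong[OF zero[of i j], of Re] integral_Re[OF imono[of i j]]
      by (simp add: case_prod_beta' mult_ac)
  qed
  moreover have "AE z in lborel. (case z of (x, y) \<Rightarrow> ?G x y * Im (F (x, y))) = 0"
  proof (rule moments_zero_imp_AE_zero_pair)
    show "integrable lborel (\<lambda>(x, y). exp (n * (\<bar>x\<bar> + \<bar>y\<bar>)) * (case (x, y) of (x, y) \<Rightarrow> ?G x y * Im (F (x, y))))" for n :: nat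
      using integrable_Im[OF int[of n]] by (simp add: case_prod_beta' mult_ac)
    show "(\<integral>(x, y). (case (x, y) of (x, y) \<Rightarrow> ?G x y * Im (F (x, y))) * x ^ i * y ^ j \<partial>lborel) = 0" for i j
      using arg_cong[OF zero[of i j], of Im] integral_Im[OF imono[of i j]]
      by (simp add: case_prod_beta' mult_ac)
  qed
  ultimately have "AE z in lborel. F z = 0"
    by eventually_elim (auto simp: complex_eq_iff)
  then show ?thesis
    unfolding F(2) zero_abs using F(1) by (simp add: abs_L2_eq_iff sq_integrable_zero)
qed

section \<open>Functions of rapid decay\<close>

definition rapid :: "(real \<times> real \<Rightarrow> complex) \<Rightarrow> bool" where
  "rapid f \<longleftrightarrow> (\<forall>k. bounded (range (\<lambda>z. norm z ^ k *\<^sub>R f z)))"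

definition pderivs ::
    "(real \<times> real \<Rightarrow> complex) \<Rightarrow> (real \<times> real \<Rightarrow> complex) \<Rightarrow> (real \<times> real \<Rightarrow> complex) \<Rightarrow> bool" where
  "pderivs f f1 f2 \<longleftrightarrow> (\<forall>z. (f has_derivative (\<lambda>h. fst h *\<^sub>R f1 z + snd h *\<^sub>R f2 z)) (at z))"

text \<open>A majorant of product form is integrable on the plane and on every line parallel to an
  axis, and it tends to zero along such lines. Integration by parts with Fubini uses all
  three.\<close>

definition decays :: "(real \<times> real \<Rightarrow> complex) \<Rightarrow> bool" where
  "decays f \<longleftrightarrow> (\<exists>K. \<forall>x y. cmod (f (x, y)) \<le> K * (inverse (1 + x\<^sup>2) * inverse (1 + y\<^sup>2)))"

lemma rapidD:
  assumes "rapid f"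
  obtains K where "K \<ge> 0" "\<And>z. norm z ^ k * cmod (f z) \<le> K"
proof -
  obtain K where K: "\<And>z. norm (norm z ^ k *\<^sub>R f z) \<le> K"
    using assms unfolding rapid_def bounded_iff by blast
  have "K \<ge> 0"
    by (rule order_trans[OF norm_ge_zero K])
  then show ?thesis
    using that K by simp
qed

lemma rapidI:
  assumes "\<And>k. \<exists>K. \<forall>z. norm z ^ k * cmod (f z) \<le> K"
  shows "rapid f"
  using assms by (simp add: rapid_def bounded_iff)

lemma rapid_add:
  assumes "rapid f" "rapid g"
  shows "rapid (\<lambda>z. f z + g z)"
proof (rule rapidI)
  fix k
  obtain K L where K: "\<And>z. norm z ^ k * cmod (f z) \<le> K" and L: "\<And>z. norm z ^ k * cmod (g z) \<le> L"
    using rapidD[OF assms(1)] rapidD[OF assms(2)] by metis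
  have "norm z ^ k * cmod (f z + g z) \<le> K + L" for z
  proof -
    have "norm z ^ k * cmod (f z + g z) \<le> norm z ^ k * (cmod (f z) + cmod (g z))"
      by (intro mult_left_mono norm_triangle_ineq) simp
    then show ?thesis
      using K[of z] L[of z] by (simp add: ring_distribs)
  qed
  then show "\<exists>K. \<forall>z. norm z ^ k * cmod (f z + g z) \<le> K"
    by blast
qed

lemma rapid_scale:
  assumes "rapid f"
  shows "rapid (\<lambda>z. c * f z)"
proof (rule rapidI)
  fix k
  obtain K where K: "\<And>z. norm z ^ k * cmod (f z) \<le> K"
    using rapidD[OF assms] by metis
  have "norm z ^ k * cmod (c * f z) \<le> cmod c * K" for z
    using mult_left_mono[OF K[of z], of "cmod c"] by (simp add: norm_mult mult_ac)
  then show "\<exists>K. \<forall>z. norm z ^ k * cmod (c * f z) \<le> K"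
    by blast
qed

lemma rapid_diff: "rapid f \<Longrightarrow> rapid g \<Longrightarrow> rapid (\<lambda>z. f z - g z)"
  using rapid_add[of f "\<lambda>z. (- 1) * g z"] rapid_scale[of g "- 1"] by simp

lemma rapid_cnj: "rapid f \<Longrightarrow> rapid (\<lambda>z. cnj (f z))"
  by (simp add: rapid_def bounded_iff)

lemma rapid_mult:
  assumes "rapid f" "rapid g"
  shows "rapid (\<lambda>z. f z * g z)"
proof (rule rapidI)
  fix k
  obtain K where K: "K \<ge> 0" "\<And>z. norm z ^ k * cmod (f z) \<le> K"
    using rapidD[OF assms(1)] by metis
  obtain L where L: "\<And>z. norm z ^ 0 * cmod (g z) \<le> L"
    using rapidD[OF assms(2)] by metis
  have "norm z ^ k * cmod (f z * g z) \<le> K * L" for z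
    using mult_mono[OF K(2) L, of z z] K(1) by (simp add: norm_mult mult.assoc)
  then show "\<exists>K. \<forall>z. norm z ^ k * cmod (f z * g z) \<le> K"
    by blast
qed

lemma rapid_mult_coord:
  assumes "rapid f"
  shows "rapid (\<lambda>z. of_real (fst z - snd z) * f z)"
proof (rule rapidI)
  fix k
  obtain K where K: "\<And>z. norm z ^ Suc k * cmod (f z) \<le> K"
    using rapidD[OF assms] by metis
  have "norm z ^ k * cmod (of_real (fst z - snd z) * f z) \<le> 2 * K" for z
  proof -
    have "\<bar>fst z - snd z\<bar> \<le> 2 * norm z"
      using abs_triangle_ineq4[of "fst z" "snd z"] norm_fst_le[of "fst z" "snd z"] norm_snd_le[of "snd z" "fst z"]
      by simp
    then have "\<bar>fst z - snd z\<bar> * (norm z ^ k * cmod (f z)) \<le> 2 * norm z * (norm z ^ k * cmod (f z))"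
      by (intro mult_right_mono) auto
    also have "\<dots> \<le> 2 * K"
      using K[of z] by (simp add: mult.assoc)
    finally show ?thesis
      by (simp only: norm_mult norm_of_real mult_ac)
  qed
  then show "\<exists>K. \<forall>z. norm z ^ k * cmod (of_real (fst z - snd z) * f z) \<le> K"
    by blast
qed

lemma rapid_decays:
  assumes "rapid f"
  shows "decays f"
proof -
  obtain K where K: "\<And>z. norm z ^ 0 * cmod (f z) \<le> K"
    using rapidD[OF assms] by metis
  obtain L where L: "\<And>z. norm z ^ 4 * cmod (f z) \<le> L"
    using rapidD[OF assms] by metis
  have "cmod (f (x, y)) \<le> (2 * K + 2 * L) * (inverse (1 + x\<^sup>2) * inverse (1 + y\<^sup>2))" for x y
  proof -
    have n4: "norm (x, y) ^ 4 = (x\<^sup>2 + y\<^sup>2)\<^sup>2"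
      by (simp add: norm_Pair power4_eq_xxxx power2_eq_square mult.assoc[symmetric])
    \<comment> \<open>With p = x^2, q = y^2 and S = (p + q)^2, this combines p q <= S with 2 (p + q)
      <= 1 + S. Powers 0 and 4 of the norm are then enough.\<close>
    have "(1 + x\<^sup>2) * (1 + y\<^sup>2) \<le> 2 + 2 * (x\<^sup>2 + y\<^sup>2)\<^sup>2"
    proof -
      define p q where "p = x\<^sup>2" and "q = y\<^sup>2"
      have "0 \<le> p" "0 \<le> q"
        by (simp_all add: p_def q_def)
      define S where "S = (p + q)\<^sup>2"
      have "p * q \<le> S" "0 \<le> S"
        using \<open>0 \<le> p\<close> \<open>0 \<le> q\<close> by (simp_all add: S_def power2_eq_square algebra_simps)
      moreover have "2 * (p + q) \<le> 1 + S"
        using zero_le_power2[of "p + q - 1"] by (simp add: S_def power2_eq_square algebra_simps)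
      ultimately have "1 + (p + q) + p * q \<le> 2 + 2 * S"
        by argo
      moreover have "(1 + p) * (1 + q) = 1 + (p + q) + p * q"
        by (simp add: algebra_simps)
      ultimately have "(1 + p) * (1 + q) \<le> 2 + 2 * (p + q)\<^sup>2"
        by (simp add: S_def)
      then show ?thesis
        by (simp add: p_def q_def)
    qed
    then have "(1 + x\<^sup>2) * (1 + y\<^sup>2) * cmod (f (x, y)) \<le> (2 + 2 * (x\<^sup>2 + y\<^sup>2)\<^sup>2) * cmod (f (x, y))"
      by (intro mult_right_mono) auto
    also have "\<dots> \<le> 2 * K + 2 * L"
      using K[of "(x, y)"] L[of "(x, y)"] unfolding n4 by (simp add: ring_distribs)
    finally have *: "(1 + x\<^sup>2) * (1 + y\<^sup>2) * cmod (f (x, y)) \<le> 2 * K + 2 * L" .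
    have pos: "0 < (1 + x\<^sup>2) * (1 + y\<^sup>2)"
      by (intro mult_pos_pos add_pos_nonneg) auto
    have "cmod (f (x, y)) \<le> (2 * K + 2 * L) / ((1 + x\<^sup>2) * (1 + y\<^sup>2))"
      using * by (subst pos_le_divide_eq[OF pos]) (simp only: mult.commute)
    then show ?thesis
      by (simp add: divide_inverse)
  qed
  then show ?thesis
    unfolding decays_def by blast
qed

lemma integrable_inverse_one_plus_square: "integrable lborel (\<lambda>x::real. inverse (1 + x\<^sup>2))"
  using integrable_inverse_1_plus_square by (simp add: set_integrable_def)

lemma decays_integrable:
  assumes "decays f" "continuous_on UNIV f"
  shows "integrable lborel f"
proof -
  have [measurable]: "f \<in> borel_measurable borel"
    using assms(2) by (rule borel_measurable_continuous_onI)
  obtain K where K: "\<And>x y :: real. cmod (f (x, y)) \<le> K * (inverse (1 + x\<^sup>2) * inverse (1 + y\<^sup>2))"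
    using assms unfolding decays_def by blast
  have "integrable (lborel \<Otimes>\<^sub>M lborel) (\<lambda>(x::real, y::real). inverse (1 + x\<^sup>2) * inverse (1 + y\<^sup>2))"
    using integrable_inverse_one_plus_square by (intro lborel_pair.Fubini_integrable) auto
  then have "integrable lborel (\<lambda>z::real \<times> real. K * (case z of (x, y) \<Rightarrow> inverse (1 + x\<^sup>2) * inverse (1 + y\<^sup>2)))"
    by (simp add: lborel_prod)
  then show ?thesis
  proof (rule Bochner_Integration.integrable_bound)
    show "AE z in lborel. norm (f z) \<le> norm (K * (case z of (x, y) \<Rightarrow> inverse (1 + x\<^sup>2) * inverse (1 + y\<^sup>2)))"
      using K by (intro AE_I2) (auto intro: order_trans[OF _ abs_ge_self] split: prod.split)
  qed measurable
qed

lemma rapid_sq_integrable: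
  assumes "rapid f" "continuous_on UNIV f"
  shows "sq_integrable f"
proof -
  have "integrable lborel (\<lambda>z. cnj (f z) * f z)"
    using assms by (intro decays_integrable rapid_decays rapid_mult rapid_cnj continuous_intros)
  from integrable_norm[OF this] have "integrable lborel (\<lambda>z. (cmod (f z))\<^sup>2)"
    by (simp add: norm_mult power2_eq_square)
  then show ?thesis
    using borel_measurable_continuous_onI[OF assms(2)] by (simp add: sq_integrable_def)
qed

text \<open>The fundamental theorem on \<open>{- n..n}\<close> leaves boundary terms that tend to
  zero by the decay of \<open>G\<close>, while dominated convergence recovers the full
  integral.\<close>

lemma integral_derivative_eq_zero:
  fixes G g :: "real \<Rightarrow> complex"
  assumes G: "\<And>x. (G has_vector_derivative g x) (at x)"
    and g: "continuous_on UNIV g" "integrable lborel g"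
    and lim: "\<And>x. cmod (G x) \<le> K * inverse (1 + x\<^sup>2)"
  shows "integral\<^sup>L lborel g = 0"
proof -
  \<comment> \<open>The sign \<open>s\<close> is 1 or -1, so that both endpoints are treated at
    once.\<close>
  have Glim: "((\<lambda>n. G (s * real n)) \<longlonglongrightarrow> 0)" if s: "s\<^sup>2 = 1" for s
  proof (rule Lim_null_comparison)
    have K: "K \<ge> 0"
      using order_trans[OF norm_ge_zero lim[of 0]] by simp
    show "\<forall>\<^sub>F n in sequentially. cmod (G (s * real n)) \<le> K * inverse (real n)"
    proof (rule eventually_sequentiallyI[of 1])
      fix n :: nat assume "1 \<le> n"
      have "(s * real n)\<^sup>2 = (real n)\<^sup>2"
        using s by (simp add: power_mult_distrib)
      moreover have "real n \<le> (real n)\<^sup>2"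
        using \<open>1 \<le> n\<close> by (simp add: power2_eq_square)
      ultimately have "real n \<le> 1 + (s * real n)\<^sup>2"
        by linarith
      then have "inverse (1 + (s * real n)\<^sup>2) \<le> inverse (real n)"
        using \<open>1 \<le> n\<close> by (intro le_imp_inverse_le) auto
      then show "cmod (G (s * real n)) \<le> K * inverse (real n)"
        by (intro order_trans[OF lim[of "s * real n"]] mult_left_mono K)
    qed
    show "(\<lambda>n. K * inverse (real n)) \<longlonglongrightarrow> 0"
      by (intro tendsto_mult_right_zero lim_inverse_n)
  qed
  have "(\<lambda>n. \<integral>x. indicator {- real n..real n} x *\<^sub>R g x \<partial>lborel) \<longlonglongrightarrow> integral\<^sup>L lborel g"
  proof (rule integral_dominated_convergence[where w = "\<lambda>x. norm (g x)"])
    show "AE x in lborel. (\<lambda>n. indicator {- real n..real n} x *\<^sub>R g x) \<longlonglongrightarrow> g x"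
    proof (intro AE_I2 tendsto_eventually)
      fix x
      obtain N :: nat where N: "\<bar>x\<bar> \<le> real N"
        using real_arch_simple by blast
      show "\<forall>\<^sub>F n in sequentially. indicator {- real n..real n} x *\<^sub>R g x = g x"
        using N by (intro eventually_sequentiallyI[of N]) (auto simp: indicator_def)
    qed
  qed (use g in \<open>auto simp: indicator_def\<close>)
  moreover have "(\<integral>x. indicator {- real n..real n} x *\<^sub>R g x \<partial>lborel) = G (1 * real n) - G (- 1 * real n)" for n
    using G g(1) integral_FTC_Icc[of "- real n" "real n" G g]
    by (simp add: has_vector_derivative_at_within continuous_on_subset)
  moreover have "(\<lambda>n. G (1 * real n) - G (- 1 * real n)) \<longlonglongrightarrow> 0 - 0"
    by (intro tendsto_diff Glim) auto
  ultimately show ?thesis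
    using LIMSEQ_unique by fastforce
qed

lemma pderivs_continuous:
  assumes "pderivs f f1 f2"
  shows "continuous_on UNIV f"
  using assms unfolding pderivs_def
  by (meson continuous_at_imp_continuous_on has_derivative_continuous)

lemma pderivs_section:
  assumes "pderivs f f1 f2"
  shows "((\<lambda>x. f (x, y)) has_vector_derivative f1 (x, y)) (at x)"
    and "((\<lambda>y. f (x, y)) has_vector_derivative f2 (x, y)) (at y)"
proof -
  have f: "(f has_derivative (\<lambda>h. fst h *\<^sub>R f1 (x, y) + snd h *\<^sub>R f2 (x, y))) (at (x, y))"
    using assms by (simp add: pderivs_def)
  have "((\<lambda>x. (x, y)) has_derivative (\<lambda>h. (h, 0))) (at x)"
    by (auto intro!: derivative_eq_intros)
  from has_derivative_compose[OF this f]
  show "((\<lambda>x. f (x, y)) has_vector_derivative f1 (x, y)) (at x)"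
    by (simp add: has_vector_derivative_def)
  have "((\<lambda>y. (x, y)) has_derivative (\<lambda>h. (0, h))) (at y)"
    by (auto intro!: derivative_eq_intros)
  from has_derivative_compose[OF this f]
  show "((\<lambda>y. f (x, y)) has_vector_derivative f2 (x, y)) (at y)"
    by (simp add: has_vector_derivative_def)
qed

lemma inverse_one_plus_square_le_1: "inverse (1 + x\<^sup>2) \<le> (1::real)"
  by (simp add: inverse_le_1_iff)

text \<open>By Fubini the inner integral can be taken along the variable of differentiation, where
  the one-dimensional statement makes it vanish.\<close>

lemma integral_pderivs_eq_zero:
  assumes F: "pderivs F F1 F2" and d: "decays F" "decays F1" "decays F2"
    and c: "continuous_on UNIV F1" "continuous_on UNIV F2"
  shows "integral\<^sup>L lborel F1 = 0" "integral\<^sup>L lborel F2 = 0"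
proof -
  have sec: "\<exists>K. \<forall>x y :: real. cmod (g (x, y)) \<le> K * inverse (1 + x\<^sup>2) \<and> cmod (g (x, y)) \<le> K * inverse (1 + y\<^sup>2)"
    if dg: "decays g" for g :: "real \<times> real \<Rightarrow> complex"
  proof -
    obtain K where K: "\<And>x y :: real. cmod (g (x, y)) \<le> K * (inverse (1 + x\<^sup>2) * inverse (1 + y\<^sup>2))"
      using dg unfolding decays_def by blast
    have K0: "K \<ge> 0"
      using order_trans[OF norm_ge_zero K[of 0 0]] by simp
    have "K * (inverse (1 + x\<^sup>2) * inverse (1 + y\<^sup>2)) \<le> K * (inverse (1 + x\<^sup>2) * 1)"
      "K * (inverse (1 + x\<^sup>2) * inverse (1 + y\<^sup>2)) \<le> K * (1 * inverse (1 + y\<^sup>2))" for x y :: real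
      using K0 by (intro mult_left_mono mult_mono inverse_one_plus_square_le_1; simp)+
    then have "cmod (g (x, y)) \<le> K * inverse (1 + x\<^sup>2)" "cmod (g (x, y)) \<le> K * inverse (1 + y\<^sup>2)" for x y
      using order_trans[OF K] by simp_all
    then show ?thesis
      by blast
  qed
  have int1: "integrable lborel (\<lambda>x. g (x, y))" and int2: "integrable lborel (\<lambda>y. g (x, y))"
    if g: "decays g" "continuous_on UNIV g" for g :: "real \<times> real \<Rightarrow> complex" and x y
  proof -
    obtain K where K: "\<And>x y :: real. cmod (g (x, y)) \<le> K * inverse (1 + x\<^sup>2)"
      "\<And>x y :: real. cmod (g (x, y)) \<le> K * inverse (1 + y\<^sup>2)"
      using sec[OF g(1)] by blast
    have [measurable]: "(\<lambda>x. g (x, y)) \<in> borel_measurable borel" "(\<lambda>y. g (x, y)) \<in> borel_measurable borel"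
      by (intro borel_measurable_continuous_onI continuous_on_compose2[OF g(2)] continuous_intros; simp)+
    show "integrable lborel (\<lambda>x. g (x, y))"
      by (rule Bochner_Integration.integrable_bound[OF integrable_mult_right[OF integrable_inverse_one_plus_square, of K]])
        (auto intro: order_trans[OF K(1) abs_ge_self])
    show "integrable lborel (\<lambda>y. g (x, y))"
      by (rule Bochner_Integration.integrable_bound[OF integrable_mult_right[OF integrable_inverse_one_plus_square, of K]])
        (auto intro: order_trans[OF K(2) abs_ge_self])
  qed
  obtain K where K: "\<And>x y :: real. cmod (F (x, y)) \<le> K * inverse (1 + x\<^sup>2)"
      "\<And>x y :: real. cmod (F (x, y)) \<le> K * inverse (1 + y\<^sup>2)"
    using sec[OF d(1)] by blast
  have "(\<integral>x. F1 (x, y) \<partial>lborel) = 0" for y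
    by (rule integral_derivative_eq_zero[OF pderivs_section(1)[OF F] _ int1[OF d(2) c(1)] K(1)])
      (intro continuous_on_compose2[OF c(1)] continuous_intros; simp)
  moreover have "(\<integral>y. \<integral>x. F1 (x, y) \<partial>lborel \<partial>lborel) = integral\<^sup>L (lborel \<Otimes>\<^sub>M lborel) F1"
    using decays_integrable[OF d(2) c(1)] lborel_pair.integral_snd[of "\<lambda>x y. F1 (x, y)"]
    by (simp add: lborel_prod)
  ultimately show "integral\<^sup>L lborel F1 = 0"
    by (simp add: lborel_prod)
  have "(\<integral>y. F2 (x, y) \<partial>lborel) = 0" for x
    by (rule integral_derivative_eq_zero[OF pderivs_section(2)[OF F] _ int2[OF d(3) c(2)] K(2)])
      (intro continuous_on_compose2[OF c(2)] continuous_intros; simp)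
  moreover have "(\<integral>x. \<integral>y. F2 (x, y) \<partial>lborel \<partial>lborel) = integral\<^sup>L (lborel \<Otimes>\<^sub>M lborel) F2"
    using decays_integrable[OF d(3) c(2)] by (intro lborel_pair.integral_fst') (simp add: lborel_prod)
  ultimately show "integral\<^sup>L lborel F2 = 0"
    by (simp add: lborel_prod)
qed

section \<open>Calculus of partial derivatives and Schwartz functions\<close>

lemma pderivsD:
  "pderivs f f1 f2 \<Longrightarrow> (f has_derivative (\<lambda>h. fst h *\<^sub>R f1 z + snd h *\<^sub>R f2 z)) (at z)"
  unfolding pderivs_def by blast

lemma pderivs_lin:
  assumes "pderivs f f1 f2" "pderivs g g1 g2"
  shows "pderivs (\<lambda>z. c * f z + d * g z) (\<lambda>z. c * f1 z + d * g1 z) (\<lambda>z. c * f2 z + d * g2 z)"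
  unfolding pderivs_def
proof
  fix z
  have "((\<lambda>z. c * f z + d * g z) has_derivative
      (\<lambda>h. c * (fst h *\<^sub>R f1 z + snd h *\<^sub>R f2 z) + d * (fst h *\<^sub>R g1 z + snd h *\<^sub>R g2 z))) (at z)"
    using assms by (intro derivative_intros pderivsD)
  then show "((\<lambda>z. c * f z + d * g z) has_derivative
      (\<lambda>h. fst h *\<^sub>R (c * f1 z + d * g1 z) + snd h *\<^sub>R (c * f2 z + d * g2 z))) (at z)"
    by (simp add: algebra_simps)
qed

lemma pderivs_mult:
  assumes "pderivs f f1 f2" "pderivs g g1 g2"
  shows "pderivs (\<lambda>z. f z * g z) (\<lambda>z. f1 z * g z + f z * g1 z) (\<lambda>z. f2 z * g z + f z * g2 z)"
  unfolding pderivs_def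
proof
  fix z
  have "((\<lambda>z. f z * g z) has_derivative
      (\<lambda>h. f z * (fst h *\<^sub>R g1 z + snd h *\<^sub>R g2 z) + (fst h *\<^sub>R f1 z + snd h *\<^sub>R f2 z) * g z)) (at z)"
    using assms by (intro derivative_intros pderivsD)
  then show "((\<lambda>z. f z * g z) has_derivative
      (\<lambda>h. fst h *\<^sub>R (f1 z * g z + f z * g1 z) + snd h *\<^sub>R (f2 z * g z + f z * g2 z))) (at z)"
    by (simp add: algebra_simps)
qed

lemma pderivs_cnj:
  assumes "pderivs f f1 f2"
  shows "pderivs (\<lambda>z. cnj (f z)) (\<lambda>z. cnj (f1 z)) (\<lambda>z. cnj (f2 z))"
  unfolding pderivs_def
proof
  fix z
  have "((\<lambda>z. cnj (f z)) has_derivative (\<lambda>h. cnj (fst h *\<^sub>R f1 z + snd h *\<^sub>R f2 z))) (at z)"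
    using assms by (intro derivative_intros pderivsD)
  then show "((\<lambda>z. cnj (f z)) has_derivative (\<lambda>h. fst h *\<^sub>R cnj (f1 z) + snd h *\<^sub>R cnj (f2 z))) (at z)"
    by (simp add: complex_cnj_scaleR)
qed

lemma pderivs_coord: "pderivs (\<lambda>z. of_real (fst z - snd z)) (\<lambda>z. 1) (\<lambda>z. - 1)"
  unfolding pderivs_def
proof
  fix z :: "real \<times> real"
  have "((\<lambda>z. complex_of_real (fst z - snd z)) has_derivative (\<lambda>h. complex_of_real (fst h - snd h))) (at z)"
    by (auto intro!: derivative_intros)
  then show "((\<lambda>z. complex_of_real (fst z - snd z)) has_derivative (\<lambda>h. fst h *\<^sub>R 1 + snd h *\<^sub>R (- 1))) (at z)"
    by (simp add: scaleR_conv_of_real)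
qed

lemma rel_deriv_eq:
  assumes "pderivs f f1 f2"
  shows "rel_deriv f = (\<lambda>z. f1 z - f2 z)"
proof
  fix z
  have "frechet_derivative f (at z) = (\<lambda>h. fst h *\<^sub>R f1 z + snd h *\<^sub>R f2 z)"
    by (rule frechet_derivative_at[OF pderivsD[OF assms], symmetric])
  then show "rel_deriv f z = f1 z - f2 z"
    by (simp add: rel_deriv_def)
qed

lemma schwartzE:
  assumes "schwartz f"
  obtains f1 f2 where "rapid f" "pderivs f f1 f2" "schwartz f1" "schwartz f2"
  using assms by (cases rule: schwartz.cases) (auto simp: rapid_def pderivs_def)

lemma schwartz_lin:
  assumes "schwartz f" "schwartz g"
  shows "schwartz (\<lambda>z. c * f z + d * g z)"
proof -
  \<comment> \<open>The coinduction invariant: linear combinations with fixed coefficients, which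
    the partial derivatives map to linear combinations with the same coefficients.\<close>
  define X where "X u \<longleftrightarrow> (\<exists>f g. schwartz f \<and> schwartz g \<and> u = (\<lambda>z. c * f z + d * g z))" for u
  have "X (\<lambda>z. c * f z + d * g z)"
    using assms unfolding X_def by blast
  then show ?thesis
  proof (rule schwartz.coinduct)
    fix u assume "X u"
    then obtain f g where fg: "schwartz f" "schwartz g" "u = (\<lambda>z. c * f z + d * g z)"
      unfolding X_def by blast
    obtain f1 f2 where f: "rapid f" "pderivs f f1 f2" "schwartz f1" "schwartz f2"
      using schwartzE[OF fg(1)] .
    obtain g1 g2 where g: "rapid g" "pderivs g g1 g2" "schwartz g1" "schwartz g2"
      using schwartzE[OF fg(2)] .
    have "rapid u" "pderivs u (\<lambda>z. c * f1 z + d * g1 z) (\<lambda>z. c * f2 z + d * g2 z)"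
      unfolding fg(3) by (intro rapid_add rapid_scale f g pderivs_lin)+
    moreover have "X (\<lambda>z. c * f1 z + d * g1 z)" "X (\<lambda>z. c * f2 z + d * g2 z)"
      using f g unfolding X_def by blast+
    ultimately show "\<exists>f f1 f2. u = f \<and> (\<forall>k. bounded (range (\<lambda>z. norm z ^ k *\<^sub>R f z))) \<and>
        (\<forall>z. (f has_derivative (\<lambda>h. fst h *\<^sub>R f1 z + snd h *\<^sub>R f2 z)) (at z)) \<and>
        (X f1 \<or> schwartz f1) \<and> (X f2 \<or> schwartz f2)"
      unfolding rapid_def pderivs_def
      by (intro exI[of _ u] exI[of _ "\<lambda>z. c * f1 z + d * g1 z"] exI[of _ "\<lambda>z. c * f2 z + d * g2 z"]) simp
  qed
qed

section \<open>The cost operator on Schwartz functions\<close>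

text \<open>The annihilation operator \<open>b = (x - y) + h (\<partial>\<^sub>x - \<partial>\<^sub>y)\<close>; the cost is \<open>b\<^sup>* b\<close>.\<close>
definition lower :: "real \<Rightarrow> (real \<times> real \<Rightarrow> complex) \<Rightarrow> real \<times> real \<Rightarrow> complex" where
  "lower h f z = of_real (fst z - snd z) * f z + of_real h * rel_deriv f z"

lemma schwartz_rapid: "schwartz f \<Longrightarrow> rapid f"
  by (erule schwartzE)

lemma schwartz_continuous: "schwartz f \<Longrightarrow> continuous_on UNIV f"
  by (erule schwartzE) (rule pderivs_continuous)

lemma schwartz_sq_integrable: "schwartz f \<Longrightarrow> sq_integrable f"
  by (intro rapid_sq_integrable schwartz_rapid schwartz_continuous)

lemma schwartz_rel_deriv:
  assumes "schwartz f"
  shows "schwartz (rel_deriv f)"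
proof -
  obtain f1 f2 where f: "pderivs f f1 f2" "schwartz f1" "schwartz f2"
    using schwartzE[OF assms] .
  have "schwartz (\<lambda>z. 1 * f1 z + (- 1) * f2 z)"
    by (intro schwartz_lin f)
  then show ?thesis
    by (simp add: rel_deriv_eq[OF f(1)])
qed

lemma rel_deriv_lin:
  assumes "schwartz f" "schwartz g"
  shows "rel_deriv (\<lambda>z. c * f z + d * g z) = (\<lambda>z. c * rel_deriv f z + d * rel_deriv g z)"
proof -
  obtain f1 f2 where f: "pderivs f f1 f2"
    using schwartzE[OF assms(1)] .
  obtain g1 g2 where g: "pderivs g g1 g2"
    using schwartzE[OF assms(2)] .
  show ?thesis
    by (simp add: rel_deriv_eq[OF f] rel_deriv_eq[OF g] rel_deriv_eq[OF pderivs_lin[OF f g]] algebra_simps)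
qed

lemma cost_expr_eq:
  "cost_expr h f = (\<lambda>z. of_real ((fst z - snd z)\<^sup>2) * f z
     - of_real (h\<^sup>2) * rel_deriv (rel_deriv f) z - of_real (2 * h) * f z)"
  by (auto simp: cost_expr_def)

lemma cost_expr_lin:
  assumes "schwartz f" "schwartz g"
  shows "cost_expr h (\<lambda>z. c * f z + d * g z) = (\<lambda>z. c * cost_expr h f z + d * cost_expr h g z)"
  unfolding cost_expr_eq rel_deriv_lin[OF assms]
    rel_deriv_lin[OF schwartz_rel_deriv schwartz_rel_deriv, OF assms]
  by (simp add: algebra_simps)

lemma cost_expr_sq_integrable:
  assumes "schwartz f"
  shows "sq_integrable (cost_expr h f)"
proof (rule rapid_sq_integrable)
  have f: "rapid f" "continuous_on UNIV f" "rapid (rel_deriv (rel_deriv f))"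
    "continuous_on UNIV (rel_deriv (rel_deriv f))"
    using assms schwartz_rel_deriv schwartz_rapid schwartz_continuous by blast+
  have "rapid (\<lambda>z. of_real (fst z - snd z) * (of_real (fst z - snd z) * f z)
     - of_real (h\<^sup>2) * rel_deriv (rel_deriv f) z - of_real (2 * h) * f z)"
    by (intro rapid_diff rapid_scale rapid_mult_coord f)
  then show "rapid (cost_expr h f)"
    by (simp add: cost_expr_eq power2_eq_square mult.assoc)
  show "continuous_on UNIV (cost_expr h f)"
    unfolding cost_expr_eq by (intro continuous_intros f)
qed

lemma lower_rapid_continuous:
  assumes "schwartz f"
  shows "rapid (lower h f)" "continuous_on UNIV (lower h f)"
proof -
  have f: "rapid f" "continuous_on UNIV f" "rapid (rel_deriv f)" "continuous_on UNIV (rel_deriv f)"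
    using assms schwartz_rel_deriv schwartz_rapid schwartz_continuous by blast+
  show "rapid (lower h f)"
    unfolding lower_def[abs_def] by (intro rapid_add rapid_scale rapid_mult_coord f)
  show "continuous_on UNIV (lower h f)"
    unfolding lower_def[abs_def] by (intro continuous_intros f)
qed

lemma lower_sq_integrable: "schwartz f \<Longrightarrow> sq_integrable (lower h f)"
  by (intro rapid_sq_integrable lower_rapid_continuous)

text \<open>Integration by parts. With b the operator \<open>lower h\<close> and L = b g, the two
  integrands differ by h times the relative derivative of \<open>cnj (f z) * L z\<close>, which
  integrates to zero. The term -2h of the cost arises because the relative derivative of x - y is
  2.\<close>

lemma cinner_cost_expr:
  assumes f: "schwartz f" and g: "schwartz g"
  shows "cinner (abs_L2 f) (abs_L2 (cost_expr h g)) = cinner (abs_L2 (lower h f)) (abs_L2 (lower h g))"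
proof -
  define r where "r = rel_deriv g"
  have r: "schwartz r"
    unfolding r_def by (rule schwartz_rel_deriv[OF g])
  obtain f1 f2 where f12: "pderivs f f1 f2" "schwartz f1" "schwartz f2"
    using schwartzE[OF f] .
  obtain g1 g2 where g12: "pderivs g g1 g2" "schwartz g1" "schwartz g2"
    using schwartzE[OF g] .
  obtain r1 r2 where r12: "pderivs r r1 r2" "schwartz r1" "schwartz r2"
    using schwartzE[OF r] .
  note sch = f g r f12(2,3) g12(2,3) r12(2,3)
  define L where "L = lower h g"
  let ?u = "\<lambda>z::real \<times> real. complex_of_real (fst z - snd z)"
  have L: "L = (\<lambda>z. 1 * (?u z * g z) + of_real h * r z)"
    by (auto simp: L_def lower_def r_def)
  define L1 where "L1 = (\<lambda>z. 1 * (1 * g z + ?u z * g1 z) + of_real h * r1 z)"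
  define L2 where "L2 = (\<lambda>z. 1 * ((- 1) * g z + ?u z * g2 z) + of_real h * r2 z)"
  have dL: "pderivs L L1 L2"
    unfolding L L1_def L2_def by (intro pderivs_lin pderivs_mult pderivs_coord g12 r12)
  define F1 where "F1 = (\<lambda>z. cnj (f1 z) * L z + cnj (f z) * L1 z)"
  define F2 where "F2 = (\<lambda>z. cnj (f2 z) * L z + cnj (f z) * L2 z)"
  have dF: "pderivs (\<lambda>z. cnj (f z) * L z) F1 F2"
    unfolding F1_def F2_def by (intro pderivs_mult pderivs_cnj f12 dL)
  have ra: "rapid L" "rapid L1" "rapid L2"
    unfolding L L1_def L2_def
    by (intro rapid_add rapid_scale rapid_mult_coord schwartz_rapid sch)+
  have co: "continuous_on UNIV L" "continuous_on UNIV L1" "continuous_on UNIV L2"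
    unfolding L L1_def L2_def by (intro continuous_intros schwartz_continuous sch)+
  have d: "decays (\<lambda>z. cnj (f z) * L z)" "decays F1" "decays F2"
    unfolding F1_def F2_def
    by (intro rapid_decays rapid_add rapid_mult rapid_cnj ra schwartz_rapid sch)+
  have c: "continuous_on UNIV F1" "continuous_on UNIV F2"
    unfolding F1_def F2_def by (intro continuous_intros co schwartz_continuous sch)+
  have int: "integrable lborel F1" "integrable lborel F2"
    using decays_integrable d c by blast+
  have zero: "(\<integral>z. F1 z - F2 z \<partial>lborel) = 0"
    using integral_pderivs_eq_zero[OF dF d c] int by simp
  have pt: "cnj (f z) * cost_expr h g z = cnj (lower h f z) * L z - of_real h * (F1 z - F2 z)" for z
    unfolding cost_expr_eq r_def[symmetric] rel_deriv_eq[OF r12(1)] F1_def F2_def L1_def L2_def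
      lower_def rel_deriv_eq[OF f12(1)] L
    unfolding r_def rel_deriv_eq[OF g12(1)]
    by (simp add: algebra_simps power2_eq_square)
  have iL: "integrable lborel (\<lambda>z. cnj (lower h f z) * L z)"
    unfolding L_def by (intro sq_integrable_mult lower_sq_integrable f g)
  have "cinner (abs_L2 f) (abs_L2 (cost_expr h g))
      = (\<integral>z. cnj (lower h f z) * L z - of_real h * (F1 z - F2 z) \<partial>lborel)"
    by (simp add: cinner_abs schwartz_sq_integrable cost_expr_sq_integrable f g pt)
  also have "\<dots> = (\<integral>z. cnj (lower h f z) * L z \<partial>lborel) - of_real h * (\<integral>z. F1 z - F2 z \<partial>lborel)"
    using iL int by simp
  also have "\<dots> = cinner (abs_L2 (lower h f)) (abs_L2 (lower h g))"
    by (simp add: zero cinner_abs lower_sq_integrable f g L_def)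
  finally show ?thesis .
qed

lemma cinner_cost_expr_sym:
  assumes "schwartz f" "schwartz g"
  shows "cinner (abs_L2 f) (abs_L2 (cost_expr h g)) = cinner (abs_L2 (cost_expr h f)) (abs_L2 g)"
  using cinner_cost_expr[OF assms, of h] cinner_cost_expr[OF assms(2,1), of h] cinner_commute
  by metis

section \<open>Gaussians times polynomials\<close>

text \<open>Generated by closure rules instead of explicit polynomials, so that stability under
  partial derivatives is an induction. The linear terms in the exponent cover products of coherent
  states with zero momentum and arbitrary centres.\<close>

inductive pgauss :: "real \<Rightarrow> (real \<times> real \<Rightarrow> complex) \<Rightarrow> bool" for h where
  pgauss_exp: "pgauss h (\<lambda>z. of_real (exp (p * fst z + q * snd z - ((fst z)\<^sup>2 + (snd z)\<^sup>2) / (2 * h))))"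
| pgauss_fst: "pgauss h f \<Longrightarrow> pgauss h (\<lambda>z. of_real (fst z) * f z)"
| pgauss_snd: "pgauss h f \<Longrightarrow> pgauss h (\<lambda>z. of_real (snd z) * f z)"
| pgauss_lin: "pgauss h f \<Longrightarrow> pgauss h g \<Longrightarrow> pgauss h (\<lambda>z. c * f z + d * g z)"

lemma pgauss_scale: "pgauss h f \<Longrightarrow> pgauss h (\<lambda>z. c * f z)"
  using pgauss_lin[of h f f c 0] by simp

text \<open>A factor of linear growth is absorbed by raising the rate \<open>b\<close> by
  one.\<close>

lemma gauss_bound_mult:
  fixes f :: "real \<times> real \<Rightarrow> complex"
  assumes "\<exists>K b. 0 \<le> K \<and> (\<forall>z. cmod (f z) \<le> K * exp (b * (\<bar>fst z\<bar> + \<bar>snd z\<bar>)) * exp (- ((fst z)\<^sup>2 + (snd z)\<^sup>2) / (2 * h)))"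
    and t: "\<And>z. \<bar>t z\<bar> \<le> \<bar>fst z\<bar> + \<bar>snd z\<bar>"
  shows "\<exists>K b. 0 \<le> K \<and> (\<forall>z. cmod (of_real (t z) * f z) \<le> K * exp (b * (\<bar>fst z\<bar> + \<bar>snd z\<bar>)) * exp (- ((fst z)\<^sup>2 + (snd z)\<^sup>2) / (2 * h)))"
proof -
  from assms(1) obtain K b where K: "0 \<le> K"
    and b: "\<And>z. cmod (f z) \<le> K * exp (b * (\<bar>fst z\<bar> + \<bar>snd z\<bar>)) * exp (- ((fst z)\<^sup>2 + (snd z)\<^sup>2) / (2 * h))"
    by blast
  have "cmod (of_real (t z) * f z) \<le> K * exp ((b + 1) * (\<bar>fst z\<bar> + \<bar>snd z\<bar>)) * exp (- ((fst z)\<^sup>2 + (snd z)\<^sup>2) / (2 * h))" for z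
  proof -
    have "\<bar>t z\<bar> \<le> exp (\<bar>fst z\<bar> + \<bar>snd z\<bar>)"
      using exp_ge_add_one_self[of "\<bar>fst z\<bar> + \<bar>snd z\<bar>"] t[of z] by linarith
    then have "\<bar>t z\<bar> * cmod (f z) \<le> exp (\<bar>fst z\<bar> + \<bar>snd z\<bar>) * (K * exp (b * (\<bar>fst z\<bar> + \<bar>snd z\<bar>)) * exp (- ((fst z)\<^sup>2 + (snd z)\<^sup>2) / (2 * h)))"
      by (intro mult_mono b) auto
    then show ?thesis
      by (simp add: norm_mult ring_distribs exp_add mult_ac)
  qed
  then show ?thesis
    using K by blast
qed

lemma pgauss_bound:
  assumes "pgauss h f"
  shows "\<exists>K b. 0 \<le> K \<and> (\<forall>z. cmod (f z) \<le> K * exp (b * (\<bar>fst z\<bar> + \<bar>snd z\<bar>)) * exp (- ((fst z)\<^sup>2 + (snd z)\<^sup>2) / (2 * h)))"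
  using assms
proof induction
  case (pgauss_exp p q)
  have "p * fst z + q * snd z \<le> (\<bar>p\<bar> + \<bar>q\<bar>) * (\<bar>fst z\<bar> + \<bar>snd z\<bar>)" for z :: "real \<times> real"
  proof -
    have "p * fst z \<le> \<bar>p\<bar> * \<bar>fst z\<bar>" "q * snd z \<le> \<bar>q\<bar> * \<bar>snd z\<bar>"
      using abs_ge_self by (metis abs_mult)+
    moreover have "0 \<le> \<bar>p\<bar> * \<bar>snd z\<bar>" "0 \<le> \<bar>q\<bar> * \<bar>fst z\<bar>"
      by simp_all
    ultimately show ?thesis
      unfolding ring_distribs by linarith
  qed
  then have "exp (p * fst z + q * snd z) * exp (- ((fst z)\<^sup>2 + (snd z)\<^sup>2) / (2 * h))
      \<le> exp ((\<bar>p\<bar> + \<bar>q\<bar>) * (\<bar>fst z\<bar> + \<bar>snd z\<bar>)) * exp (- ((fst z)\<^sup>2 + (snd z)\<^sup>2) / (2 * h))"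
    for z :: "real \<times> real"
    by (intro mult_right_mono) auto
  moreover have "cmod (of_real (exp (p * fst z + q * snd z - ((fst z)\<^sup>2 + (snd z)\<^sup>2) / (2 * h))))
      = exp (p * fst z + q * snd z) * exp (- ((fst z)\<^sup>2 + (snd z)\<^sup>2) / (2 * h))" for z :: "real \<times> real"
    unfolding exp_add[symmetric] norm_of_real abs_exp_cancel by (simp add: diff_divide_distrib add_divide_distrib)
  ultimately show ?case
    by (intro exI[of _ 1] exI[of _ "\<bar>p\<bar> + \<bar>q\<bar>"]) (simp only: mult_1 zero_le_one simp_thms)
next
  case (pgauss_fst f)
  show ?case
    by (rule gauss_bound_mult[OF pgauss_fst.IH]) simp
next
  case (pgauss_snd f)
  show ?case
    by (rule gauss_bound_mult[OF pgauss_snd.IH]) simp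
next
  case (pgauss_lin f g c d)
  let ?e = "\<lambda>b z. exp (b * (\<bar>fst z\<bar> + \<bar>snd z\<bar>))" and ?G = "\<lambda>z. exp (- ((fst z)\<^sup>2 + (snd z)\<^sup>2) / (2 * h))"
  from pgauss_lin obtain K b K' b' where K: "0 \<le> K" "0 \<le> K'"
    and b: "\<And>z. cmod (f z) \<le> K * ?e b z * ?G z" and b': "\<And>z. cmod (g z) \<le> K' * ?e b' z * ?G z"
    by blast
  have "cmod (c * f z + d * g z) \<le> (cmod c * K + cmod d * K') * ?e (max b b') z * ?G z" for z
  proof -
    have e: "?e b z \<le> ?e (max b b') z" "?e b' z \<le> ?e (max b b') z"
      by (auto intro!: mult_right_mono)
    have "cmod (f z) \<le> K * ?e (max b b') z * ?G z"
      using K by (intro order_trans[OF b] mult_right_mono mult_left_mono e) auto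
    moreover have "cmod (g z) \<le> K' * ?e (max b b') z * ?G z"
      using K by (intro order_trans[OF b'] mult_right_mono mult_left_mono e) auto
    ultimately have "cmod c * cmod (f z) + cmod d * cmod (g z)
        \<le> cmod c * (K * ?e (max b b') z * ?G z) + cmod d * (K' * ?e (max b b') z * ?G z)"
      by (intro add_mono mult_left_mono) auto
    moreover have "cmod (c * f z + d * g z) \<le> cmod c * cmod (f z) + cmod d * cmod (g z)"
      using norm_triangle_ineq[of "c * f z" "d * g z"] unfolding norm_mult .
    ultimately have "cmod (c * f z + d * g z)
        \<le> cmod c * (K * ?e (max b b') z * ?G z) + cmod d * (K' * ?e (max b b') z * ?G z)"
      by linarith
    also have "\<dots> = (cmod c * K + cmod d * K') * ?e (max b b') z * ?G z"
      by (simp only: ring_distribs mult.assoc)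
    finally show ?thesis .
  qed
  moreover have "0 \<le> cmod c * K + cmod d * K'"
    using K by simp
  ultimately show ?case
    by blast
qed

lemma pgauss_rapid:
  assumes h: "h > 0" and f: "pgauss h f"
  shows "rapid f"
proof (rule rapidI)
  fix k
  obtain K b where K: "0 \<le> K"
    and b: "\<And>z. cmod (f z) \<le> K * exp (b * (\<bar>fst z\<bar> + \<bar>snd z\<bar>)) * exp (- ((fst z)\<^sup>2 + (snd z)\<^sup>2) / (2 * h))"
    using pgauss_bound[OF f] by blast
  \<comment> \<open>The left side is maximal at t = (b + 1) h. The two coordinates together
    contribute \<open>(b + 1)\<^sup>2 * h\<close>; the extra 1 in the rate pays for the power of the
    norm.\<close>
  have sq: "(b + 1) * t - t\<^sup>2 / (2 * h) \<le> (b + 1)\<^sup>2 * h / 2" for t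
  proof -
    have "(b + 1)\<^sup>2 * h / 2 - ((b + 1) * t - t\<^sup>2 / (2 * h)) = (t - (b + 1) * h)\<^sup>2 / (2 * h)"
      using h by (simp add: field_simps power2_eq_square)
    moreover have "0 \<le> (t - (b + 1) * h)\<^sup>2 / (2 * h)"
      using h by simp
    ultimately show ?thesis
      by linarith
  qed
  have "norm z ^ k * cmod (f z) \<le> fact k * K * exp ((b + 1)\<^sup>2 * h)" for z
  proof -
    let ?s = "\<bar>fst z\<bar> + \<bar>snd z\<bar>"
    have "norm z \<le> ?s"
      using norm_Pair_le[of "fst z" "snd z"] by simp
    then have "norm z ^ k \<le> ?s ^ k"
      by (intro power_mono) auto
    also have "\<dots> \<le> fact k * exp ?s"
      using power_le_fact_exp[of ?s k] by simp
    finally have "norm z ^ k * cmod (f z) \<le> (fact k * exp ?s) * (K * exp (b * ?s) * exp (- ((fst z)\<^sup>2 + (snd z)\<^sup>2) / (2 * h)))"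
      using b[of z] by (intro mult_mono) auto
    also have "\<dots> = fact k * K * exp (?s + b * ?s + - ((fst z)\<^sup>2 + (snd z)\<^sup>2) / (2 * h))"
      by (simp only: exp_add mult_ac)
    also have "?s + b * ?s + - ((fst z)\<^sup>2 + (snd z)\<^sup>2) / (2 * h)
        = ((b + 1) * \<bar>fst z\<bar> - \<bar>fst z\<bar>\<^sup>2 / (2 * h)) + ((b + 1) * \<bar>snd z\<bar> - \<bar>snd z\<bar>\<^sup>2 / (2 * h))"
      using h by (simp add: field_simps)
    also have "fact k * K * exp \<dots> \<le> fact k * K * exp ((b + 1)\<^sup>2 * h / 2 + (b + 1)\<^sup>2 * h / 2)"
      using K add_mono[OF sq[of "\<bar>fst z\<bar>"] sq[of "\<bar>snd z\<bar>"]]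
      by (intro mult_left_mono) (simp_all only: exp_le_cancel_iff, simp_all)
    finally show ?thesis
      by (simp add: mult.commute)
  qed
  then show "\<exists>K. \<forall>z. norm z ^ k * cmod (f z) \<le> K"
    by blast
qed

lemma pderivs_exp_gauss:
  fixes h p q :: real
  assumes h: "h > 0"
    and E_def: "E = (\<lambda>z. complex_of_real (exp (p * fst z + q * snd z - ((fst z)\<^sup>2 + (snd z)\<^sup>2) / (2 * h))))"
  shows "pderivs E (\<lambda>z. of_real p * E z + of_real (- 1 / h) * (of_real (fst z) * E z))
      (\<lambda>z. of_real q * E z + of_real (- 1 / h) * (of_real (snd z) * E z))"
  unfolding pderivs_def
proof
  fix z :: "real \<times> real"
  let ?w = "\<lambda>z::real \<times> real. p * fst z + q * snd z - ((fst z)\<^sup>2 + (snd z)\<^sup>2) / (2 * h)"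
  have w: "(?w has_derivative (\<lambda>k. (p - fst z / h) * fst k + (q - snd z / h) * snd k)) (at z)"
    using h by (auto intro!: derivative_eq_intros simp: field_simps)
  have "((\<lambda>z. exp (?w z)) has_derivative (\<lambda>k. ((p - fst z / h) * fst k + (q - snd z / h) * snd k) * exp (?w z))) (at z)"
    using DERIV_compose_FDERIV[OF DERIV_exp w] .
  from has_derivative_of_real[OF this]
  show "(E has_derivative (\<lambda>k. fst k *\<^sub>R (of_real p * E z + of_real (- 1 / h) * (of_real (fst z) * E z))
      + snd k *\<^sub>R (of_real q * E z + of_real (- 1 / h) * (of_real (snd z) * E z)))) (at z)"
    unfolding E_def by (rule has_derivative_eq_rhs) (auto simp: scaleR_conv_of_real algebra_simps)
qed

lemma pgauss_pderivs:
  assumes h: "h > 0" and "pgauss h f"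
  shows "\<exists>f1 f2. pderivs f f1 f2 \<and> pgauss h f1 \<and> pgauss h f2"
  using assms(2)
proof induction
  case (pgauss_exp p q)
  let ?E = "\<lambda>z. complex_of_real (exp (p * fst z + q * snd z - ((fst z)\<^sup>2 + (snd z)\<^sup>2) / (2 * h)))"
  have E: "pgauss h ?E"
    by (rule pgauss.pgauss_exp)
  note pderivs_exp_gauss[OF h refl, of p q]
  moreover have "pgauss h (\<lambda>z. of_real p * ?E z + of_real (- 1 / h) * (of_real (fst z) * ?E z))"
    "pgauss h (\<lambda>z. of_real q * ?E z + of_real (- 1 / h) * (of_real (snd z) * ?E z))"
    by (intro pgauss_lin pgauss_fst pgauss_snd E)+
  ultimately show ?case
    by blast
next
  case (pgauss_fst f)
  then obtain f1 f2 where f: "pderivs f f1 f2" "pgauss h f1" "pgauss h f2"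
    by blast
  have x: "pderivs (\<lambda>z. of_real (fst z)) (\<lambda>z. 1) (\<lambda>z. 0)"
    unfolding pderivs_def by (auto intro!: derivative_eq_intros simp: scaleR_conv_of_real)
  have "pgauss h (\<lambda>z. 1 * f z + 1 * (of_real (fst z) * f1 z))" "pgauss h (\<lambda>z. 0 * f z + 1 * (of_real (fst z) * f2 z))"
    by (intro pgauss_lin pgauss.pgauss_fst f pgauss_fst)+
  then show ?case
    using pderivs_mult[OF x f(1)] by auto
next
  case (pgauss_snd f)
  then obtain f1 f2 where f: "pderivs f f1 f2" "pgauss h f1" "pgauss h f2"
    by blast
  have x: "pderivs (\<lambda>z. of_real (snd z)) (\<lambda>z. 0) (\<lambda>z. 1)"
    unfolding pderivs_def by (auto intro!: derivative_eq_intros simp: scaleR_conv_of_real)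
  have "pgauss h (\<lambda>z. 0 * f z + 1 * (of_real (snd z) * f1 z))" "pgauss h (\<lambda>z. 1 * f z + 1 * (of_real (snd z) * f2 z))"
    by (intro pgauss_lin pgauss.pgauss_snd f pgauss_snd)+
  then show ?case
    using pderivs_mult[OF x f(1)] by auto
next
  case (pgauss_lin f g c d)
  then show ?case
    by (blast intro: pderivs_lin pgauss.pgauss_lin)
qed

text \<open>Being rapid and closed under partial derivatives, the class \<open>pgauss h\<close> is
  itself a coinduction invariant.\<close>

lemma pgauss_schwartz:
  assumes h: "h > 0" and "pgauss h f"
  shows "schwartz f"
  using assms(2)
proof (rule schwartz.coinduct)
  fix u assume u: "pgauss h u"
  obtain f1 f2 where "pderivs u f1 f2" "pgauss h f1" "pgauss h f2"
    using pgauss_pderivs[OF h u] by blast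
  moreover have "rapid u"
    by (rule pgauss_rapid[OF h u])
  ultimately show "\<exists>f f1 f2. u = f \<and> (\<forall>k. bounded (range (\<lambda>z. norm z ^ k *\<^sub>R f z))) \<and>
        (\<forall>z. (f has_derivative (\<lambda>h. fst h *\<^sub>R f1 z + snd h *\<^sub>R f2 z)) (at z)) \<and>
        (pgauss h f1 \<or> schwartz f1) \<and> (pgauss h f2 \<or> schwartz f2)"
    unfolding rapid_def pderivs_def
    by (intro exI[of _ u] exI[of _ f1] exI[of _ f2]) simp
qed

section \<open>Hermite functions\<close>

text \<open>For \<open>h > 0\<close> these are the physicists' Hermite polynomials in the scale sqrt
  (2h): (2h)^(n/2) H_n(t / sqrt (2h)). This scale matches the Gaussian of variance \<open>h\<close>
  in x and y when it is written in x - y.\<close>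

fun herm :: "real \<Rightarrow> nat \<Rightarrow> real poly" where
  "herm h 0 = 1"
| "herm h (Suc n) = pCons 0 (smult 2 (herm h n)) - smult (2 * h) (pderiv (herm h n))"

lemma pderiv_herm: "pderiv (herm h (Suc n)) = smult (2 * real (Suc n)) (herm h n)"
proof (induction n)
  case 0
  show ?case
    by (simp add: pderiv_pCons pderiv_diff pderiv_smult pderiv_1)
next
  case (Suc n)
  have "pderiv (herm h (Suc (Suc n)))
      = smult 2 (herm h (Suc n)) + pCons 0 (smult 2 (pderiv (herm h (Suc n))))
        - smult (2 * h) (pderiv (pderiv (herm h (Suc n))))"
    unfolding herm.simps(2)[of h "Suc n"] pderiv_pCons pderiv_diff pderiv_smult by (rule refl)
  \<comment> \<open>After inserting the induction hypothesis, the last two terms are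
    \<open>2 * real (Suc n)\<close> times the recursion for \<open>herm h (Suc n)\<close>.\<close>
  also have "\<dots> = smult 2 (herm h (Suc n)) + smult (2 * real (Suc n)) (herm h (Suc n))"
    unfolding Suc.IH pderiv_smult
    by (subst poly_eq_poly_eq_iff[symmetric], rule ext) (simp add: algebra_simps)
  finally show ?case
    by (simp add: smult_add_left[symmetric] del: herm.simps(2))
qed

text \<open>As x^2 + y^2 is half the sum of the squares of x - y and x + y, the Gaussian also
  factors in these coordinates. The cost therefore acts on \<open>P\<close> alone.\<close>

definition gpoly :: "real \<Rightarrow> real poly \<Rightarrow> real poly \<Rightarrow> real \<times> real \<Rightarrow> complex" where
  "gpoly h P Q z = of_real (poly P (fst z - snd z) * poly Q (fst z + snd z)
     * exp (- ((fst z)\<^sup>2 + (snd z)\<^sup>2) / (2 * h)))"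

text \<open>The relative derivative annihilates functions of x + y and doubles the derivative of
  functions of x - y.\<close>

lemma rel_deriv_gpoly:
  assumes h: "h > 0"
  shows "rel_deriv (gpoly h P Q) = gpoly h (smult 2 (pderiv P) - smult (1 / h) (pCons 0 P)) Q"
proof -
  let ?E = "\<lambda>z. exp (- ((fst z)\<^sup>2 + (snd z)\<^sup>2) / (2 * h))"
  let ?P = "\<lambda>z. poly P (fst z - snd z)" and ?Q = "\<lambda>z. poly Q (fst z + snd z)"
  let ?P' = "\<lambda>z. poly (pderiv P) (fst z - snd z)" and ?Q' = "\<lambda>z. poly (pderiv Q) (fst z + snd z)"
  have "pderivs (gpoly h P Q)
      (\<lambda>z. of_real ((?P' z * ?Q z + ?P z * ?Q' z - fst z / h * ?P z * ?Q z) * ?E z))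
      (\<lambda>z. of_real ((- ?P' z * ?Q z + ?P z * ?Q' z - snd z / h * ?P z * ?Q z) * ?E z))"
    unfolding pderivs_def
  proof
    fix z :: "real \<times> real"
    have dP: "(?P has_derivative (\<lambda>k. (fst k - snd k) * ?P' z)) (at z)"
      by (rule DERIV_compose_FDERIV[OF poly_DERIV]) (auto intro!: derivative_eq_intros)
    have dQ: "(?Q has_derivative (\<lambda>k. (fst k + snd k) * ?Q' z)) (at z)"
      by (rule DERIV_compose_FDERIV[OF poly_DERIV]) (auto intro!: derivative_eq_intros)
    have w: "((\<lambda>z. - ((fst z)\<^sup>2 + (snd z)\<^sup>2) / (2 * h)) has_derivative (\<lambda>k. - (fst z * fst k + snd z * snd k) / h)) (at z)"
      using h by (auto intro!: derivative_eq_intros simp: field_simps)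
    have dE: "(?E has_derivative (\<lambda>k. (- (fst z * fst k + snd z * snd k) / h) * ?E z)) (at z)"
      using DERIV_compose_FDERIV[OF DERIV_exp w] .
    from has_derivative_of_real[OF has_derivative_mult[OF has_derivative_mult[OF dP dQ] dE]]
    show "(gpoly h P Q has_derivative
        (\<lambda>k. fst k *\<^sub>R of_real ((?P' z * ?Q z + ?P z * ?Q' z - fst z / h * ?P z * ?Q z) * ?E z)
          + snd k *\<^sub>R of_real ((- ?P' z * ?Q z + ?P z * ?Q' z - snd z / h * ?P z * ?Q z) * ?E z))) (at z)"
      unfolding gpoly_def[abs_def]
      by (rule has_derivative_eq_rhs)
        (use h in \<open>auto simp: scaleR_conv_of_real fun_eq_iff field_simps simp flip: of_real_mult of_real_add\<close>)
  qed
  from rel_deriv_eq[OF this] show ?thesis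
    using h by (auto simp: gpoly_def fun_eq_iff field_simps simp flip: of_real_diff)
qed

text \<open>Pulling the Gaussian out turns the cost into 4h times the Hermite operator t P' - h P''
  in t = x - y. The polynomial \<open>herm h n\<close> is its eigenvector for \<open>n\<close>, by
  the recursion and \<open>pderiv_herm\<close>.\<close>

lemma cost_expr_herm:
  assumes h: "h > 0"
  shows "cost_expr h (gpoly h (herm h n) Q) = (\<lambda>z. of_real (4 * h * real n) * gpoly h (herm h n) Q z)"
proof -
  define P where "P = herm h n"
  have ode: "x * poly (pderiv P) x - h * poly (pderiv (pderiv P)) x = real n * poly P x" for x
  proof (cases n)
    case 0
    then show ?thesis
      by (simp add: P_def pderiv_1)
  next
    case (Suc m)
    have "pderiv P = smult (2 * real (Suc m)) (herm h m)"
      unfolding P_def Suc by (rule pderiv_herm)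
    then show ?thesis
      unfolding P_def Suc by (simp add: pderiv_smult algebra_simps)
  qed
  \<comment> \<open>The same identity for numbers, with \<open>p\<close>, \<open>p1\<close>,
    \<open>p2\<close> standing for the values of P, P' and P'' at x.\<close>
  have alg: "x\<^sup>2 * p - h\<^sup>2 * (2 * (2 * p2 - (1 / h) * (p + x * p1)) - (1 / h) * (x * (2 * p1 - (1 / h) * (x * p)))) - 2 * h * p
      = 4 * h * (x * p1 - h * p2)" for x p p1 p2
    using h by (simp add: field_simps power2_eq_square)
  have "((fst z - snd z)\<^sup>2 * poly P (fst z - snd z)
      - h\<^sup>2 * poly (smult 2 (pderiv (smult 2 (pderiv P) - smult (1 / h) (pCons 0 P)))
          - smult (1 / h) (pCons 0 (smult 2 (pderiv P) - smult (1 / h) (pCons 0 P)))) (fst z - snd z)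
      - 2 * h * poly P (fst z - snd z)) = 4 * h * (real n * poly P (fst z - snd z))" for z
    using alg[of "fst z - snd z" "poly P (fst z - snd z)" "poly (pderiv (pderiv P)) (fst z - snd z)" "poly (pderiv P) (fst z - snd z)"]
    by (simp add: pderiv_diff pderiv_smult pderiv_pCons ode[symmetric] add_divide_distrib)
  from arg_cong[OF this, of "\<lambda>t. complex_of_real (t * (poly Q (fst z + snd z) * exp (- ((fst z)\<^sup>2 + (snd z)\<^sup>2) / (2 * h))))" for z]
  show ?thesis
    unfolding P_def[symmetric] cost_expr_eq rel_deriv_gpoly[OF h]
    by (simp add: gpoly_def fun_eq_iff algebra_simps)
qed

lemma pgauss_poly_diff:
  assumes "pgauss h f"
  shows "pgauss h (\<lambda>z. of_real (poly P (fst z - snd z)) * f z)"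
proof (induction P)
  case 0
  show ?case
    using pgauss_scale[OF assms, of 0] by simp
next
  case (pCons a P)
  let ?g = "\<lambda>z. of_real (poly P (fst z - snd z)) * f z"
  have "pgauss h (\<lambda>z. of_real a * f z + 1 * (1 * (of_real (fst z) * ?g z) + (- 1) * (of_real (snd z) * ?g z)))"
    by (intro pgauss_lin assms pgauss_fst pgauss_snd pCons)
  then show ?case
    by (rule back_subst[of "pgauss h"]) (auto simp: algebra_simps)
qed

lemma pgauss_poly_sum:
  assumes "pgauss h f"
  shows "pgauss h (\<lambda>z. of_real (poly P (fst z + snd z)) * f z)"
proof (induction P)
  case 0
  show ?case
    using pgauss_scale[OF assms, of 0] by simp
next
  case (pCons a P)
  let ?g = "\<lambda>z. of_real (poly P (fst z + snd z)) * f z"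
  have "pgauss h (\<lambda>z. of_real a * f z + 1 * (1 * (of_real (fst z) * ?g z) + 1 * (of_real (snd z) * ?g z)))"
    by (intro pgauss_lin assms pgauss_fst pgauss_snd pCons)
  then show ?case
    by (rule back_subst[of "pgauss h"]) (auto simp: algebra_simps)
qed

lemma pgauss_gpoly: "pgauss h (gpoly h P Q)"
proof -
  have "pgauss h (\<lambda>z. of_real (poly P (fst z - snd z)) * (of_real (poly Q (fst z + snd z)) *
      of_real (exp (0 * fst z + 0 * snd z - ((fst z)\<^sup>2 + (snd z)\<^sup>2) / (2 * h)))))"
    by (intro pgauss_poly_diff pgauss_poly_sum pgauss_exp)
  then show ?thesis
    by (rule back_subst[of "pgauss h"]) (simp add: gpoly_def fun_eq_iff diff_divide_distrib add_divide_distrib)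
qed

lemma schwartz_gpoly: "h > 0 \<Longrightarrow> schwartz (gpoly h P Q)"
  by (rule pgauss_schwartz[OF _ pgauss_gpoly])

definition herm_vec :: "real \<Rightarrow> nat \<Rightarrow> nat \<Rightarrow> (real \<times> real) L2" where
  "herm_vec h n m = abs_L2 (gpoly h (herm h n) (herm h m))"

text \<open>Eigenvectors of a symmetric operator for different eigenvalues are orthogonal. This
  settles only the first index, as the eigenvalue is independent of the second.\<close>

lemma herm_vec_orthogonal_left:
  assumes h: "h > 0" and "n \<noteq> n'"
  shows "cinner (herm_vec h n m) (herm_vec h n' m') = 0"
proof -
  let ?f = "gpoly h (herm h n) (herm h m)" and ?g = "gpoly h (herm h n') (herm h m')"
  have sq: "sq_integrable ?f" "sq_integrable ?g"
    by (intro schwartz_sq_integrable schwartz_gpoly h)+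
  have "cinner (abs_L2 ?f) (of_real (4 * h * real n') *\<^sub>C abs_L2 ?g) = cinner (of_real (4 * h * real n) *\<^sub>C abs_L2 ?f) (abs_L2 ?g)"
    using cinner_cost_expr_sym[of ?f ?g h, OF schwartz_gpoly[OF h] schwartz_gpoly[OF h]]
    by (simp only: cost_expr_herm[OF h] scaleC_abs[OF sq(1)] scaleC_abs[OF sq(2)])
  then have "(of_real (4 * h * real n') - of_real (4 * h * real n)) * cinner (abs_L2 ?f) (abs_L2 ?g) = 0"
    by (simp add: cinner_simps left_diff_distrib)
  moreover have "complex_of_real (4 * h * real n') \<noteq> of_real (4 * h * real n)"
    using assms by (subst of_real_eq_iff) simp
  ultimately show ?thesis
    by (simp add: herm_vec_def)
qed

lemma lborel_integral_reflect_snd: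
  fixes f :: "real \<times> real \<Rightarrow> complex"
  assumes "integrable lborel f" "integrable lborel (\<lambda>z. f (fst z, - snd z))"
  shows "(\<integral>z. f (fst z, - snd z) \<partial>lborel) = integral\<^sup>L lborel f"
proof -
  have "(\<integral>z. f (fst z, - snd z) \<partial>lborel) = (\<integral>x. \<integral>y. f (x, - y) \<partial>lborel \<partial>lborel)"
    using lborel_pair.integral_fst'[of "\<lambda>z. f (fst z, - snd z)"] assms(2) by (simp add: lborel_prod)
  also have "\<dots> = (\<integral>x. \<integral>y. f (x, y) \<partial>lborel \<partial>lborel)"
    using lborel_integral_real_affine[of "- 1" "\<lambda>y. f (_, y)" 0] by simp
  also have "\<dots> = integral\<^sup>L lborel f"
    using lborel_pair.integral_fst'[of f] assms(1) by (simp add: lborel_prod)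
  finally show ?thesis .
qed

text \<open>The reflection of y exchanges x - y and x + y and preserves the Gaussian, so
  orthogonality in the second index follows from that in the first.\<close>

lemma cinner_herm_vec_swap:
  assumes h: "h > 0"
  shows "cinner (herm_vec h n m) (herm_vec h n' m') = cinner (herm_vec h m n) (herm_vec h m' n')"
proof -
  have sq: "sq_integrable (gpoly h P Q)" for P Q
    by (intro schwartz_sq_integrable schwartz_gpoly h)
  have refl: "gpoly h P Q (fst z, - snd z) = gpoly h Q P z" for P Q z
    by (simp add: gpoly_def)
  have "(\<integral>z. cnj (gpoly h (herm h m) (herm h n) z) * gpoly h (herm h m') (herm h n') z \<partial>lborel)
      = (\<integral>z. cnj (gpoly h (herm h n) (herm h m) z) * gpoly h (herm h n') (herm h m') z \<partial>lborel)"
    using lborel_integral_reflect_snd[of "\<lambda>z. cnj (gpoly h (herm h n) (herm h m) z) * gpoly h (herm h n') (herm h m') z"]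
      sq_integrable_mult[OF sq sq] by (simp add: refl)
  then show ?thesis
    by (simp add: herm_vec_def cinner_abs sq)
qed

lemma herm_vec_orthogonal:
  assumes h: "h > 0" and "(n, m) \<noteq> (n', m')"
  shows "cinner (herm_vec h n m) (herm_vec h n' m') = 0"
  using assms herm_vec_orthogonal_left cinner_herm_vec_swap by (metis prod.inject)

text \<open>The linear span of the products of Hermite polynomials in x - y and x + y. It turns out
  to contain all monomials, which transfers totality from Gaussian monomials to Hermite
  functions.\<close>

inductive hspan :: "real \<Rightarrow> (real \<Rightarrow> real \<Rightarrow> real) \<Rightarrow> bool" for h where
  hspan_base: "hspan h (\<lambda>x y. poly (herm h n) (x - y) * poly (herm h m) (x + y))"
| hspan_lin: "hspan h p \<Longrightarrow> hspan h q \<Longrightarrow> hspan h (\<lambda>x y. c * p x y + d * q x y)"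

text \<open>The three-term recurrence solved for the product with the variable: its lower term comes
  from \<open>pderiv_herm\<close>.\<close>

lemma herm_times_var:
  "\<exists>k c. \<forall>t. t * poly (herm h n) t = 1 / 2 * poly (herm h (Suc n)) t + c * poly (herm h k) t"
proof (cases n)
  case 0
  \<comment> \<open>There is no lower term for \<open>n = 0\<close>; the coefficient 0 makes the
    index irrelevant.\<close>
  then show ?thesis
    by (intro exI[of _ 0] exI[of _ 0]) (simp add: pderiv_1)
next
  case (Suc m)
  show ?thesis
    unfolding Suc
    by (rule exI[of _ m], rule exI[of _ "h * (2 * real (Suc m))"])
      (simp only: herm.simps(2)[of h "Suc m"] pderiv_herm, simp add: field_simps del: herm.simps(2))
qed

lemma hspan_diff_mult: "hspan h p \<Longrightarrow> hspan h (\<lambda>x y. (x - y) * p x y)"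
proof (induction rule: hspan.induct)
  case (hspan_base n m)
  obtain k c where kc: "\<And>t. t * poly (herm h n) t = 1 / 2 * poly (herm h (Suc n)) t + c * poly (herm h k) t"
    using herm_times_var by blast
  have "hspan h (\<lambda>x y. 1 / 2 * (poly (herm h (Suc n)) (x - y) * poly (herm h m) (x + y))
      + c * (poly (herm h k) (x - y) * poly (herm h m) (x + y)))"
    by (intro hspan_lin hspan.hspan_base)
  then show ?case
    by (rule back_subst[of "hspan h"]) (simp only: fun_eq_iff mult.assoc[symmetric] kc ring_distribs simp_thms)
next
  case (hspan_lin p q c d)
  then show ?case
    using hspan.hspan_lin[of h "\<lambda>x y. (x - y) * p x y" "\<lambda>x y. (x - y) * q x y" c d]
    by (simp add: algebra_simps)
qed

lemma hspan_sum_mult: "hspan h p \<Longrightarrow> hspan h (\<lambda>x y. (x + y) * p x y)"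
proof (induction rule: hspan.induct)
  case (hspan_base n m)
  obtain k c where kc: "\<And>t. t * poly (herm h m) t = 1 / 2 * poly (herm h (Suc m)) t + c * poly (herm h k) t"
    using herm_times_var by blast
  have "hspan h (\<lambda>x y. 1 / 2 * (poly (herm h n) (x - y) * poly (herm h (Suc m)) (x + y))
      + c * (poly (herm h n) (x - y) * poly (herm h k) (x + y)))"
    by (intro hspan_lin hspan.hspan_base)
  moreover have "(x + y) * (poly (herm h n) (x - y) * poly (herm h m) (x + y))
      = poly (herm h n) (x - y) * ((x + y) * poly (herm h m) (x + y))" for x y
    by (rule mult.left_commute)
  ultimately show ?case
    by (simp only: kc) (simp only: ring_distribs mult.left_commute)
next
  case (hspan_lin p q c d)
  then show ?case
    using hspan.hspan_lin[of h "\<lambda>x y. (x + y) * p x y" "\<lambda>x y. (x + y) * q x y" c d]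
    by (simp add: algebra_simps)
qed

lemma hspan_monomial: "hspan h (\<lambda>x y. x ^ i * y ^ j)"
proof -
  have x: "hspan h (\<lambda>x y. x * p x y)" and y: "hspan h (\<lambda>x y. y * p x y)" if "hspan h p" for p
  proof -
    note hspan_lin[OF hspan_sum_mult hspan_diff_mult, OF that that]
    \<comment> \<open>x and y are half the sum and half the difference of x + y and x - y.\<close>
    from this[of "1 / 2" "1 / 2"] this[of "1 / 2" "- 1 / 2"]
    show "hspan h (\<lambda>x y. x * p x y)" "hspan h (\<lambda>x y. y * p x y)"
      by (simp_all add: algebra_simps)
  qed
  have 0: "hspan h (\<lambda>x y. 1)"
    using hspan_base[of h 0 0] by simp
  have "hspan h (\<lambda>x y. y ^ j)"
    by (induction j) (use 0 y in simp_all)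
  then show ?thesis
    by (induction i) (use x[of "\<lambda>x y. x ^ _ * y ^ j"] in \<open>simp_all add: mult.assoc\<close>)
qed

text \<open>Square integrability is carried through the induction because \<open>abs_L2\<close> is
  known to respect linear combinations only of square integrable functions.\<close>

lemma hspan_orthogonal:
  assumes h: "h > 0" and f: "\<And>n m. cinner (herm_vec h n m) f = 0" and "hspan h p"
  shows "sq_integrable (\<lambda>(x, y). of_real (p x y * exp (- (x\<^sup>2 + y\<^sup>2) / (2 * h))))
    \<and> cinner (abs_L2 (\<lambda>(x, y). of_real (p x y * exp (- (x\<^sup>2 + y\<^sup>2) / (2 * h))))) f = 0"
  using assms(3)
proof induction
  case (hspan_base n m)
  have "(\<lambda>(x, y). complex_of_real (poly (herm h n) (x - y) * poly (herm h m) (x + y) * exp (- (x\<^sup>2 + y\<^sup>2) / (2 * h))))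
      = gpoly h (herm h n) (herm h m)"
    by (auto simp: gpoly_def)
  then show ?case
    using f[of n m] schwartz_sq_integrable[OF schwartz_gpoly[OF h]] by (simp add: herm_vec_def)
next
  case (hspan_lin p q c d)
  let ?F = "\<lambda>p (x, y). complex_of_real (p x y * exp (- (x\<^sup>2 + y\<^sup>2) / (2 * h)))"
  have eq: "?F (\<lambda>x y. c * p x y + d * q x y) = (\<lambda>z. of_real c * ?F p z + of_real d * ?F q z)"
    by (auto simp: algebra_simps)
  have sq: "sq_integrable (?F p)" "sq_integrable (?F q)"
    using hspan_lin by auto
  have sq': "sq_integrable (\<lambda>z. of_real c * ?F p z)" "sq_integrable (\<lambda>z. of_real d * ?F q z)"
    by (rule sq_integrable_scale[OF sq(1)] sq_integrable_scale[OF sq(2)])+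
  have "abs_L2 (?F (\<lambda>x y. c * p x y + d * q x y)) = of_real c *\<^sub>C abs_L2 (?F p) + of_real d *\<^sub>C abs_L2 (?F q)"
    unfolding eq scaleC_abs[OF sq(1)] scaleC_abs[OF sq(2)] add_abs[OF sq'] ..
  moreover have "sq_integrable (?F (\<lambda>x y. c * p x y + d * q x y))"
    unfolding eq by (rule sq_integrable_add[OF sq'])
  ultimately show ?case
    using hspan_lin by (simp add: cinner_simps)
qed

lemma herm_vec_total:
  assumes "h > 0" "\<And>n m. cinner (herm_vec h n m) f = 0"
  shows "f = 0"
  using gauss_monomials_total[OF assms(1)] hspan_orthogonal[OF assms hspan_monomial] by blast

text \<open>The eigenvalues are delivered as squares, so that the square root of the cost can be
  read off as \<open>diag_op B l\<close>. The eigenvectors are Schwartz functions, and the cost is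
  symmetric on that space, so \<open>closure_eq_diag_op\<close> applies.\<close>

theorem cost_op_diagonal:
  assumes h: "h > 0"
  obtains B l where "orthonormal_basis B" "\<And>e. e \<in> B \<Longrightarrow> 0 \<le> l e"
    "cost_op h = diag_op B (\<lambda>e. (l e)\<^sup>2)"
proof -
  \<comment> \<open>Leaving out zero vectors avoids showing that no \<open>herm_vec\<close>
    vanishes, and they contribute nothing to totality.\<close>
  define B where "B = {inverse (norm v) *\<^sub>R v | v. v \<noteq> 0 \<and> (\<exists>n m. v = herm_vec h n m)}"
  define T where "T = {(abs_L2 f, abs_L2 (cost_expr h f)) | f. schwartz f}"
  have orth: "orthonormal B"
    unfolding orthonormal_def
  proof (intro ballI)
    fix e f assume "e \<in> B" "f \<in> B"
    then obtain n m n' m' where e: "e = inverse (norm (herm_vec h n m)) *\<^sub>R herm_vec h n m" "herm_vec h n m \<noteq> 0"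
      and f: "f = inverse (norm (herm_vec h n' m')) *\<^sub>R herm_vec h n' m'" "herm_vec h n' m' \<noteq> 0"
      unfolding B_def by blast
    have "norm e = 1" "norm f = 1"
      using e f by simp_all
    show "cinner e f = (if e = f then 1 else 0)"
    proof (cases "(n, m) = (n', m')")
      case True
      then have "e = f"
        by (simp add: e f)
      then show ?thesis
        using \<open>norm f = 1\<close> by (simp add: cinner_self)
    next
      case False
      then have "cinner e f = 0"
        by (simp add: e f cinner_simps herm_vec_orthogonal[OF h])
      moreover then have "e \<noteq> f"
        using \<open>norm f = 1\<close> by (auto simp: cinner_self)
      ultimately show ?thesis
        by simp
    qed
  qed
  have "f = 0" if f: "\<forall>e\<in>B. cinner e f = 0" for f
  proof (rule herm_vec_total[OF h])
    fix n m
    show "cinner (herm_vec h n m) f = 0"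
    proof (cases "herm_vec h n m = 0")
      case False
      then have "inverse (norm (herm_vec h n m)) *\<^sub>R herm_vec h n m \<in> B"
        unfolding B_def by blast
      then show ?thesis
        using f False by (auto simp: cinner_simps)
    qed simp
  qed
  with orth have B: "orthonormal_basis B"
    by (simp add: orthonormal_basis_def)
  have scale: "(k *\<^sub>C f, k *\<^sub>C g) \<in> T" if fg: "(f, g) \<in> T" for k f g
  proof -
    obtain u where u: "schwartz u" "f = abs_L2 u" "g = abs_L2 (cost_expr h u)"
      using fg unfolding T_def by blast
    have "schwartz (\<lambda>z. k * u z + 0 * u z)" "cost_expr h (\<lambda>z. k * u z + 0 * u z) = (\<lambda>z. k * cost_expr h u z + 0 * cost_expr h u z)"
      by (intro schwartz_lin cost_expr_lin u)+
    then show ?thesis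
      unfolding T_def u(2,3) scaleC_abs[OF schwartz_sq_integrable[OF u(1)]] scaleC_abs[OF cost_expr_sq_integrable[OF u(1)]]
      by (auto intro!: exI[of _ "\<lambda>z. k * u z"])
  qed
  have add: "(f + f', g + g') \<in> T" if fg: "(f, g) \<in> T" "(f', g') \<in> T" for f g f' g'
  proof -
    obtain u where u: "schwartz u" "f = abs_L2 u" "g = abs_L2 (cost_expr h u)"
      using fg unfolding T_def by blast
    obtain v where v: "schwartz v" "f' = abs_L2 v" "g' = abs_L2 (cost_expr h v)"
      using fg unfolding T_def by blast
    have "schwartz (\<lambda>z. 1 * u z + 1 * v z)" "cost_expr h (\<lambda>z. 1 * u z + 1 * v z) = (\<lambda>z. 1 * cost_expr h u z + 1 * cost_expr h v z)"
      by (intro schwartz_lin cost_expr_lin u v)+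
    then show ?thesis
      unfolding T_def u(2,3) v(2,3) add_abs[OF schwartz_sq_integrable[OF u(1)] schwartz_sq_integrable[OF v(1)]]
        add_abs[OF cost_expr_sq_integrable[OF u(1)] cost_expr_sq_integrable[OF v(1)]]
      by (auto intro!: exI[of _ "\<lambda>z. u z + v z"])
  qed
  \<comment> \<open>The root is chosen for each vector \<open>e\<close>, so it is not necessary to
    recover the index \<open>n\<close> from \<open>e\<close>. Its value is sqrt (4 h n).\<close>
  have "\<exists>r\<ge>0. (e, r\<^sup>2 *\<^sub>R e) \<in> T" if "e \<in> B" for e
  proof -
    obtain n m where e: "e = inverse (norm (herm_vec h n m)) *\<^sub>R herm_vec h n m"
      using \<open>e \<in> B\<close> unfolding B_def by blast
    have sq: "sq_integrable (gpoly h (herm h n) (herm h m))"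
      by (intro schwartz_sq_integrable schwartz_gpoly h)
    have "(herm_vec h n m, of_real (4 * h * real n) *\<^sub>C herm_vec h n m) \<in> T"
      unfolding T_def herm_vec_def scaleC_abs[OF sq] cost_expr_herm[OF h, symmetric]
      using schwartz_gpoly[OF h] by blast
    from scale[OF this, of "of_real (inverse (norm (herm_vec h n m)))"]
    have "(e, (4 * h * real n) *\<^sub>R e) \<in> T"
      by (simp add: e scaleR_scaleC scaleC_scaleC mult_ac)
    then show ?thesis
      using h by (intro exI[of _ "sqrt (4 * h * real n)"]) simp
  qed
  then obtain l where l: "\<And>e. e \<in> B \<Longrightarrow> 0 \<le> l e" "\<And>e. e \<in> B \<Longrightarrow> (e, (l e)\<^sup>2 *\<^sub>R e) \<in> T"
    by metis
  have "closure T = diag_op B (\<lambda>e. (l e)\<^sup>2)"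
  proof (rule closure_eq_diag_op[OF B _ add scale l(2)])
    have "schwartz (\<lambda>z. 0 * gpoly h 0 0 z)"
      by (intro pgauss_schwartz[OF h] pgauss_scale pgauss_gpoly)
    then have "(0 *\<^sub>C abs_L2 (gpoly h 0 0), 0 *\<^sub>C abs_L2 (cost_expr h (gpoly h 0 0))) \<in> T"
      by (intro scale) (auto simp: T_def schwartz_gpoly[OF h])
    then show "(0, 0) \<in> T"
      by simp
    show "T \<subseteq> diag_op B (\<lambda>e. (l e)\<^sup>2)"
    proof (rule subrelI)
      fix f g assume "(f, g) \<in> T"
      then obtain u where u: "schwartz u" "f = abs_L2 u" "g = abs_L2 (cost_expr h u)"
        unfolding T_def by blast
      have "cinner e g = of_real ((l e)\<^sup>2) * cinner e f" if eB: "e \<in> B" for e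
      proof -
        obtain v where v: "schwartz v" "e = abs_L2 v" "(l e)\<^sup>2 *\<^sub>R e = abs_L2 (cost_expr h v)"
          using l(2)[OF eB] unfolding T_def by blast
        have "cinner e g = cinner ((l e)\<^sup>2 *\<^sub>R e) f"
          unfolding v(3) unfolding v(2) u(2,3) by (rule cinner_cost_expr_sym[OF v(1) u(1)])
        then show ?thesis
          by (simp add: cinner_simps)
      qed
      then show "(f, g) \<in> diag_op B (\<lambda>e. (l e)\<^sup>2)"
        by (simp add: diag_op_def)
    qed
  qed
  then show ?thesis
    using that[OF B l(1)] by (simp add: cost_op_def T_def)
qed

section \<open>Tensor products\<close>

text \<open>The representing vector must have the coefficients \<open>cnj (\<phi> e)\<close>.
  Evaluating the functional on their finite partial sums \<open>w\<close> gives |w|^2 <= K |w|, so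
  the coefficients are square summable.\<close>

lemma riesz_representation:
  fixes \<phi> :: "'a::euclidean_space L2 \<Rightarrow> complex"
  assumes lin: "bounded_linear \<phi>" and scale: "\<And>k u. \<phi> (k *\<^sub>C u) = k * \<phi> u"
  obtains p where "\<And>u. \<phi> u = cinner p u"
proof -
  obtain B :: "'a L2 set" where B: "orthonormal_basis B"
    using orthonormal_extend_basis[OF orthonormal_empty] by blast
  obtain K where K: "K \<ge> 0" "\<And>u. cmod (\<phi> u) \<le> norm u * K"
    using bounded_linear.nonneg_bounded[OF lin] by blast
  have "(\<Sum>e\<in>E. (cmod (cnj (\<phi> e)))\<^sup>2) \<le> K\<^sup>2" if E: "finite E" "E \<subseteq> B" for E
  proof -
    define s where "s = (\<Sum>e\<in>E. (cmod (cnj (\<phi> e)))\<^sup>2)"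
    define w where "w = (\<Sum>e\<in>E. cnj (\<phi> e) *\<^sub>C e)"
    have w: "(norm w)\<^sup>2 = s"
      unfolding w_def s_def using E B
      by (intro norm_orthonormal_sum orthonormal_subset[OF onb_orthonormal]) auto
    have "\<phi> w = (\<Sum>e\<in>E. cnj (\<phi> e) * \<phi> e)"
      unfolding w_def by (simp add: linear_sum[OF bounded_linear.linear[OF lin]] scale)
    also have "\<dots> = of_real s"
      unfolding s_def of_real_sum
      by (intro sum.cong refl) (simp add: complex_norm_square mult.commute del: of_real_power)
    finally have "\<bar>s\<bar> \<le> norm w * K"
      using K(2)[of w] by simp
    then have "norm w * norm w \<le> norm w * K"
      using w by (simp add: power2_eq_square)
    then have "norm w \<le> K"
      using K(1) by (cases "norm w = 0") auto
    then show ?thesis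
      unfolding s_def[symmetric] w[symmetric] by (intro power_mono) auto
  qed
  then have "(\<lambda>e. (cmod (cnj (\<phi> e)))\<^sup>2) summable_on B"
    by (intro nonneg_bdd_above_summable_on bdd_aboveI) auto
  from riesz_fischer[OF onb_orthonormal[OF B] this]
  obtain p where p: "\<And>e. e \<in> B \<Longrightarrow> cinner e p = cnj (\<phi> e)"
    by metis
  have "\<phi> u = cinner p u" for u
  proof -
    have "((\<lambda>e. cinner e u * \<phi> e) has_sum \<phi> u) B"
      using has_sum_bounded_linear[OF lin onb_expansion[OF B, of u]] by (simp add: scale)
    moreover have "((\<lambda>e. cinner e u * \<phi> e) has_sum cinner p u) B"
    proof -
      have "cinner p e * cinner e u = cinner e u * \<phi> e" if "e \<in> B" for e
        using p[OF that] cinner_commute[of p e] by simp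
      from has_sum_cong[OF this] show ?thesis
        using parseval[OF B, of p u] by (rule iffD1)
    qed
    ultimately show ?thesis
      by (rule has_sum_unique)
  qed
  then show ?thesis
    using that by blast
qed

text \<open>Multiplicativity of inner products and totality determine everything below. The locale
  is interpreted with the factors in both orders, so each statement about one factor also yields its
  mirror image.\<close>

locale hilbert_tensor =
  fixes tens :: "'a::euclidean_space L2 \<Rightarrow> 'b::euclidean_space L2 \<Rightarrow> 'c::euclidean_space L2"
  assumes cinner_tens: "cinner (tens u v) (tens u' v') = cinner u u' * cinner v v'"
    and tens_total: "(\<And>u v. cinner (tens u v) F = 0) \<Longrightarrow> F = 0"
begin

lemma tens_eqI:
  assumes "\<And>u v. cinner (tens u v) F = cinner (tens u v) G"
  shows "F = G"
proof -
  have "F - G = 0"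
    using assms by (intro tens_total) (simp add: cinner_simps)
  then show ?thesis by simp
qed

lemma tens_add_left: "tens (u + u') v = tens u v + tens u' v"
  by (rule tens_eqI) (simp add: cinner_simps cinner_tens ring_distribs)

lemma tens_add_right: "tens u (v + v') = tens u v + tens u v'"
  by (rule tens_eqI) (simp add: cinner_simps cinner_tens ring_distribs)

lemma tens_scaleC_left: "tens (k *\<^sub>C u) v = k *\<^sub>C tens u v"
  by (rule tens_eqI) (simp add: cinner_simps cinner_tens)

lemma tens_scaleC_right: "tens u (k *\<^sub>C v) = k *\<^sub>C tens u v"
  by (rule tens_eqI) (simp add: cinner_simps cinner_tens)

lemma norm_tens: "norm (tens u v) = norm u * norm v"
proof -
  have "complex_of_real ((norm (tens u v))\<^sup>2) = of_real ((norm u * norm v)\<^sup>2)"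
    unfolding cinner_self[symmetric] cinner_tens by (simp add: cinner_self power_mult_distrib)
  then show ?thesis
    by (simp only: of_real_eq_iff) (simp add: power2_eq_iff_nonneg)
qed

lemma bounded_linear_tens_left: "bounded_linear (\<lambda>u. tens u v)"
  by (rule bounded_linear_intro[where K = "norm v"])
    (simp_all add: tens_add_left tens_scaleC_left scaleR_scaleC norm_tens)

lemma bounded_linear_tens_right: "bounded_linear (\<lambda>v. tens u v)"
  by (rule bounded_linear_intro[where K = "norm u"])
    (simp_all add: tens_add_right tens_scaleC_right scaleR_scaleC norm_tens mult.commute)

lemma tens_inj:
  assumes "orthonormal B" "orthonormal C" "e \<in> B" "e' \<in> B" "f \<in> C" "f' \<in> C" "tens e f = tens e' f'"
  shows "e = e' \<and> f = f'"
proof -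
  have "cinner e e' * cinner f f' = cinner e' e' * cinner f' f'"
    using arg_cong[OF assms(7), of "\<lambda>b. cinner b (tens e' f')"] by (simp only: cinner_tens)
  then show ?thesis
    using orthonormalD[OF assms(1,3,4)] orthonormalD[OF assms(1,4,4)]
      orthonormalD[OF assms(2,5,6)] orthonormalD[OF assms(2,6,6)] by (auto split: if_splits)
qed

text \<open>A vector orthogonal to all products of basis vectors is orthogonal to all product
  vectors: expand first the left factor, then the right one.\<close>

lemma tens_onb:
  assumes B: "orthonormal_basis B" and C: "orthonormal_basis C"
  shows "orthonormal_basis {tens e f | e f. e \<in> B \<and> f \<in> C}"
  unfolding orthonormal_basis_def
proof (intro conjI allI impI)
  show "orthonormal {tens e f | e f. e \<in> B \<and> f \<in> C}"
    unfolding orthonormal_def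
    using B[THEN onb_orthonormal] C[THEN onb_orthonormal]
    by (auto simp: cinner_tens orthonormalD)
  fix F assume F: "\<forall>b\<in>{tens e f | e f. e \<in> B \<and> f \<in> C}. cinner b F = 0"
  have 1: "cinner F (tens u f) = 0" if "f \<in> C" for u f
  proof -
    have "((\<lambda>e. cinner e u * cinner F (tens e f)) has_sum cinner F (tens u f)) B"
      using has_sum_bounded_linear[OF bounded_linear_compose[OF bounded_linear_cinner_right bounded_linear_tens_left]
          onb_expansion[OF B, of u], of F f]
      by (simp add: tens_scaleC_left cinner_simps)
    moreover have "cinner F (tens e f) = 0" if "e \<in> B" for e
      using F that \<open>f \<in> C\<close> cinner_commute[of F "tens e f"] by auto
    ultimately have "((\<lambda>e. 0) has_sum cinner F (tens u f)) B"
      by (simp cong: has_sum_cong)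
    then show ?thesis
      using has_sum_unique[OF has_sum_0_simp] by metis
  qed
  have 2: "cinner F (tens u v) = 0" for u v
  proof -
    have "((\<lambda>f. cinner f v * cinner F (tens u f)) has_sum cinner F (tens u v)) C"
      using has_sum_bounded_linear[OF bounded_linear_compose[OF bounded_linear_cinner_right bounded_linear_tens_right]
          onb_expansion[OF C, of v], of F u]
      by (simp add: tens_scaleC_right cinner_simps)
    then have "((\<lambda>f. 0) has_sum cinner F (tens u v)) C"
      using 1 by (simp cong: has_sum_cong)
    then show ?thesis
      using has_sum_unique[OF has_sum_0_simp] by metis
  qed
  show "F = 0"
    by (rule tens_total) (simp add: cinner_commute[of _ F] 2)
qed

lemma bounded_op_tens_eqI:
  assumes "bounded_op T" "bounded_op T'" "\<And>u v. T (tens u v) = T' (tens u v)"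
  shows "T = T'"
proof -
  obtain B :: "'a L2 set" where B: "orthonormal_basis B"
    using orthonormal_extend_basis[OF orthonormal_empty] by blast
  obtain C :: "'b L2 set" where C: "orthonormal_basis C"
    using orthonormal_extend_basis[OF orthonormal_empty] by blast
  show ?thesis
    by (rule bounded_op_eq_on_onb[OF assms(1,2) tens_onb[OF B C]]) (use assms(3) in auto)
qed

text \<open>The partial inner product with \<open>v\<close> in the second factor, that is, the
  adjoint of the map sending \<open>u\<close> to \<open>tens u v\<close>.\<close>

definition slice :: "'b L2 \<Rightarrow> 'c L2 \<Rightarrow> 'a L2" where
  "slice v F = (SOME p. \<forall>u. cinner u p = cinner (tens u v) F)"

lemma cinner_slice: "cinner u (slice v F) = cinner (tens u v) F"
proof -
  obtain p where "\<And>u. cinner F (tens u v) = cinner p u"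
    by (rule riesz_representation[of "\<lambda>u. cinner F (tens u v)"])
      (auto intro: bounded_linear_compose[OF bounded_linear_cinner_right bounded_linear_tens_left]
        simp: tens_scaleC_left cinner_simps)
  then have "\<forall>u. cinner u p = cinner (tens u v) F"
    by (metis cinner_commute)
  then show ?thesis
    unfolding slice_def by (rule someI2) blast
qed

lemma L2_eqI: "(\<And>u :: 'a L2. cinner u f = cinner u g) \<Longrightarrow> f = g"
proof -
  assume *: "\<And>u :: 'a L2. cinner u f = cinner u g"
  have "cinner (f - g) (f - g) = 0"
    using *[of "f - g"] cinner_diff_right[of "f - g" f g] by simp
  then show "f = g"
    by (simp add: cinner_self)
qed

lemma slice_add: "slice v (F + G) = slice v F + slice v G"
  by (rule L2_eqI) (simp add: cinner_slice cinner_simps)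

lemma slice_scaleC: "slice v (k *\<^sub>C F) = k *\<^sub>C slice v F"
  by (rule L2_eqI) (simp add: cinner_slice cinner_simps)

lemma slice_tens: "slice v (tens u w) = cinner v w *\<^sub>C u"
  by (rule L2_eqI) (simp add: cinner_slice cinner_simps cinner_tens mult.commute)

text \<open>The vector \<open>H\<close> is the orthogonal projection of \<open>F\<close> onto the
  vectors whose second factor lies in the span of \<open>G\<close>. Its squared norm is the sum on
  the left, and it equals <H, F>.\<close>

lemma slice_bessel:
  assumes G: "orthonormal G" "finite G"
  shows "(\<Sum>f\<in>G. (norm (slice f F))\<^sup>2) \<le> (norm F)\<^sup>2"
proof -
  define s where "s = (\<Sum>f\<in>G. (norm (slice f F))\<^sup>2)"
  define H where "H = (\<Sum>f\<in>G. tens (slice f F) f)"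
  have "cinner H F = (\<Sum>f\<in>G. of_real ((norm (slice f F))\<^sup>2))"
    unfolding H_def cinner_sum_left by (simp add: cinner_slice[symmetric] cinner_self)
  then have HF: "cinner H F = of_real s"
    by (simp add: s_def)
  have "cinner (tens (slice f F) f) H = of_real ((norm (slice f F))\<^sup>2)" if "f \<in> G" for f
  proof -
    have "cinner (tens (slice f F) f) H = (\<Sum>g\<in>G. if g = f then of_real ((norm (slice f F))\<^sup>2) else 0)"
      unfolding H_def cinner_sum_right using G that
      by (intro sum.cong refl) (auto simp: cinner_tens orthonormalD cinner_self)
    then show ?thesis
      using G that by simp
  qed
  then have "cinner H H = (\<Sum>f\<in>G. of_real ((norm (slice f F))\<^sup>2))"
    by (subst (1) H_def) (simp add: cinner_sum_left)
  then have HH: "(norm H)\<^sup>2 = s"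
    unfolding cinner_self s_def by (simp only: of_real_sum[symmetric] of_real_eq_iff)
  have "\<bar>s\<bar> \<le> norm H * norm F"
    using norm_cinner_le[of H F] by (simp add: HF)
  then have "norm H * norm H \<le> norm H * norm F"
    using HH by (simp add: power2_eq_square)
  then have "norm H \<le> norm F"
    by (cases "norm H = 0") auto
  then show ?thesis
    unfolding s_def[symmetric] HH[symmetric] by (intro power_mono) auto
qed

text \<open>The coefficient of T F at \<open>tens e f\<close> has to be <e, A (slice f F)>. Bessel's
  inequality for \<open>e\<close>, the bound of \<open>A\<close>, and Bessel's inequality for slices
  make these coefficients square summable with norm at most \<open>K * norm F\<close>.\<close>

lemma tensor_left_exists:
  assumes A: "bounded_op A"
  obtains T where "bounded_op T" "\<And>u v. T (tens u v) = tens (A u) v"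
proof -
  obtain B :: "'a L2 set" where B: "orthonormal_basis B"
    using orthonormal_extend_basis[OF orthonormal_empty] by blast
  obtain C :: "'b L2 set" where C: "orthonormal_basis C"
    using orthonormal_extend_basis[OF orthonormal_empty] by blast
  let ?t = "\<lambda>(e, f). tens e f"
  define D where "D = {tens e f | e f. e \<in> B \<and> f \<in> C}"
  have D: "orthonormal_basis D"
    unfolding D_def by (rule tens_onb[OF B C])
  have D_img: "D = ?t ` (B \<times> C)"
    unfolding D_def by auto
  have inj: "inj_on ?t (B \<times> C)"
    using tens_inj[OF onb_orthonormal[OF B] onb_orthonormal[OF C]] by (fastforce simp: inj_on_def)
  obtain K where K: "K \<ge> 0" "\<And>u. norm (A u) \<le> norm u * K"
    using bounded_linear.nonneg_bounded[OF bounded_op_bounded_linear[OF A]] by blast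
  \<comment> \<open>Injectivity of the product map on the two bases lets the pair of factors be
    recovered from the basis vector.\<close>
  define c where "c F b = (case inv_into (B \<times> C) ?t b of (e, f) \<Rightarrow> cinner e (A (slice f F)))" for F b
  have c: "c F (tens e f) = cinner e (A (slice f F))" if "e \<in> B" "f \<in> C" for F e f
    using inv_into_f_f[OF inj, of "(e, f)"] that by (simp add: c_def)
  have bound: "(\<Sum>b\<in>X. (cmod (c F b))\<^sup>2) \<le> (K * norm F)\<^sup>2" if X: "finite X" "X \<subseteq> D" for X F
  proof -
    define Y where "Y = inv_into (B \<times> C) ?t ` X"
    have "?t (inv_into (B \<times> C) ?t b) = b" "inv_into (B \<times> C) ?t b \<in> B \<times> C" if "b \<in> X" for b
      using X(2) that unfolding D_img by (blast intro: f_inv_into_f inv_into_into)+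
    then have Y: "finite Y" "Y \<subseteq> B \<times> C" "X = ?t ` Y"
      using X(1) unfolding Y_def by (simp, blast, force simp: image_image)
    have "(\<Sum>b\<in>X. (cmod (c F b))\<^sup>2) = (\<Sum>y\<in>Y. (cmod (c F (?t y)))\<^sup>2)"
      unfolding Y(3) by (rule sum.reindex_cong[OF inj_on_subset[OF inj Y(2)] refl refl])
    also have "\<dots> = (\<Sum>(e, f)\<in>Y. (cmod (cinner e (A (slice f F))))\<^sup>2)"
      using Y(2) by (intro sum.cong refl) (auto simp: c)
    \<comment> \<open>Enlarging the index set to a rectangle separates the two sums, each of which
      is then bounded by its own Bessel inequality.\<close>
    also have "\<dots> \<le> (\<Sum>(e, f)\<in>fst ` Y \<times> snd ` Y. (cmod (cinner e (A (slice f F))))\<^sup>2)"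
      using Y(1) by (intro sum_mono2) (auto simp: rev_image_eqI)
    also have "\<dots> = (\<Sum>f\<in>snd ` Y. \<Sum>e\<in>fst ` Y. (cmod (cinner e (A (slice f F))))\<^sup>2)"
      by (subst sum.swap) (rule sum.cartesian_product[symmetric])
    also have "\<dots> \<le> (\<Sum>f\<in>snd ` Y. (norm (A (slice f F)))\<^sup>2)"
      using Y by (intro sum_mono bessel orthonormal_subset[OF onb_orthonormal[OF B]]) auto
    also have "\<dots> \<le> (\<Sum>f\<in>snd ` Y. K\<^sup>2 * (norm (slice f F))\<^sup>2)"
      unfolding power_mult_distrib[symmetric] using K by (intro sum_mono power_mono) (auto simp: mult.commute)
    also have "\<dots> \<le> K\<^sup>2 * (norm F)\<^sup>2"
      unfolding sum_distrib_left[symmetric] using Y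
      by (intro mult_left_mono slice_bessel orthonormal_subset[OF onb_orthonormal[OF C]]) auto
    finally show ?thesis
      by (simp add: power_mult_distrib)
  qed
  have "\<exists>g. \<forall>b\<in>D. cinner b g = c F b" for F
  proof -
    have "(\<lambda>b. (cmod (c F b))\<^sup>2) summable_on D"
      by (rule nonneg_bdd_above_summable_on) (auto intro!: bdd_aboveI[of _ "(K * norm F)\<^sup>2"] bound)
    from riesz_fischer[OF onb_orthonormal[OF D] this] show ?thesis
      by metis
  qed
  then obtain T where T: "\<And>F b. b \<in> D \<Longrightarrow> cinner b (T F) = c F b"
    by metis
  have T': "cinner (tens e f) (T F) = cinner e (A (slice f F))" if "e \<in> B" "f \<in> C" for e f F
    using T[of "tens e f" F] that by (auto simp: c D_def)
  have eqI: "F = G" if "\<And>e f. e \<in> B \<Longrightarrow> f \<in> C \<Longrightarrow> cinner (tens e f) F = cinner (tens e f) G" for F G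
    by (rule onb_eqI[OF D]) (use that in \<open>auto simp: D_def\<close>)
  have scale: "T (k *\<^sub>C F) = k *\<^sub>C T F" for k F
    by (rule eqI) (simp add: T' cinner_simps slice_scaleC bounded_op_scaleC[OF A])
  have "bounded_linear T"
  proof (rule bounded_linear_intro[where K = K])
    show "T (F + G) = T F + T G" for F G
      by (rule eqI) (simp add: T' cinner_simps slice_add bounded_op_add[OF A])
    show "T (r *\<^sub>R F) = r *\<^sub>R T F" for r F
      by (simp add: scaleR_scaleC scale)
    show "norm (T F) \<le> norm F * K" for F
    proof -
      have "((\<lambda>b. Re (cinner (T F) b * cinner b (T F))) has_sum (norm (T F))\<^sup>2) D"
        using has_sum_Re[OF parseval[OF D, of "T F" "T F"]] by (simp add: cinner_self)
      moreover have "Re (cinner (T F) b * cinner b (T F)) = (cmod (c F b))\<^sup>2" if "b \<in> D" for b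
      proof -
        have "cinner (T F) b * cinner b (T F) = of_real ((cmod (c F b))\<^sup>2)"
          unfolding cinner_commute[of "T F" b] T[OF that] complex_norm_square by (rule mult.commute)
        then show ?thesis
          by (simp only: Re_complex_of_real)
      qed
      ultimately have "((\<lambda>b. (cmod (c F b))\<^sup>2) has_sum (norm (T F))\<^sup>2) D"
        by (simp cong: has_sum_cong)
      then have "(norm (T F))\<^sup>2 \<le> (K * norm F)\<^sup>2"
        by (rule has_sum_le_finite_sums) (rule bound)
      then have "norm (T F) \<le> K * norm F"
        by (rule power2_le_imp_le) (simp add: K(1))
      then show ?thesis
        by (simp only: mult.commute)
    qed
  qed
  then have "bounded_op T"
    by (simp add: bounded_op_def scale)
  moreover have "T (tens u v) = tens (A u) v" for u v
    by (rule eqI) (simp add: T' slice_tens bounded_op_scaleC[OF A] cinner_simps cinner_tens mult.commute)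
  ultimately show ?thesis
    using that by blast
qed

end

section \<open>The tensor product of functions on the line\<close>

lemma sq_integrable_tensor:
  assumes "sq_integrable f" "sq_integrable g"
  shows "sq_integrable (\<lambda>(x, y). f x * g y)"
  using tensor_vec.rsp[THEN rel_funD, THEN rel_funD, OF l2_eq_refl l2_eq_refl, OF assms]
  by (simp add: l2_eq_def)

lemma tensor_abs:
  assumes "sq_integrable f" "sq_integrable g"
  shows "abs_L2 f \<otimes>\<^sub>v abs_L2 g = abs_L2 (\<lambda>(x, y). f x * g y)"
  using assms by (intro tensor_vec.abs_eq) (auto simp: l2_eq_refl)

lemma cinner_tensor: "cinner (f \<otimes>\<^sub>v g) (f' \<otimes>\<^sub>v g') = cinner f f' * cinner g g'"
proof -
  let ?r = rep_L2
  note sq = sq_integrable_rep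
  have i: "integrable (lborel \<Otimes>\<^sub>M lborel) (\<lambda>(x, y). cnj (?r f x * ?r g y) * (?r f' x * ?r g' y))"
    using sq_integrable_mult[OF sq_integrable_tensor sq_integrable_tensor, OF sq sq sq sq, of f g f' g']
    by (simp add: lborel_prod case_prod_beta')
  have "cinner (abs_L2 (?r f) \<otimes>\<^sub>v abs_L2 (?r g)) (abs_L2 (?r f') \<otimes>\<^sub>v abs_L2 (?r g'))
      = (\<integral>(x, y). cnj (?r f x * ?r g y) * (?r f' x * ?r g' y) \<partial>(lborel \<Otimes>\<^sub>M lborel))"
    unfolding tensor_abs[OF sq sq] cinner_abs[OF sq_integrable_tensor[OF sq sq] sq_integrable_tensor[OF sq sq]]
    by (simp add: lborel_prod case_prod_beta')
  also have "\<dots> = (\<integral>x. \<integral>y. cnj (?r f x * ?r g y) * (?r f' x * ?r g' y) \<partial>lborel \<partial>lborel)"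
    using lborel_pair.integral_fst'[OF i] by simp
  also have "\<dots> = (\<integral>x. \<integral>y. (cnj (?r f x) * ?r f' x) * (cnj (?r g y) * ?r g' y) \<partial>lborel \<partial>lborel)"
    by (simp add: mult_ac)
  also have "\<dots> = cinner (abs_L2 (?r f)) (abs_L2 (?r f')) * cinner (abs_L2 (?r g)) (abs_L2 (?r g'))"
    unfolding cinner_abs[OF sq sq] by (simp only: integral_mult_right_zero integral_mult_left_zero)
  finally show ?thesis
    by simp
qed

lemma sq_integrable_gauss_real:
  fixes f :: "real \<Rightarrow> complex"
  assumes h: "h > 0" and [measurable]: "f \<in> borel_measurable borel"
    and bound: "\<And>x. cmod (f x) \<le> K * exp (b * \<bar>x\<bar> - x\<^sup>2 / (2 * h))"
  shows "sq_integrable f"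
proof -
  have "integrable lborel (\<lambda>x. (cmod (f x))\<^sup>2)"
  proof (rule Bochner_Integration.integrable_bound[OF integrable_mult_right[OF integrable_exp_abs_gauss[OF h, of "2 * b"], of "K\<^sup>2"]])
    have "(cmod (f x))\<^sup>2 \<le> K\<^sup>2 * exp (2 * b * \<bar>x\<bar> - x\<^sup>2 / h)" for x
    proof -
      have "(cmod (f x))\<^sup>2 \<le> (K * exp (b * \<bar>x\<bar> - x\<^sup>2 / (2 * h)))\<^sup>2"
        by (rule power_mono[OF bound]) simp
      also have "\<dots> = K\<^sup>2 * exp (2 * (b * \<bar>x\<bar> - x\<^sup>2 / (2 * h)))"
        by (simp only: power_mult_distrib exp_double)
      also have "2 * (b * \<bar>x\<bar> - x\<^sup>2 / (2 * h)) = 2 * b * \<bar>x\<bar> - x\<^sup>2 / h"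
        using h by (simp add: field_simps)
      finally show ?thesis .
    qed
    then show "AE x in lborel. norm ((cmod (f x))\<^sup>2) \<le> norm (K\<^sup>2 * exp (2 * b * \<bar>x\<bar> - x\<^sup>2 / h))"
      by (intro AE_I2) simp
  qed measurable
  then show ?thesis
    by (simp add: sq_integrable_def)
qed

text \<open>Every Gaussian monomial in two variables is a product of two Gaussian monomials in one
  variable.\<close>

lemma tensor_total:
  fixes F :: "(real \<times> real) L2"
  assumes "\<And>f g. cinner (f \<otimes>\<^sub>v g) F = 0"
  shows "F = 0"
proof (rule gauss_monomials_total[of 1])
  define m where "m i x = complex_of_real (x ^ i * exp (- x\<^sup>2 / 2))" for i and x :: real
  have sq: "sq_integrable (m i)" for i
  proof (rule sq_integrable_gauss_real[of 1])
    show "cmod (m i x) \<le> fact i * exp (1 * \<bar>x\<bar> - x\<^sup>2 / (2 * 1))" for x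
    proof -
      have "\<bar>x\<bar> ^ i * exp (- x\<^sup>2 / 2) \<le> (fact i * exp \<bar>x\<bar>) * exp (- x\<^sup>2 / 2)"
        by (intro mult_right_mono power_le_fact_exp) auto
      also have "\<dots> = fact i * exp (1 * \<bar>x\<bar> - x\<^sup>2 / (2 * 1))"
        by (simp add: exp_add[symmetric])
      finally show ?thesis
        by (simp add: m_def norm_mult norm_power)
    qed
  qed (simp_all add: m_def[abs_def])
  fix i j
  have "exp (- (x\<^sup>2 + y\<^sup>2) / (2 * 1)) = exp (- x\<^sup>2 / 2) * exp (- y\<^sup>2 / 2)" for x y :: real
    by (simp add: exp_add[symmetric] add_divide_distrib diff_divide_distrib)
  then have "(\<lambda>(x, y). complex_of_real (x ^ i * y ^ j * exp (- (x\<^sup>2 + y\<^sup>2) / (2 * 1)))) = (\<lambda>(x, y). m i x * m j y)"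
    by (simp only: m_def of_real_mult mult_ac)
  then show "cinner (abs_L2 (\<lambda>(x, y). complex_of_real (x ^ i * y ^ j * exp (- (x\<^sup>2 + y\<^sup>2) / (2 * 1))))) F = 0"
    using assms[of "abs_L2 (m i)" "abs_L2 (m j)"] by (simp add: tensor_abs[OF sq sq])
qed simp

interpretation tensor: hilbert_tensor "tensor_vec :: real L2 \<Rightarrow> real L2 \<Rightarrow> (real \<times> real) L2"
  by standard (auto simp: cinner_tensor tensor_total)

interpretation tensor_flip: hilbert_tensor "\<lambda>g f. tensor_vec f g :: (real \<times> real) L2"
  by standard (auto simp: cinner_tensor mult.commute intro: tensor_total)

lemma tensor_op_eqI:
  fixes T :: "(real \<times> real) L2 \<Rightarrow> (real \<times> real) L2"
  assumes "bounded_op T" "\<And>f g. T (f \<otimes>\<^sub>v g) = A f \<otimes>\<^sub>v B g"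
  shows "A \<otimes>\<^sub>o B = T"
  unfolding tensor_op_def
  by (rule the_equality) (use assms in \<open>auto intro!: tensor.bounded_op_tens_eqI\<close>)

lemma tensor_op_id_right:
  fixes A :: "real L2 \<Rightarrow> real L2"
  assumes "bounded_op A"
  shows "bounded_op (A \<otimes>\<^sub>o (id :: real L2 \<Rightarrow> real L2))" "(A \<otimes>\<^sub>o id) (f \<otimes>\<^sub>v g) = A f \<otimes>\<^sub>v (g :: real L2)"
proof -
  obtain T :: "(real \<times> real) L2 \<Rightarrow> (real \<times> real) L2"
    where T: "bounded_op T" "\<And>f g. T (f \<otimes>\<^sub>v g) = A f \<otimes>\<^sub>v g"
    by (rule tensor.tensor_left_exists[OF assms]) blast
  have "A \<otimes>\<^sub>o id = T"
    by (rule tensor_op_eqI) (simp_all add: T)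
  with T show "bounded_op (A \<otimes>\<^sub>o (id :: real L2 \<Rightarrow> real L2))" "(A \<otimes>\<^sub>o id) (f \<otimes>\<^sub>v g) = A f \<otimes>\<^sub>v g"
    by simp_all
qed

lemma tensor_op_id_left:
  fixes B :: "real L2 \<Rightarrow> real L2"
  assumes "bounded_op B"
  shows "bounded_op ((id :: real L2 \<Rightarrow> real L2) \<otimes>\<^sub>o B)" "(id \<otimes>\<^sub>o B) (f \<otimes>\<^sub>v g) = (f :: real L2) \<otimes>\<^sub>v B g"
proof -
  obtain T :: "(real \<times> real) L2 \<Rightarrow> (real \<times> real) L2"
    where T: "bounded_op T" "\<And>g f. T (f \<otimes>\<^sub>v g) = f \<otimes>\<^sub>v B g"
    by (rule tensor_flip.tensor_left_exists[OF assms]) blast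
  have "id \<otimes>\<^sub>o B = T"
    by (rule tensor_op_eqI) (simp_all add: T)
  with T show "bounded_op ((id :: real L2 \<Rightarrow> real L2) \<otimes>\<^sub>o B)" "(id \<otimes>\<^sub>o B) (f \<otimes>\<^sub>v g) = f \<otimes>\<^sub>v B g"
    by simp_all
qed

lemma tensor_op_ket_bra:
  fixes u v :: "real L2"
  shows "ket_bra u \<otimes>\<^sub>o ket_bra v = ket_bra (u \<otimes>\<^sub>v v)"
  by (rule tensor_op_eqI)
    (simp_all add: bounded_op_ket_bra ket_bra_def cinner_tensor tensor.tens_scaleC_left
      tensor.tens_scaleC_right scaleC_scaleC mult.commute)

section \<open>Coherent states\<close>

definition coh :: "real \<Rightarrow> real \<Rightarrow> real \<Rightarrow> real \<Rightarrow> complex" where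
  "coh h q p x = of_real ((pi * h) powr (- 1 / 4)) * of_real (exp (- (x - q)\<^sup>2 / (2 * h)))
       * exp (\<i> * of_real (p * x / h))"

lemma coherent_eq: "coherent h (q, p) = abs_L2 (coh h q p)"
  by (simp add: coherent_def coh_def[abs_def])

lemma coh_measurable [measurable]: "coh h q p \<in> borel_measurable borel"
  unfolding coh_def[abs_def] by measurable

lemma norm_coh: "cmod (coh h q p x) = (pi * h) powr (- 1 / 4) * exp (- (x - q)\<^sup>2 / (2 * h))"
  by (simp add: coh_def norm_mult)

lemma gauss_shift_le:
  fixes h q x :: real
  assumes "h > 0"
  shows "exp (- (x - q)\<^sup>2 / (2 * h)) \<le> exp (\<bar>q\<bar> / h * \<bar>x\<bar> - x\<^sup>2 / (2 * h))"
proof -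
  have "q * x \<le> \<bar>q\<bar> * \<bar>x\<bar>"
    using abs_ge_self[of "q * x"] by (simp add: abs_mult)
  then have "- (x - q)\<^sup>2 \<le> 2 * (\<bar>q\<bar> * \<bar>x\<bar>) - x\<^sup>2"
    using zero_le_power2[of q] power2_diff[of x q] by (simp only: mult.commute[of x q] mult.assoc)
  then have "- (x - q)\<^sup>2 / (2 * h) \<le> (2 * (\<bar>q\<bar> * \<bar>x\<bar>) - x\<^sup>2) / (2 * h)"
    using assms by (intro divide_right_mono) auto
  also have "\<dots> = \<bar>q\<bar> / h * \<bar>x\<bar> - x\<^sup>2 / (2 * h)"
    using assms by (simp add: field_simps)
  finally show ?thesis
    by simp
qed

lemma coh_sq_integrable:
  assumes "h > 0"
  shows "sq_integrable (coh h q p)"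
proof (rule sq_integrable_gauss_real[OF assms])
  show "cmod (coh h q p x) \<le> (pi * h) powr (- 1 / 4) * exp (\<bar>q\<bar> / h * \<bar>x\<bar> - x\<^sup>2 / (2 * h))" for x
    unfolding norm_coh by (intro mult_left_mono gauss_shift_le assms) simp
qed measurable

lemma powr_quarter_squared:
  assumes "h > 0"
  shows "(pi * h) powr (- 1 / 4) * (pi * h) powr (- 1 / 4) = 1 / sqrt (pi * h)"
proof -
  have "(pi * h) powr (- 1 / 4) * (pi * h) powr (- 1 / 4) = (pi * h) powr (- (1 / 2))"
    by (simp add: powr_add[symmetric])
  also have "\<dots> = inverse ((pi * h) powr (1 / 2))"
    by (rule powr_minus)
  also have "\<dots> = 1 / sqrt (pi * h)"
    using assms by (simp add: powr_half_sqrt inverse_eq_divide)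
  finally show ?thesis .
qed

text \<open>The product of the two Gaussians is the overlap times the normal density of variance
  \<open>h / 2\<close> at the midpoint of their centres.\<close>

lemma cinner_coherent_real:
  assumes h: "h > 0"
  shows "cinner (coherent h (q, 0)) (coherent h (q', 0)) = of_real (exp (- (q - q')\<^sup>2 / (4 * h)))"
proof -
  have "cnj (coh h q 0 x) * coh h q' 0 x
      = of_real (exp (- (q - q')\<^sup>2 / (4 * h)) * normal_density ((q + q') / 2) (sqrt (h / 2)) x)" for x
  proof -
    have "- (x - q)\<^sup>2 / (2 * h) + - (x - q')\<^sup>2 / (2 * h)
        = - (q - q')\<^sup>2 / (4 * h) + - (x - (q + q') / 2)\<^sup>2 / (2 * (h / 2))"
      using h by (simp add: field_simps power2_eq_square)
    then have e: "exp (- (x - q)\<^sup>2 / (2 * h)) * exp (- (x - q')\<^sup>2 / (2 * h))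
        = exp (- (q - q')\<^sup>2 / (4 * h)) * exp (- (x - (q + q') / 2)\<^sup>2 / (2 * (h / 2)))"
      by (simp only: exp_add[symmetric])
    have "cnj (coh h q 0 x) * coh h q' 0 x = of_real (((pi * h) powr (- 1 / 4) * (pi * h) powr (- 1 / 4)) *
        (exp (- (x - q)\<^sup>2 / (2 * h)) * exp (- (x - q')\<^sup>2 / (2 * h))))"
      by (simp add: coh_def)
    also have "\<dots> = of_real (exp (- (q - q')\<^sup>2 / (4 * h)) * normal_density ((q + q') / 2) (sqrt (h / 2)) x)"
      unfolding e powr_quarter_squared[OF h] normal_density_def using h
      by (simp add: real_sqrt_pow2)
    finally show ?thesis .
  qed
  then have "cinner (coherent h (q, 0)) (coherent h (q', 0))
      = (\<integral>x. complex_of_real (exp (- (q - q')\<^sup>2 / (4 * h)) * normal_density ((q + q') / 2) (sqrt (h / 2)) x) \<partial>lborel)"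
    by (simp only: coherent_eq cinner_abs[OF coh_sq_integrable[OF h] coh_sq_integrable[OF h]])
  also have "\<dots> = of_real (\<integral>x. exp (- (q - q')\<^sup>2 / (4 * h)) * normal_density ((q + q') / 2) (sqrt (h / 2)) x \<partial>lborel)"
    by (rule integral_complex_of_real)
  also have "\<dots> = of_real (exp (- (q - q')\<^sup>2 / (4 * h)))"
    using h by (simp add: integral_normal_density)
  finally show ?thesis .
qed

lemma norm_coherent:
  assumes h: "h > 0"
  shows "norm (coherent h z) = 1"
proof -
  obtain q p where z: "z = (q, p)"
    by (cases z)
  have "cnj (coh h q p x) * coh h q p x = cnj (coh h q 0 x) * coh h q 0 x" for x
  proof -
    have "cnj (iexp t) * iexp t = 1" for t
      by (simp add: exp_cnj mult_exp_exp)
    moreover have "coh h q p x = coh h q 0 x * iexp (p * x / h)"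
      by (simp add: coh_def)
    then have "cnj (coh h q p x) * coh h q p x
        = cnj (coh h q 0 x) * coh h q 0 x * (cnj (iexp (p * x / h)) * iexp (p * x / h))"
      by (simp only: complex_cnj_mult mult_ac)
    ultimately show ?thesis
      by (simp only: mult_1_right)
  qed
  then have "cinner (coherent h (q, p)) (coherent h (q, p)) = cinner (coherent h (q, 0)) (coherent h (q, 0))"
    by (simp add: coherent_eq cinner_abs coh_sq_integrable h)
  also have "\<dots> = 1"
    by (simp add: cinner_coherent_real[OF h])
  finally have "(norm (coherent h z))\<^sup>2 = 1"
    unfolding z cinner_self using of_real_eq_1_iff by blast
  then show ?thesis
    by (simp add: power2_eq_1_iff) (metis norm_ge_zero neg_0_le_iff_le not_one_le_zero)
qed

text \<open>The overlaps \<open>\<langle>q, p | (x\<^sup>2 + c) e\<^bsup>-x\<^sup>2/2h\<^esup>\<rangle>\<close> are \<open>(m\<^sup>2 + h/2 + c)\<close> times a nonvanishing factor,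
  where \<open>m = (q - i p) / 2\<close>. For \<open>c = - h/2 - a\<^sup>2/4\<close> this function of the phase space point vanishes
  exactly at \<open>(\<plusminus>a, 0)\<close>.\<close>

definition cgauss :: "real \<Rightarrow> real \<Rightarrow> real \<Rightarrow> real \<Rightarrow> complex" where
  "cgauss h q p x = of_real (exp (- (x - q / 2)\<^sup>2 / h)) * iexp (- (p / h) * x)"

lemma norm_cgauss_le:
  assumes "h > 0"
  shows "cmod (cgauss h q p x) \<le> exp (\<bar>q\<bar> / h * \<bar>x\<bar> - x\<^sup>2 / h)"
  using gauss_shift_le[of "h / 2" x "q / 2"] assms by (simp add: cgauss_def norm_mult)

text \<open>An affine substitution turns the integral into a nonzero multiple of the characteristic
  function of the standard normal law, which has no zeros.\<close>

lemma integral_cgauss_nonzero: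
  assumes h: "h > 0"
  shows "(\<integral>x. cgauss h q p x \<partial>lborel) \<noteq> 0"
proof -
  define s where "s = sqrt (h / 2)"
  have s: "s > 0" "s\<^sup>2 = h / 2"
    using h by (simp_all add: s_def)
  have "(\<integral>x. cgauss h q p x \<partial>lborel) = \<bar>s\<bar> *\<^sub>R (\<integral>x. cgauss h q p (q / 2 + s * x) \<partial>lborel)"
    using s by (intro lborel_integral_real_affine) simp
  also have "(\<integral>x. cgauss h q p (q / 2 + s * x) \<partial>lborel)
      = (\<integral>x. (of_real (sqrt (2 * pi)) * iexp (- (p / h) * (q / 2))) * (std_normal_density x *\<^sub>R iexp (- (p * s / h) * x)) \<partial>lborel)"
  proof (intro Bochner_Integration.integral_cong refl)
    fix x
    have "(q / 2 + s * x - q / 2)\<^sup>2 / h = x\<^sup>2 / 2"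
      using h by (simp add: power_mult_distrib s)
    then have "cgauss h q p (q / 2 + s * x) = of_real (exp (- x\<^sup>2 / 2)) * iexp (- (p / h) * (q / 2) + - (p * s / h) * x)"
      unfolding cgauss_def by (simp add: algebra_simps)
    moreover have "iexp (u + v) = iexp u * iexp v" for u v
      by (simp add: distrib_left exp_add)
    moreover have "exp (- x\<^sup>2 / 2) = sqrt (2 * pi) * std_normal_density x"
      by (simp add: std_normal_density_def)
    ultimately show "cgauss h q p (q / 2 + s * x)
        = (of_real (sqrt (2 * pi)) * iexp (- (p / h) * (q / 2))) * (std_normal_density x *\<^sub>R iexp (- (p * s / h) * x))"
      by (simp only: scaleR_conv_of_real of_real_mult mult_ac)
  qed
  also have "\<dots> = (of_real (sqrt (2 * pi)) * iexp (- (p / h) * (q / 2))) * (\<integral>x. std_normal_density x *\<^sub>R iexp (- (p * s / h) * x) \<partial>lborel)"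
    by (rule integral_mult_right_zero)
  also have "(\<integral>x. std_normal_density x *\<^sub>R iexp (- (p * s / h) * x) \<partial>lborel) = char std_normal_distribution (- (p * s / h))"
    unfolding char_def by (subst integral_density) auto
  finally show ?thesis
    using s by (simp add: char_std_normal_distribution)
qed

text \<open>The constants add factorials: 7 = 1 + 6 from the powers 1 and 3, and 3 = 1 + 2 from the
  powers 0 and 2.\<close>

lemma cubic_le_exp:
  fixes x :: real
  assumes "0 \<le> M"
  shows "(1 + x\<^sup>2) * (\<bar>x\<bar> + M) \<le> (7 + 3 * M) * exp \<bar>x\<bar>"
proof -
  have "\<bar>x\<bar> \<le> exp \<bar>x\<bar>" "x\<^sup>2 \<le> 2 * exp \<bar>x\<bar>" "\<bar>x\<bar> ^ 3 \<le> 6 * exp \<bar>x\<bar>" "1 \<le> exp \<bar>x\<bar>"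
    using power_le_fact_exp[of x 1] power_le_fact_exp[of x 2] power_le_fact_exp[of x 3]
    by (simp_all add: fact_numeral)
  moreover have "(1 + x\<^sup>2) * (\<bar>x\<bar> + M) = \<bar>x\<bar> + \<bar>x\<bar> ^ 3 + M * 1 + M * x\<^sup>2"
    by (simp add: algebra_simps power3_eq_cube power2_eq_square abs_mult_self_eq flip: abs_mult)
  moreover have "M * 1 \<le> M * exp \<bar>x\<bar>" "M * x\<^sup>2 \<le> M * (2 * exp \<bar>x\<bar>)"
    using assms calculation by (intro mult_left_mono; simp)+
  ultimately show ?thesis
    by (simp add: algebra_simps)
qed

lemma cgauss_integrable_mult:
  fixes P :: "real \<Rightarrow> complex"
  assumes h: "h > 0" and [measurable]: "P \<in> borel_measurable borel" and P: "\<And>x. cmod (P x) \<le> L * exp \<bar>x\<bar>"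
  shows "integrable lborel (\<lambda>x. P x * cgauss h q p x)"
proof (rule Bochner_Integration.integrable_bound[OF integrable_mult_right[OF integrable_exp_abs_gauss[OF h, of "1 + \<bar>q\<bar> / h"], of L]])
  have "cmod (P x * cgauss h q p x) \<le> L * exp ((1 + \<bar>q\<bar> / h) * \<bar>x\<bar> - x\<^sup>2 / h)" for x
  proof -
    have "cmod (P x * cgauss h q p x) \<le> (L * exp \<bar>x\<bar>) * exp (\<bar>q\<bar> / h * \<bar>x\<bar> - x\<^sup>2 / h)"
      unfolding norm_mult using order_trans[OF norm_ge_zero P]
      by (intro mult_mono P norm_cgauss_le h) auto
    also have "\<dots> = L * exp (\<bar>x\<bar> + (\<bar>q\<bar> / h * \<bar>x\<bar> - x\<^sup>2 / h))"
      by (simp only: exp_add mult.assoc)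
    also have "\<bar>x\<bar> + (\<bar>q\<bar> / h * \<bar>x\<bar> - x\<^sup>2 / h) = (1 + \<bar>q\<bar> / h) * \<bar>x\<bar> - x\<^sup>2 / h"
      by (simp add: distrib_right)
    finally show ?thesis .
  qed
  then show "AE x in lborel. norm (P x * cgauss h q p x) \<le> norm (L * exp ((1 + \<bar>q\<bar> / h) * \<bar>x\<bar> - x\<^sup>2 / h))"
    by (intro AE_I2) (auto intro: order_trans[OF _ abs_ge_self])
  show "(\<lambda>x. P x * cgauss h q p x) \<in> borel_measurable lborel"
    unfolding cgauss_def by measurable
qed

text \<open>With E = \<open>cgauss h q p\<close> one has E' = -(2/h) (x - m) E, so the derivative of
  (x + m) E is E - (2/h) (x^2 - m^2) E. Its integral vanishes, which expresses the second moment
  through the integral of E.\<close>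

lemma cgauss_second_moment:
  fixes h q p c :: real
  assumes h: "h > 0"
  defines "m \<equiv> (of_real q - \<i> * of_real p) / 2"
  shows "(\<integral>x. (of_real (x\<^sup>2) + of_real c) * cgauss h q p x \<partial>lborel)
    = (m\<^sup>2 + of_real (h / 2) + of_real c) * (\<integral>x. cgauss h q p x \<partial>lborel)"
proof -
  define E where "E = cgauss h q p"
  have dE: "(E has_vector_derivative (- 2 / of_real h) * (of_real x - m) * E x) (at x)" for x
  proof -
    have "((\<lambda>x. exp (- (x - q / 2)\<^sup>2 / h)) has_real_derivative exp (- (x - q / 2)\<^sup>2 / h) * (- 2 * (x - q / 2) / h)) (at x)"
      using h by (auto intro!: derivative_eq_intros simp: field_simps)
    then have 1: "((\<lambda>x. complex_of_real (exp (- (x - q / 2)\<^sup>2 / h))) has_vector_derivative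
        of_real (exp (- (x - q / 2)\<^sup>2 / h) * (- 2 * (x - q / 2) / h))) (at x)"
      unfolding has_real_derivative_iff_has_vector_derivative by (rule bounded_linear.has_vector_derivative[OF bounded_linear_of_real])
    have 2: "((\<lambda>x. iexp (- (p / h) * x)) has_vector_derivative (\<i> * of_real (- (p / h))) * iexp (- (p / h) * x)) (at x)"
    proof -
      have "((\<lambda>z. exp (\<i> * of_real (- (p / h)) * z)) has_field_derivative exp (\<i> * of_real (- (p / h)) * of_real x) * (\<i> * of_real (- (p / h)))) (at (of_real x))"
        using h by (auto intro!: derivative_eq_intros)
      from has_vector_derivative_real_field[OF this] show ?thesis
        by (simp add: mult_ac)
    qed
    have "(E has_vector_derivative of_real (exp (- (x - q / 2)\<^sup>2 / h)) * ((\<i> * of_real (- (p / h))) * iexp (- (p / h) * x))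
        + of_real (exp (- (x - q / 2)\<^sup>2 / h) * (- 2 * (x - q / 2) / h)) * iexp (- (p / h) * x)) (at x)"
      unfolding E_def cgauss_def[abs_def] by (rule has_vector_derivative_mult[OF 1 2])
    moreover have "of_real (exp (- (x - q / 2)\<^sup>2 / h)) * ((\<i> * of_real (- (p / h))) * iexp (- (p / h) * x))
        + of_real (exp (- (x - q / 2)\<^sup>2 / h) * (- 2 * (x - q / 2) / h)) * iexp (- (p / h) * x)
        = (\<i> * of_real (- (p / h)) + of_real (- 2 * (x - q / 2) / h)) * E x"
      unfolding E_def cgauss_def of_real_mult by (simp only: ring_distribs mult_ac)
    moreover have "\<i> * of_real (- (p / h)) + of_real (- 2 * (x - q / 2) / h) = (- 2 / of_real h) * (of_real x - m)"
      using h by (simp add: m_def field_simps)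
    ultimately show ?thesis
      by simp
  qed
  define g where "g x = E x - (2 / of_real h) * ((of_real (x\<^sup>2) - m\<^sup>2) * E x)" for x
  have cE: "continuous_on UNIV E"
    unfolding E_def cgauss_def[abs_def] using h by (intro continuous_intros) auto
  have iE: "integrable lborel E" "integrable lborel (\<lambda>x. of_real (x\<^sup>2) * E x)"
  proof -
    show "integrable lborel E"
      using cgauss_integrable_mult[OF h, of "\<lambda>x. 1" 1 q p] by (simp add: E_def)
    show "integrable lborel (\<lambda>x. of_real (x\<^sup>2) * E x)"
      unfolding E_def
    proof (rule cgauss_integrable_mult[OF h, of _ 2])
      show "cmod (complex_of_real (x\<^sup>2)) \<le> 2 * exp \<bar>x\<bar>" for x
        using power_le_fact_exp[of x 2] unfolding norm_of_real by (simp add: fact_numeral)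
    qed measurable
  qed
  then have ig: "integrable lborel g"
    unfolding g_def[abs_def] left_diff_distrib by simp
  have "integral\<^sup>L lborel g = 0"
  proof (rule integral_derivative_eq_zero)
    show "((\<lambda>x. (of_real x + m) * E x) has_vector_derivative g x) (at x)" for x
    proof -
      have "((\<lambda>x. of_real x + m) has_vector_derivative 1) (at x)"
        by (auto intro!: derivative_eq_intros)
      from has_vector_derivative_mult[OF this dE]
      show ?thesis
        by (rule has_vector_derivative_eq_rhs) (simp add: g_def algebra_simps power2_eq_square diff_divide_distrib add_divide_distrib)
    qed
    show "continuous_on UNIV g"
      unfolding g_def[abs_def]
      by (intro continuous_on_diff continuous_on_mult continuous_on_const continuous_on_of_real continuous_on_power continuous_on_id cE)
    show "integrable lborel g"
      by (rule ig)
    define M where "M = cmod m"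
    define b where "b = 1 + \<bar>q\<bar> / h"
    show "cmod ((of_real x + m) * E x) \<le> ((7 + 3 * M) * exp (b\<^sup>2 * h / 4)) * inverse (1 + x\<^sup>2)" for x
    proof -
      have pos: "0 < 1 + x\<^sup>2"
        by (rule add_pos_nonneg) auto
      have sq: "b * \<bar>x\<bar> - x\<^sup>2 / h \<le> b\<^sup>2 * h / 4"
      proof -
        have "b\<^sup>2 * h / 4 - (b * \<bar>x\<bar> - \<bar>x\<bar>\<^sup>2 / h) = (\<bar>x\<bar> - b * h / 2)\<^sup>2 / h"
          using h by (simp add: field_simps power2_eq_square)
        moreover have "0 \<le> (\<bar>x\<bar> - b * h / 2)\<^sup>2 / h"
          using h by simp
        ultimately show ?thesis
          by simp
      qed
      have "(1 + x\<^sup>2) * cmod ((of_real x + m) * E x) = ((1 + x\<^sup>2) * cmod (of_real x + m)) * cmod (E x)"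
        by (simp add: norm_mult)
      also have "\<dots> \<le> ((1 + x\<^sup>2) * (\<bar>x\<bar> + M)) * cmod (E x)"
        using norm_triangle_ineq[of "of_real x" m] pos
        by (intro mult_right_mono mult_left_mono) (auto simp: M_def)
      also have "\<dots> \<le> ((7 + 3 * M) * exp \<bar>x\<bar>) * exp (\<bar>q\<bar> / h * \<bar>x\<bar> - x\<^sup>2 / h)"
        unfolding E_def by (intro mult_mono cubic_le_exp norm_cgauss_le h) (auto simp: M_def)
      also have "\<dots> = (7 + 3 * M) * exp (\<bar>x\<bar> + (\<bar>q\<bar> / h * \<bar>x\<bar> - x\<^sup>2 / h))"
        by (simp only: exp_add mult.assoc)
      also have "\<bar>x\<bar> + (\<bar>q\<bar> / h * \<bar>x\<bar> - x\<^sup>2 / h) = b * \<bar>x\<bar> - x\<^sup>2 / h"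
        by (simp add: distrib_right b_def)
      also have "(7 + 3 * M) * exp (b * \<bar>x\<bar> - x\<^sup>2 / h) \<le> (7 + 3 * M) * exp (b\<^sup>2 * h / 4)"
        using sq by (intro mult_left_mono) (auto simp: M_def)
      finally show ?thesis
        unfolding divide_inverse[symmetric] pos_le_divide_eq[OF pos] by (subst mult.commute)
    qed
  qed
  moreover have "integral\<^sup>L lborel g = integral\<^sup>L lborel E - (2 / of_real h) * ((\<integral>x. of_real (x\<^sup>2) * E x \<partial>lborel) - m\<^sup>2 * integral\<^sup>L lborel E)"
    unfolding g_def[abs_def] left_diff_distrib using iE by simp
  ultimately have "(\<integral>x. of_real (x\<^sup>2) * E x \<partial>lborel) = (m\<^sup>2 + of_real (h / 2)) * integral\<^sup>L lborel E"
    using h by (simp add: field_simps)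
  then show ?thesis
    unfolding E_def[symmetric] distrib_right[of "of_real (_\<^sup>2)"] using iE by (simp add: distrib_right)
qed

text \<open>Completing the square turns the conjugated coherent state times the centred Gaussian
  into a constant times \<open>cgauss\<close>. The case b = 0 gives the overlap with the ground
  state, b = 1 the separating vector.\<close>

lemma cinner_coherent_gauss_poly:
  fixes a b h q p :: real
  assumes h: "h > 0"
  defines "f \<equiv> \<lambda>x. complex_of_real ((b * x\<^sup>2 + a) * exp (- x\<^sup>2 / (2 * h)))"
  obtains k where "k \<noteq> 0" "sq_integrable f" "cinner (coherent h (q, p)) (abs_L2 f)
    = k * (\<integral>x. of_real (b * x\<^sup>2 + a) * cgauss h q p x \<partial>lborel)"
proof -
  have sq: "sq_integrable f"
  proof (rule sq_integrable_gauss_real[OF h])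
    show "f \<in> borel_measurable borel"
      unfolding f_def by measurable
    show "cmod (f x) \<le> (2 * \<bar>b\<bar> + \<bar>a\<bar>) * exp (1 * \<bar>x\<bar> - x\<^sup>2 / (2 * h))" for x
    proof -
      have "x\<^sup>2 \<le> 2 * exp \<bar>x\<bar>" "1 \<le> exp \<bar>x\<bar>"
        using power_le_fact_exp[of x 2] by (simp_all add: fact_numeral)
      then have "\<bar>b\<bar> * x\<^sup>2 \<le> \<bar>b\<bar> * (2 * exp \<bar>x\<bar>)" "\<bar>a\<bar> * 1 \<le> \<bar>a\<bar> * exp \<bar>x\<bar>"
        by (intro mult_left_mono; simp)+
      moreover have "\<bar>b * x\<^sup>2 + a\<bar> \<le> \<bar>b\<bar> * x\<^sup>2 + \<bar>a\<bar>"
        using abs_triangle_ineq[of "b * x\<^sup>2" a] by (simp add: abs_mult)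
      ultimately have "\<bar>b * x\<^sup>2 + a\<bar> \<le> (2 * \<bar>b\<bar> + \<bar>a\<bar>) * exp \<bar>x\<bar>"
        by (simp add: algebra_simps)
      then have "\<bar>b * x\<^sup>2 + a\<bar> * exp (- x\<^sup>2 / (2 * h)) \<le> ((2 * \<bar>b\<bar> + \<bar>a\<bar>) * exp \<bar>x\<bar>) * exp (- x\<^sup>2 / (2 * h))"
        by (intro mult_right_mono) auto
      also have "\<dots> = (2 * \<bar>b\<bar> + \<bar>a\<bar>) * exp (\<bar>x\<bar> + - x\<^sup>2 / (2 * h))"
        by (simp only: exp_add mult.assoc)
      also have "\<bar>x\<bar> + - x\<^sup>2 / (2 * h) = 1 * \<bar>x\<bar> - x\<^sup>2 / (2 * h)"
        by simp
      finally show ?thesis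
        by (simp only: f_def norm_of_real abs_mult abs_exp_cancel)
    qed
  qed
  define k where "k = complex_of_real ((pi * h) powr (- 1 / 4) * exp (- q\<^sup>2 / (4 * h)))"
  have "cnj (coh h q p x) * f x = k * (of_real (b * x\<^sup>2 + a) * cgauss h q p x)" for x
  proof -
    have "- (x - q)\<^sup>2 / (2 * h) + - x\<^sup>2 / (2 * h) = - q\<^sup>2 / (4 * h) + - (x - q / 2)\<^sup>2 / h"
      using h by (simp add: field_simps power2_eq_square)
    then have e: "exp (- (x - q)\<^sup>2 / (2 * h)) * exp (- x\<^sup>2 / (2 * h)) = exp (- q\<^sup>2 / (4 * h)) * exp (- (x - q / 2)\<^sup>2 / h)"
      by (simp only: exp_add[symmetric])
    have "cnj (coh h q p x) * f x = of_real ((pi * h) powr (- 1 / 4)) * of_real (b * x\<^sup>2 + a) *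
        of_real (exp (- (x - q)\<^sup>2 / (2 * h)) * exp (- x\<^sup>2 / (2 * h))) * exp (cnj (\<i> * of_real (p * x / h)))"
      unfolding coh_def f_def complex_cnj_mult exp_cnj complex_cnj_complex_of_real of_real_mult by (simp only: mult_ac)
    also have "\<dots> = k * (of_real (b * x\<^sup>2 + a) * cgauss h q p x)"
      unfolding e k_def cgauss_def of_real_mult by (simp add: mult_ac)
    finally show ?thesis .
  qed
  then have "cinner (coherent h (q, p)) (abs_L2 f) = k * (\<integral>x. of_real (b * x\<^sup>2 + a) * cgauss h q p x \<partial>lborel)"
    by (simp add: coherent_eq cinner_abs[OF coh_sq_integrable[OF h] sq])
  moreover have "k \<noteq> 0"
    using h by (simp add: k_def)
  ultimately show ?thesis
    using that sq by blast
qed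

text \<open>The ground state serves as the second factor when a marginal is tested: it cannot be
  responsible for the vanishing of a product of overlaps.\<close>

lemma cinner_coherent_zero_nonzero:
  assumes h: "h > 0"
  shows "cinner (coherent h z) (coherent h (0, 0)) \<noteq> 0"
proof -
  obtain q p where z: "z = (q, p)"
    by (cases z)
  obtain k where "k \<noteq> 0" and k: "cinner (coherent h (q, p)) (abs_L2 (\<lambda>x. complex_of_real ((0 * x\<^sup>2 + (pi * h) powr (- 1 / 4)) * exp (- x\<^sup>2 / (2 * h)))))
    = k * (\<integral>x. of_real (0 * x\<^sup>2 + (pi * h) powr (- 1 / 4)) * cgauss h q p x \<partial>lborel)"
    using cinner_coherent_gauss_poly[OF h] by blast
  have "coh h 0 0 = (\<lambda>x. complex_of_real ((0 * x\<^sup>2 + (pi * h) powr (- 1 / 4)) * exp (- x\<^sup>2 / (2 * h))))"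
    by (simp add: coh_def fun_eq_iff)
  with k have "cinner (coherent h z) (coherent h (0, 0))
      = k * (of_real ((pi * h) powr (- 1 / 4)) * (\<integral>x. cgauss h q p x \<partial>lborel))"
    unfolding z coherent_eq[of h 0 0] by simp
  then show ?thesis
    using \<open>k \<noteq> 0\<close> integral_cgauss_nonzero[OF h] h by simp
qed

lemma coherent_separating_vector:
  fixes a h :: real
  assumes h: "h > 0"
  obtains f where "\<And>z. cinner (coherent h z) f = 0 \<longleftrightarrow> z = (a, 0) \<or> z = (- a, 0)"
proof -
  define f where "f = (\<lambda>x. complex_of_real ((1 * x\<^sup>2 + (- (h / 2) - a\<^sup>2 / 4)) * exp (- x\<^sup>2 / (2 * h))))"
  have "cinner (coherent h z) (abs_L2 f) = 0 \<longleftrightarrow> z = (a, 0) \<or> z = (- a, 0)" for z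
  proof -
    obtain q p where z: "z = (q, p)"
      by (cases z)
    obtain k where "k \<noteq> 0" and k: "cinner (coherent h (q, p)) (abs_L2 f)
        = k * (\<integral>x. of_real (1 * x\<^sup>2 + (- (h / 2) - a\<^sup>2 / 4)) * cgauss h q p x \<partial>lborel)"
      unfolding f_def using cinner_coherent_gauss_poly[OF h] by blast
    let ?w = "of_real q - \<i> * of_real p"
    have "(\<integral>x. of_real (1 * x\<^sup>2 + (- (h / 2) - a\<^sup>2 / 4)) * cgauss h q p x \<partial>lborel)
        = ((?w / 2)\<^sup>2 + of_real (h / 2) + of_real (- (h / 2) - a\<^sup>2 / 4)) * (\<integral>x. cgauss h q p x \<partial>lborel)"
      using cgauss_second_moment[OF h, of "- (h / 2) - a\<^sup>2 / 4" q p] by simp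
    then have "cinner (coherent h z) (abs_L2 f) = 0 \<longleftrightarrow> (?w / 2)\<^sup>2 + of_real (h / 2) + of_real (- (h / 2) - a\<^sup>2 / 4) = 0"
      using \<open>k \<noteq> 0\<close> integral_cgauss_nonzero[OF h, of q p] unfolding z k by simp
    also have "(?w / 2)\<^sup>2 + of_real (h / 2) + of_real (- (h / 2) - a\<^sup>2 / 4) = ((?w - of_real a) * (?w + of_real a)) / 4"
      by (simp add: field_simps power2_eq_square)
    also have "\<dots> = 0 \<longleftrightarrow> ?w = of_real a \<or> ?w = - of_real a"
      by (simp add: eq_neg_iff_add_eq_0)
    also have "\<dots> \<longleftrightarrow> z = (a, 0) \<or> z = (- a, 0)"
      by (auto simp: z complex_eq_iff)
    finally show ?thesis .
  qed
  then show ?thesis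
    using that by blast
qed

section \<open>Marginals of a Toeplitz coupling\<close>

lemma parseval_norm:
  assumes "orthonormal_basis B"
  shows "((\<lambda>e. (cmod (cinner f e))\<^sup>2) has_sum (norm f)\<^sup>2) B"
proof -
  have "Re (cinner f e * cinner e f) = (cmod (cinner f e))\<^sup>2" for e
    unfolding cinner_commute[of e f] complex_norm_square[symmetric] by (rule Re_complex_of_real)
  then show ?thesis
    using has_sum_Re[OF parseval[OF assms, of f f]] by (simp add: cinner_self)
qed

text \<open>The operator \<open>T\<close> replaces the second factor by its projection onto
  \<open>f\<close>. In a product basis whose second part contains \<open>f\<close>, only the vectors
  \<open>tens g f\<close> contribute to the trace.\<close>

lemma (in hilbert_tensor) rank_one_right_has_sum:
  assumes T: "bounded_op T" "\<And>u v. T (tens u v) = tens u (ket_bra f v)" and f: "norm f = 1"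
    and tr: "has_trace (T \<circ> Q) t" and C: "orthonormal_basis C"
  shows "((\<lambda>g. cinner (tens g f) (Q (tens g f))) has_sum t) C"
proof -
  have b: "bounded_op (\<lambda>H. tens (slice f H) f)"
    unfolding bounded_op_def
  proof (intro conjI allI)
    show "bounded_linear (\<lambda>H. tens (slice f H) f)"
    proof (rule bounded_linear_intro[where K = 1])
      show "norm (tens (slice f H) f) \<le> norm H * 1" for H
        using slice_bessel[OF orthonormal_singleton[OF f], of H]
        by (simp add: norm_tens f power2_le_iff_abs_le)
    qed (simp_all add: slice_add slice_scaleC tens_add_left tens_scaleC_left scaleR_scaleC)
  qed (simp add: slice_scaleC tens_scaleC_left)
  have T_eq: "T = (\<lambda>H. tens (slice f H) f)"
    by (rule bounded_op_tens_eqI[OF T(1) b])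
      (simp add: T(2) slice_tens ket_bra_def tens_scaleC_left tens_scaleC_right)
  obtain B where B: "{f} \<subseteq> B" "orthonormal_basis B"
    using orthonormal_extend_basis[OF orthonormal_singleton[OF f]] by blast
  define D where "D = {tens g e | g e. g \<in> C \<and> e \<in> B}"
  have D: "orthonormal_basis D"
    unfolding D_def by (rule tens_onb[OF C B(2)])
  have "((\<lambda>b. cinner b ((T \<circ> Q) b)) has_sum t) D"
    using tr D unfolding has_trace_def by blast
  moreover have "((\<lambda>b. cinner b ((T \<circ> Q) b)) has_sum t) D \<longleftrightarrow>
      ((\<lambda>b. cinner b (Q b)) has_sum t) ((\<lambda>g. tens g f) ` C)"
  proof (rule has_sum_cong_neutral)
    fix b assume "b \<in> (\<lambda>g. tens g f) ` C - D"
    then show "cinner b (Q b) = 0"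
      using B by (auto simp: D_def)
  next
    fix b assume "b \<in> D - (\<lambda>g. tens g f) ` C"
    then obtain g e where "b = tens g e" "e \<in> B" "e \<noteq> f"
      unfolding D_def by blast
    then show "cinner b ((T \<circ> Q) b) = 0"
      using B orthonormalD[OF onb_orthonormal[OF B(2)]] by (auto simp: T_eq cinner_tens)
  next
    fix b assume "b \<in> D \<inter> (\<lambda>g. tens g f) ` C"
    then obtain g where "b = tens g f"
      by blast
    then show "cinner b ((T \<circ> Q) b) = cinner b (Q b)"
      using f by (simp add: T_eq cinner_tens cinner_slice cinner_self)
  qed
  moreover have "inj_on (\<lambda>g. tens g f) C"
    using tens_inj[OF onb_orthonormal[OF C] onb_orthonormal[OF B(2)]] B(1) by (auto simp: inj_on_def)
  ultimately show ?thesis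
    by (simp add: has_sum_reindex comp_def)
qed

lemma ket_bra_comp_has_trace:
  assumes "\<And>x y. cinner x (R y) = cinner (R x) y"
  shows "has_trace (ket_bra f \<circ> R) (cinner f (R f))"
proof -
  have "ket_bra f \<circ> R = (\<lambda>x. cinner (R f) x *\<^sub>C f)"
    by (auto simp: ket_bra_def assms)
  then show ?thesis
    using has_trace_rank_one[of "R f" f] assms[of f f] by simp
qed

text \<open>The sum is the quadratic form at \<open>f\<close> of the partial trace of
  \<open>Q\<close> over the second factor. The coupling condition is used for the projection onto
  \<open>f\<close> only.\<close>

lemma coupling_marginal_left:
  fixes R S :: "real L2 \<Rightarrow> real L2" and Q :: "(real \<times> real) L2 \<Rightarrow> (real \<times> real) L2"
  assumes Q: "coupling R S Q" and R: "\<And>x y. cinner x (R y) = cinner (R x) y"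
    and f: "norm f = 1" and C: "orthonormal_basis C"
  shows "((\<lambda>g. cinner (f \<otimes>\<^sub>v g) (Q (f \<otimes>\<^sub>v g))) has_sum cinner f (R f)) C"
proof -
  obtain t where t: "has_trace ((ket_bra f \<otimes>\<^sub>o id) \<circ> Q) t" "has_trace (ket_bra f \<circ> R) t"
    using Q bounded_op_ket_bra[of f] unfolding coupling_def by blast
  have "t = cinner f (R f)"
    by (rule has_trace_unique[OF t(2) ket_bra_comp_has_trace[OF R]])
  then show ?thesis
    using tensor_flip.rank_one_right_has_sum[OF tensor_op_id_right(1)[OF bounded_op_ket_bra[of f]]
        tensor_op_id_right(2)[OF bounded_op_ket_bra[of f]] f t(1) C] by simp
qed

lemma coupling_marginal_right:
  fixes R S :: "real L2 \<Rightarrow> real L2" and Q :: "(real \<times> real) L2 \<Rightarrow> (real \<times> real) L2"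
  assumes Q: "coupling R S Q" and S: "\<And>x y. cinner x (S y) = cinner (S x) y"
    and f: "norm f = 1" and C: "orthonormal_basis C"
  shows "((\<lambda>g. cinner (g \<otimes>\<^sub>v f) (Q (g \<otimes>\<^sub>v f))) has_sum cinner f (S f)) C"
proof -
  obtain t where t: "has_trace ((id \<otimes>\<^sub>o ket_bra f) \<circ> Q) t" "has_trace (ket_bra f \<circ> S) t"
    using Q bounded_op_ket_bra[of f] unfolding coupling_def by blast
  have "t = cinner f (S f)"
    by (rule has_trace_unique[OF t(2) ket_bra_comp_has_trace[OF S]])
  then show ?thesis
    using tensor.rank_one_right_has_sum[OF tensor_op_id_left(1)[OF bounded_op_ket_bra[of f]]
        tensor_op_id_left(2)[OF bounded_op_ket_bra[of f]] f t(1) C] by simp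
qed

text \<open>On representatives the overlap is a parameter integral whose integrand is jointly
  measurable in the phase space points and the integration variable.\<close>

lemma measurable_coherent_overlap:
  assumes h: "h > 0"
  shows "(\<lambda>w. cinner (coherent h (fst w) \<otimes>\<^sub>v coherent h (snd w)) F) \<in> borel_measurable borel"
proof -
  note sq = coh_sq_integrable[OF h]
  define G where "G = rep_L2 F"
  have G: "sq_integrable G" "F = abs_L2 G"
    by (simp_all add: G_def sq_integrable_rep)
  have [measurable]: "G \<in> borel_measurable borel"
    using G(1) by (simp add: sq_integrable_def)
  have [measurable]: "cnj \<in> borel_measurable borel"
    by (intro borel_measurable_continuous_onI continuous_intros)
  have [measurable]: "(fst :: real \<times> real \<Rightarrow> real) \<in> borel_measurable borel"
    "(snd :: real \<times> real \<Rightarrow> real) \<in> borel_measurable borel"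
    "(fst :: (real \<times> real) \<times> (real \<times> real) \<Rightarrow> real \<times> real) \<in> borel_measurable borel"
    "(snd :: (real \<times> real) \<times> (real \<times> real) \<Rightarrow> real \<times> real) \<in> borel_measurable borel"
    by (intro borel_measurable_continuous_onI continuous_intros)+
  have "cinner (coherent h (fst w) \<otimes>\<^sub>v coherent h (snd w)) F
      = (\<integral>t. cnj (coh h (fst (fst w)) (snd (fst w)) (fst t) * coh h (fst (snd w)) (snd (snd w)) (snd t)) * G t \<partial>lborel)" for w
  proof -
    have eq: "coherent h (fst w) = abs_L2 (coh h (fst (fst w)) (snd (fst w)))"
      "coherent h (snd w) = abs_L2 (coh h (fst (snd w)) (snd (snd w)))"
      by (simp_all flip: coherent_eq)
    show ?thesis
      unfolding eq tensor_abs[OF sq sq] G(2) cinner_abs[OF sq_integrable_tensor[OF sq sq] G(1)]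
      by (simp only: case_prod_beta')
  qed
  moreover have "(\<lambda>w. \<integral>t. cnj (coh h (fst (fst w)) (snd (fst w)) (fst t) * coh h (fst (snd w)) (snd (snd w)) (snd t)) * G t \<partial>lborel)
      \<in> borel_measurable borel"
    unfolding coh_def by measurable
  ultimately show ?thesis
    by simp
qed

lemma toeplitz_quadratic_form:
  assumes h: "h > 0" and \<mu>: "prob_space \<mu>" "sets \<mu> = sets borel" and Q: "toeplitz_of h \<mu> Q"
  defines "\<psi> \<equiv> \<lambda>w. coherent h (fst w) \<otimes>\<^sub>v coherent h (snd w)"
  shows "integrable \<mu> (\<lambda>w. (cmod (cinner (\<psi> w) F))\<^sup>2)"
    and "cinner F (Q F) = of_real (\<integral>w. (cmod (cinner (\<psi> w) F))\<^sup>2 \<partial>\<mu>)"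
proof -
  interpret prob_space \<mu> by fact
  have [measurable]: "(\<lambda>w. cinner (\<psi> w) F) \<in> borel_measurable \<mu>"
    unfolding \<psi>_def measurable_cong_sets[OF \<mu>(2) refl] by (rule measurable_coherent_overlap[OF h])
  have norm: "norm (\<psi> w) = 1" for w
    by (simp add: \<psi>_def tensor.norm_tens norm_coherent[OF h])
  show "integrable \<mu> (\<lambda>w. (cmod (cinner (\<psi> w) F))\<^sup>2)"
  proof (rule integrable_const_bound[where B = "(norm F)\<^sup>2"])
    show "AE w in \<mu>. norm ((cmod (cinner (\<psi> w) F))\<^sup>2) \<le> (norm F)\<^sup>2"
      using norm_cinner_le[of "\<psi> _" F] by (intro AE_I2) (simp add: norm power_mono)
  qed measurable
  have "cinner F ((ket_bra (coherent h z) \<otimes>\<^sub>o ket_bra (coherent h z')) F) = of_real ((cmod (cinner (\<psi> (z, z')) F))\<^sup>2)" for z z'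
    unfolding tensor_op_ket_bra ket_bra_def cinner_scaleC_right complex_norm_square
    by (simp add: \<psi>_def cinner_commute[of F])
  then have "cinner F (Q F) = (\<integral>w. of_real ((cmod (cinner (\<psi> w) F))\<^sup>2) \<partial>\<mu>)"
    using Q unfolding toeplitz_of_def by (simp add: case_prod_beta')
  also have "\<dots> = of_real (\<integral>w. (cmod (cinner (\<psi> w) F))\<^sup>2 \<partial>\<mu>)"
    by (rule integral_complex_of_real)
  finally show "cinner F (Q F) = of_real (\<integral>w. (cmod (cinner (\<psi> w) F))\<^sup>2 \<partial>\<mu>)" .
qed

lemma nonneg_has_sum_zeroD:
  fixes f :: "'a \<Rightarrow> real"
  assumes "(f has_sum 0) A" "\<And>x. x \<in> A \<Longrightarrow> 0 \<le> f x" "x \<in> A"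
  shows "f x = 0"
  using finite_sum_le_has_sum[OF assms(1), of "{x}"] assms(2,3) by force

lemma integral_AE_finite:
  fixes g :: "'a \<Rightarrow> real"
  assumes \<mu>: "finite_measure \<mu>" and W: "finite W" "\<And>w. w \<in> W \<Longrightarrow> {w} \<in> sets \<mu>"
    and AE: "AE w in \<mu>. w \<in> W" and [measurable]: "g \<in> borel_measurable \<mu>"
  shows "(\<integral>w. g w \<partial>\<mu>) = (\<Sum>w\<in>W. measure \<mu> {w} * g w)"
proof -
  interpret finite_measure \<mu> by fact
  have "(\<integral>w. g w \<partial>\<mu>) = (\<integral>w. (\<Sum>v\<in>W. indicat_real {v} w * g v) \<partial>\<mu>)"
  proof (rule integral_cong_AE)
    show "AE w in \<mu>. g w = (\<Sum>v\<in>W. indicat_real {v} w * g v)"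
      using AE
    proof eventually_elim
      case (elim w)
      have "(\<Sum>v\<in>W. indicat_real {v} w * g v) = (\<Sum>v\<in>W. if v = w then g v else 0)"
        by (intro sum.cong) (auto simp: indicator_def)
      then show ?case
        using elim W(1) by simp
    qed
    show "(\<lambda>w. \<Sum>v\<in>W. indicat_real {v} w * g v) \<in> borel_measurable \<mu>"
      using W(2) by (intro borel_measurable_sum borel_measurable_times borel_measurable_indicator) auto
  qed measurable
  also have "\<dots> = (\<Sum>v\<in>W. \<integral>w. indicat_real {v} w * g v \<partial>\<mu>)"
    using W(2) by (intro Bochner_Integration.integral_sum integrable_mult_left integrable_real_indicator)
      (auto simp: emeasure_eq_measure)
  also have "\<dots> = (\<Sum>w\<in>W. measure \<mu> {w} * g w)"
    using W(2) sets.sets_into_space by (intro sum.cong refl) (fastforce intro: arg_cong2[where f = measure])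
  finally show ?thesis .
qed

lemma two_state_mixture:
  fixes u v :: "'a::euclidean_space L2"
  assumes R: "R = (\<lambda>f. \<alpha> *\<^sub>R ket_bra u f + \<beta> *\<^sub>R ket_bra v f)"
  shows "cinner x (R y) = cinner (R x) y"
    and "cinner x (R x) = of_real (\<alpha> * (cmod (cinner u x))\<^sup>2 + \<beta> * (cmod (cinner v x))\<^sup>2)"
proof -
  show "cinner x (R y) = cinner (R x) y"
    by (simp add: R ket_bra_def cinner_simps cinner_commute[of x])
  have "cinner x (R x) = of_real \<alpha> * (cinner u x * cinner x u) + of_real \<beta> * (cinner v x * cinner x v)"
    by (simp add: R ket_bra_def cinner_simps)
  also have "\<dots> = of_real (\<alpha> * (cmod (cinner u x))\<^sup>2 + \<beta> * (cmod (cinner v x))\<^sup>2)"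
    unfolding cinner_commute[of x] complex_norm_square[symmetric] by (simp only: of_real_add of_real_mult)
  finally show "cinner x (R x) = of_real (\<alpha> * (cmod (cinner u x))\<^sup>2 + \<beta> * (cmod (cinner v x))\<^sup>2)" .
qed

text \<open>Once the measure sits on four points, the marginals give the row sum p(A,A) + p(A,V) =
  \<open>\<alpha>\<close> and the column sum p(A,A) + p(V,A) = \<open>\<gamma>\<close>. Subtracting
  them yields p(A,V) >= \<open>\<alpha> - \<gamma>\<close>, and the other three points contribute
  nonnegatively.\<close>

lemma toeplitz_coupling_lower_bound:
  fixes h a :: real and Q :: "(real \<times> real) L2 \<Rightarrow> (real \<times> real) L2"
  assumes h: "h > 0" and a: "a > 0"
  defines "u \<equiv> coherent h (a, 0)" and "v \<equiv> coherent h (- a, 0)"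
  assumes R: "R = (\<lambda>f. \<alpha> *\<^sub>R ket_bra u f + \<beta> *\<^sub>R ket_bra v f)"
    and S: "S = (\<lambda>f. \<gamma> *\<^sub>R ket_bra u f + \<delta> *\<^sub>R ket_bra v f)"
    and Q: "coupling R S Q" and toep: "is_toeplitz h Q"
  shows "(\<alpha> - \<gamma>) * (cmod (cinner (u \<otimes>\<^sub>v v) F))\<^sup>2 \<le> Re (cinner F (Q F))"
proof -
  obtain \<mu> where \<mu>: "prob_space \<mu>" "sets \<mu> = sets borel" and T: "toeplitz_of h \<mu> Q"
    using toep unfolding is_toeplitz_def by blast
  interpret prob_space \<mu> by fact
  let ?c = "coherent h"
  define \<psi> where "\<psi> w = ?c (fst w) \<otimes>\<^sub>v ?c (snd w)" for w
  note form = toeplitz_quadratic_form[OF h \<mu> T, folded \<psi>_def]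
  have \<psi>: "cinner (\<psi> w) (f \<otimes>\<^sub>v g) = cinner (?c (fst w)) f * cinner (?c (snd w)) g" for w f g
    by (simp add: \<psi>_def cinner_tensor)
  note R_sym = two_state_mixture(1)[OF R] and R_form = two_state_mixture(2)[OF R]
  note S_sym = two_state_mixture(1)[OF S] and S_form = two_state_mixture(2)[OF S]
  obtain f0 where f0: "\<And>z. cinner (?c z) f0 = 0 \<longleftrightarrow> z = (a, 0) \<or> z = (- a, 0)"
    using coherent_separating_vector[OF h] by blast
  \<comment> \<open>As \<open>a > 0\<close>, the origin is neither of the two points, so
    \<open>f0\<close> has a nonzero overlap there.\<close>
  have "f0 \<noteq> 0"
    using f0[of "(0, 0)"] a by auto
  define f where "f = inverse (norm f0) *\<^sub>R f0"
  have f: "norm f = 1" "\<And>z. cinner (?c z) f = 0 \<longleftrightarrow> z = (a, 0) \<or> z = (- a, 0)"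
    using \<open>f0 \<noteq> 0\<close> f0 by (simp_all add: f_def cinner_simps)
  have uvf: "cinner u f = 0" "cinner v f = 0"
    by (simp_all add: u_def v_def f)
  define g where "g = ?c (0, 0)"
  have g: "norm g = 1" "\<And>z. cinner (?c z) g \<noteq> 0"
    by (simp_all add: g_def norm_coherent[OF h] cinner_coherent_zero_nonzero[OF h])
  obtain C where C: "{g} \<subseteq> C" "orthonormal_basis C"
    using orthonormal_extend_basis[OF orthonormal_singleton[OF g(1)]] by blast
  have "AE w in \<mu>. fst w = (a, 0) \<or> fst w = (- a, 0)"
  proof -
    \<comment> \<open>\<open>f\<close> is orthogonal to u and v, so the form of R at
      \<open>f\<close> is zero and every term of this nonnegative sum vanishes. The term of the
      ground state forces the overlap of the first point with \<open>f\<close> to vanish almost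
      everywhere.\<close>
    have "((\<lambda>g. \<integral>w. (cmod (cinner (\<psi> w) (f \<otimes>\<^sub>v g)))\<^sup>2 \<partial>\<mu>) has_sum 0) C"
      using has_sum_Re[OF coupling_marginal_left[OF Q R_sym f(1) C(2)]] by (simp add: form(2) R_form uvf)
    then have "(\<integral>w. (cmod (cinner (\<psi> w) (f \<otimes>\<^sub>v g)))\<^sup>2 \<partial>\<mu>) = 0"
      by (rule nonneg_has_sum_zeroD) (use C in \<open>auto intro: integral_nonneg_AE\<close>)
    then have "AE w in \<mu>. (cmod (cinner (\<psi> w) (f \<otimes>\<^sub>v g)))\<^sup>2 = 0"
      using integral_nonneg_eq_0_iff_AE[OF form(1)] by simp
    then show ?thesis
      by eventually_elim (simp add: \<psi> g f)
  qed
  moreover have "AE w in \<mu>. snd w = (a, 0) \<or> snd w = (- a, 0)"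
  proof -
    have "((\<lambda>g. \<integral>w. (cmod (cinner (\<psi> w) (g \<otimes>\<^sub>v f)))\<^sup>2 \<partial>\<mu>) has_sum 0) C"
      using has_sum_Re[OF coupling_marginal_right[OF Q S_sym f(1) C(2)]] by (simp add: form(2) S_form uvf)
    then have "(\<integral>w. (cmod (cinner (\<psi> w) (g \<otimes>\<^sub>v f)))\<^sup>2 \<partial>\<mu>) = 0"
      by (rule nonneg_has_sum_zeroD) (use C in \<open>auto intro: integral_nonneg_AE\<close>)
    then have "AE w in \<mu>. (cmod (cinner (\<psi> w) (g \<otimes>\<^sub>v f)))\<^sup>2 = 0"
      using integral_nonneg_eq_0_iff_AE[OF form(1)] by simp
    then show ?thesis
      by eventually_elim (simp add: \<psi> g f)
  qed
  ultimately have AE: "AE w in \<mu>. w \<in> {(a, 0), (- a, 0)} \<times> {(a, 0), (- a, 0)}"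
    by eventually_elim (unfold mem_Times_iff insert_iff, blast)
  define p where "p z z' = measure \<mu> {(z, z')}" for z z'
  let ?A = "(a, 0) :: real \<times> real" and ?V = "(- a, 0) :: real \<times> real"
  have AV: "?A \<noteq> ?V"
    using a by simp
  have Qform: "Re (cinner F (Q F)) = (p ?A ?A * (cmod (cinner (u \<otimes>\<^sub>v u) F))\<^sup>2 + p ?A ?V * (cmod (cinner (u \<otimes>\<^sub>v v) F))\<^sup>2)
      + (p ?V ?A * (cmod (cinner (v \<otimes>\<^sub>v u) F))\<^sup>2 + p ?V ?V * (cmod (cinner (v \<otimes>\<^sub>v v) F))\<^sup>2)" for F
  proof -
    have "(\<integral>w. (cmod (cinner (\<psi> w) F))\<^sup>2 \<partial>\<mu>)
        = (\<Sum>w\<in>{?A, ?V} \<times> {?A, ?V}. measure \<mu> {w} * (cmod (cinner (\<psi> w) F))\<^sup>2)"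
      using borel_measurable_integrable[OF form(1)] AE \<mu>(2)
      by (intro integral_AE_finite finite_measure_axioms) auto
    then show ?thesis
      using AV unfolding form(2) sum.cartesian_product'[symmetric]
      by (simp add: sum.cartesian_product[symmetric] p_def \<psi>_def u_def v_def)
  qed
  have p0: "0 \<le> p z z'" for z z'
    by (simp add: p_def)
  define s where "s = exp (- (a - - a)\<^sup>2 / (4 * h))"
  have uv: "cinner u v = of_real s" "cinner v u = of_real s"
    using cinner_coherent_real[OF h, of a "- a"] cinner_coherent_real[OF h, of "- a" a]
    by (simp_all add: u_def v_def s_def power2_commute)
  have uu: "cinner u u = 1" "cinner v v = 1" "norm u = 1" "norm v = 1"
    by (simp_all add: u_def v_def cinner_self norm_coherent[OF h])
  have s: "0 < s" "s < 1"
    using h a by (simp_all add: s_def)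
  \<comment> \<open>Orthogonal to v but not to u. Testing a marginal with its normalisation
    \<open>k\<close> removes the two points with V in that factor and leaves one row or column sum
    times \<open>r\<close>.\<close>
  define \<xi> where "\<xi> = u - s *\<^sub>R v"
  have \<xi>: "cinner v \<xi> = 0" "cinner u \<xi> = of_real (1 - s * s)"
    by (simp_all add: \<xi>_def cinner_simps uv uu)
  have ss: "s * s < 1"
    using s mult_strict_mono[of s 1 s 1] by simp
  have "\<xi> \<noteq> 0"
  proof
    assume "\<xi> = 0"
    then have "complex_of_real (1 - s * s) = 0"
      using \<xi>(2) by (simp only: cinner_zero_right)
    then show False
      using ss by (simp only: of_real_eq_0_iff)
  qed
  define k where "k = inverse (norm \<xi>) *\<^sub>R \<xi>"
  define r where "r = (cmod (cinner u k))\<^sup>2"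
  have k: "norm k = 1" "cinner v k = 0"
    using \<open>\<xi> \<noteq> 0\<close> \<xi> by (simp_all add: k_def cinner_simps)
  have "cinner u k \<noteq> 0"
    unfolding k_def cinner_scaleR_right \<xi>(2) using \<open>\<xi> \<noteq> 0\<close> ss by (simp del: of_real_diff of_real_mult)
  then have r: "r > 0"
    by (simp add: r_def)
  have nu: "((\<lambda>g. (cmod (cinner u g))\<^sup>2) has_sum 1) C" "((\<lambda>g. (cmod (cinner v g))\<^sup>2) has_sum 1) C"
    using parseval_norm[OF C(2), of u] parseval_norm[OF C(2), of v] by (simp_all add: uu)
  have left: "p ?A ?A + p ?A ?V = \<alpha>"
  proof -
    have "((\<lambda>g. p ?A ?A * r * (cmod (cinner u g))\<^sup>2 + p ?A ?V * r * (cmod (cinner v g))\<^sup>2) has_sum \<alpha> * r) C"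
      using has_sum_Re[OF coupling_marginal_left[OF Q R_sym k(1) C(2)]]
      by (simp add: Qform R_form cinner_tensor norm_mult power_mult_distrib k r_def mult.assoc)
    moreover have "((\<lambda>g. p ?A ?A * r * (cmod (cinner u g))\<^sup>2 + p ?A ?V * r * (cmod (cinner v g))\<^sup>2)
        has_sum (p ?A ?A * r * 1 + p ?A ?V * r * 1)) C"
      by (intro has_sum_add has_sum_cmult_right nu)
    ultimately have "\<alpha> * r = p ?A ?A * r * 1 + p ?A ?V * r * 1"
      by (rule has_sum_unique)
    then have "(p ?A ?A + p ?A ?V) * r = \<alpha> * r"
      by (simp add: algebra_simps)
    then show ?thesis
      using r by simp
  qed
  have right: "p ?A ?A + p ?V ?A = \<gamma>"
  proof -
    have "((\<lambda>g. p ?A ?A * r * (cmod (cinner u g))\<^sup>2 + p ?V ?A * r * (cmod (cinner v g))\<^sup>2) has_sum \<gamma> * r) C"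
      using has_sum_Re[OF coupling_marginal_right[OF Q S_sym k(1) C(2)]]
      by (simp add: Qform S_form cinner_tensor norm_mult power_mult_distrib k r_def mult_ac)
    moreover have "((\<lambda>g. p ?A ?A * r * (cmod (cinner u g))\<^sup>2 + p ?V ?A * r * (cmod (cinner v g))\<^sup>2)
        has_sum (p ?A ?A * r * 1 + p ?V ?A * r * 1)) C"
      by (intro has_sum_add has_sum_cmult_right nu)
    ultimately have "\<gamma> * r = p ?A ?A * r * 1 + p ?V ?A * r * 1"
      by (rule has_sum_unique)
    then have "(p ?A ?A + p ?V ?A) * r = \<gamma> * r"
      by (simp add: algebra_simps)
    then show ?thesis
      using r by simp
  qed
  have "\<alpha> - \<gamma> \<le> p ?A ?V"
    using left right p0[of ?V ?A] by linarith
  then have "(\<alpha> - \<gamma>) * (cmod (cinner (u \<otimes>\<^sub>v v) F))\<^sup>2 \<le> p ?A ?V * (cmod (cinner (u \<otimes>\<^sub>v v) F))\<^sup>2"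
    by (rule mult_right_mono) simp
  also have "\<dots> \<le> Re (cinner F (Q F))"
    unfolding Qform using p0 by simp
  finally show ?thesis .
qed

section \<open>The cost of products of coherent states\<close>

text \<open>Coherent states are eigenvectors of annihilation operators: with zero momenta, the
  derivative term cancels x - y and leaves the difference of the centres as eigenvalue.\<close>

lemma coherent_product_lower:
  assumes h: "h > 0"
  obtains f where "schwartz f" "coherent h (q, 0) \<otimes>\<^sub>v coherent h (q', 0) = abs_L2 f"
    "lower h f = (\<lambda>z. of_real (q - q') * f z)"
proof -
  define E where "E z = complex_of_real (exp (q / h * fst z + q' / h * snd z - ((fst z)\<^sup>2 + (snd z)\<^sup>2) / (2 * h)))" for z :: "real \<times> real"
  define k where "k = complex_of_real ((pi * h) powr (- 1 / 4) * (pi * h) powr (- 1 / 4) * exp (- (q\<^sup>2 + q'\<^sup>2) / (2 * h)))"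
  define f where "f z = k * E z" for z
  have "pgauss h E"
    unfolding E_def[abs_def] by (rule pgauss_exp)
  then have sE: "schwartz E" and sf: "schwartz f"
    unfolding f_def[abs_def] by (auto intro: pgauss_schwartz[OF h] pgauss_scale)
  have "coh h q 0 x * coh h q' 0 y = f (x, y)" for x y
  proof -
    have "- (x - q)\<^sup>2 / (2 * h) + - (y - q')\<^sup>2 / (2 * h)
        = - (q\<^sup>2 + q'\<^sup>2) / (2 * h) + (q / h * x + q' / h * y - (x\<^sup>2 + y\<^sup>2) / (2 * h))"
      using h by (simp add: field_simps power2_eq_square)
    then have e: "exp (- (x - q)\<^sup>2 / (2 * h)) * exp (- (y - q')\<^sup>2 / (2 * h))
        = exp (- (q\<^sup>2 + q'\<^sup>2) / (2 * h)) * exp (q / h * x + q' / h * y - (x\<^sup>2 + y\<^sup>2) / (2 * h))"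
      by (simp only: exp_add[symmetric])
    have "coh h q 0 x * coh h q' 0 y = of_real ((pi * h) powr (- 1 / 4) * (pi * h) powr (- 1 / 4) *
        (exp (- (x - q)\<^sup>2 / (2 * h)) * exp (- (y - q')\<^sup>2 / (2 * h))))"
      by (simp add: coh_def)
    then show ?thesis
      unfolding e by (simp add: f_def k_def E_def)
  qed
  then have "(\<lambda>(x, y). coh h q 0 x * coh h q' 0 y) = f"
    by auto
  then have "coherent h (q, 0) \<otimes>\<^sub>v coherent h (q', 0) = abs_L2 f"
    by (simp add: coherent_eq tensor_abs coh_sq_integrable[OF h])
  moreover have "lower h f = (\<lambda>z. of_real (q - q') * f z)"
  proof -
    have "rel_deriv f = (\<lambda>z. k * rel_deriv E z + 0 * rel_deriv E z)"
      using rel_deriv_lin[OF sE sE, of k 0] by (simp add: f_def[abs_def])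
    have E_eq: "E = (\<lambda>z. complex_of_real (exp (q / h * fst z + q' / h * snd z - ((fst z)\<^sup>2 + (snd z)\<^sup>2) / (2 * h))))"
      by (simp add: E_def fun_eq_iff)
    note \<open>rel_deriv f = (\<lambda>z. k * rel_deriv E z + 0 * rel_deriv E z)\<close>
    also have "rel_deriv E = (\<lambda>z. of_real ((q - q') / h - (fst z - snd z) / h) * E z)"
      unfolding rel_deriv_eq[OF pderivs_exp_gauss[OF h E_eq]]
      using h by (auto simp: fun_eq_iff field_simps)
    finally have eq: "rel_deriv f = (\<lambda>z. k * (of_real ((q - q') / h - (fst z - snd z) / h) * E z)
        + 0 * (of_real ((q - q') / h - (fst z - snd z) / h) * E z))" .
    have rd: "rel_deriv f z = of_real ((q - q') / h - (fst z - snd z) / h) * f z" for z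
      unfolding eq by (simp add: f_def mult_ac)
    have "h * ((q - q') / h - d / h) = q - q' - d" for d
      using h by (simp add: field_simps)
    then have "of_real h * rel_deriv f z = of_real (q - q' - (fst z - snd z)) * f z" for z
      unfolding rd mult.assoc[symmetric] of_real_mult[symmetric] by simp
    then show ?thesis
      by (simp add: lower_def fun_eq_iff algebra_simps)
  qed
  ultimately show ?thesis
    using that sf by blast
qed

text \<open>The squared norm of \<open>y\<close> is the expectation of the cost in the product
  state, hence that of b* b with b the operator \<open>lower h\<close>, and the product is an
  eigenvector of b. The product lies in the domain of the cost, which places \<open>y\<close> in the
  domain of the square root.\<close>

lemma coherent_product_sqrt_cost:
  assumes h: "h > 0" and B: "orthonormal_basis B" and cost: "cost_op h = diag_op B (\<lambda>e. (l e)\<^sup>2)"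
  obtains y where "(coherent h (q, 0) \<otimes>\<^sub>v coherent h (q', 0), y) \<in> diag_op B l"
    "y \<in> Domain (diag_op B l)" "norm y = \<bar>q - q'\<bar>"
proof -
  obtain f where f: "schwartz f" "coherent h (q, 0) \<otimes>\<^sub>v coherent h (q', 0) = abs_L2 f"
    "lower h f = (\<lambda>z. of_real (q - q') * f z)"
    using coherent_product_lower[OF h] .
  let ?\<psi> = "coherent h (q, 0) \<otimes>\<^sub>v coherent h (q', 0)"
  have "(?\<psi>, abs_L2 (cost_expr h f)) \<in> cost_op h"
    unfolding cost_op_def f(2) using f(1) by (intro subsetD[OF closure_subset]) blast
  then have "(?\<psi>, abs_L2 (cost_expr h f)) \<in> diag_op B l O diag_op B l"
    unfolding cost diag_op_comp[OF B] .
  then obtain y where y: "(?\<psi>, y) \<in> diag_op B l" "(y, abs_L2 (cost_expr h f)) \<in> diag_op B l"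
    by blast
  have "cinner y y = cinner ?\<psi> (abs_L2 (cost_expr h f))"
    using diag_op_sym[OF B y(2) y(1)] by simp
  also have "\<dots> = cinner (of_real (q - q') *\<^sub>C ?\<psi>) (of_real (q - q') *\<^sub>C ?\<psi>)"
    unfolding f(2) cinner_cost_expr[OF f(1) f(1)] f(3) scaleC_abs[OF schwartz_sq_integrable[OF f(1)]] ..
  finally have "(norm y)\<^sup>2 = (norm (complex_of_real (q - q') *\<^sub>C ?\<psi>))\<^sup>2"
    unfolding cinner_self by (simp only: of_real_eq_iff)
  then have "norm y = norm (complex_of_real (q - q') *\<^sub>C ?\<psi>)"
    by (rule power2_eq_imp_eq) simp_all
  then have "norm y = \<bar>q - q'\<bar>"
    by (simp add: norm_scaleC tensor.norm_tens norm_coherent[OF h] del: of_real_diff)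
  then show ?thesis
    using that y by blast
qed

section \<open>Finite rank operators\<close>

text \<open>Weights are absorbed into the first vector of each pair, so the trace of a composition
  is a finite sum of inner products that can be evaluated term by term.\<close>

definition finite_rank ::
    "('a::euclidean_space L2 \<times> 'a L2) list \<Rightarrow> 'a L2 \<Rightarrow> 'a L2" where
  "finite_rank xs f = (\<Sum>(u, v)\<leftarrow>xs. cinner v f *\<^sub>C u)"

lemma finite_rank_Nil: "finite_rank [] = (\<lambda>f. 0)"
  by (simp add: finite_rank_def fun_eq_iff)

lemma finite_rank_Cons: "finite_rank ((u, v) # xs) = (\<lambda>f. cinner v f *\<^sub>C u + finite_rank xs f)"
  by (simp add: finite_rank_def fun_eq_iff)

lemma bounded_op_zero: "bounded_op (\<lambda>f. 0)"
  by (simp add: bounded_op_def)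

lemma has_trace_comp_finite_rank:
  assumes T: "bounded_op T"
  shows "has_trace (T \<circ> finite_rank xs) (\<Sum>(u, v)\<leftarrow>xs. cinner v (T u))"
proof (induction xs)
  case Nil
  have "T 0 = 0"
    using bounded_op_scaleC[OF T, of 0 0] by simp
  then show ?case
    by (simp add: finite_rank_Nil comp_def has_trace_def bounded_op_zero)
next
  case (Cons x xs)
  obtain u v where x: "x = (u, v)"
    by (cases x)
  have "T \<circ> finite_rank (x # xs) = (\<lambda>f. cinner v f *\<^sub>C T u + (T \<circ> finite_rank xs) f)"
    by (auto simp: x finite_rank_Cons bounded_op_add[OF T] bounded_op_scaleC[OF T])
  then show ?case
    using has_trace_plus[OF has_trace_rank_one[of v "T u"] Cons.IH] by (simp add: x)
qed

lemma has_trace_comp_finite_rankI: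
  "bounded_op T \<Longrightarrow> t = (\<Sum>(u, v)\<leftarrow>xs. cinner v (T u)) \<Longrightarrow> has_trace (T \<circ> finite_rank xs) t"
  using has_trace_comp_finite_rank by blast

lemma has_trace_finite_rankI: "t = (\<Sum>(u, v)\<leftarrow>xs. cinner v u) \<Longrightarrow> has_trace (finite_rank xs) t"
  using has_trace_comp_finite_rank[OF bounded_op_id, of xs] by (simp add: comp_def)

lemma bounded_op_finite_rank: "bounded_op (finite_rank xs)"
  using has_trace_finite_rankI[OF refl, of xs] by (simp add: has_trace_def)

section \<open>A cheaper coupling\<close>

text \<open>The perturbation of the Toeplitz coupling is \<open>- \<tau> (|A\<rangle>\<langle>B| + |B\<rangle>\<langle>A|)\<close> with
  \<open>A = u \<otimes> (u - s v)\<close> and \<open>B = (v - s u) \<otimes> v\<close>, where \<open>s = \<langle>u, v\<rangle>\<close>. Since \<open>u - s v \<bottom> v\<close> and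
  \<open>v - s u \<bottom> u\<close>, both of its partial traces vanish, while it lowers the weight of
  \<open>|u \<otimes> v\<rangle>\<langle>u \<otimes> v|\<close>, the only term that contributes to the cost.\<close>
definition competitor ::
    "real \<Rightarrow> real L2 \<Rightarrow> real L2 \<Rightarrow> real \<Rightarrow> real \<Rightarrow> (real \<times> real) L2 \<Rightarrow> (real \<times> real) L2" where
  "competitor s u v \<eta> \<tau> =
     (let A = u \<otimes>\<^sub>v (u - s *\<^sub>R v); B = (v - s *\<^sub>R u) \<otimes>\<^sub>v v in
      finite_rank [((1 / 2) *\<^sub>R (u \<otimes>\<^sub>v u), u \<otimes>\<^sub>v u), ((\<eta> / 2) *\<^sub>R (u \<otimes>\<^sub>v v), u \<otimes>\<^sub>v v),
        (((1 - \<eta>) / 2) *\<^sub>R (v \<otimes>\<^sub>v v), v \<otimes>\<^sub>v v), ((- \<tau>) *\<^sub>R A, B), ((- \<tau>) *\<^sub>R B, A)])"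

lemma tensor_diff_left: "(f - r *\<^sub>R g) \<otimes>\<^sub>v (k :: real L2) = f \<otimes>\<^sub>v k - r *\<^sub>R ((g :: real L2) \<otimes>\<^sub>v k)"
  by (rule tensor.tens_eqI) (simp add: cinner_tensor cinner_simps algebra_simps)

lemma tensor_diff_right: "(k :: real L2) \<otimes>\<^sub>v (f - r *\<^sub>R g) = k \<otimes>\<^sub>v f - r *\<^sub>R (k \<otimes>\<^sub>v (g :: real L2))"
  by (rule tensor.tens_eqI) (simp add: cinner_tensor cinner_simps algebra_simps)

text \<open>The overlaps of A and B with F are \<open>\<alpha> F - s * \<beta> F\<close> and
  \<open>\<gamma> F - s * \<beta> F\<close>. Where \<open>\<alpha>\<close> and
  \<open>\<gamma>\<close> vanish, only \<open>\<beta>\<close> remains and the perturbation lowers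
  its weight by \<open>2 * \<tau> * s\<^sup>2\<close>.\<close>

lemma competitor_form:
  fixes u v :: "real L2"
  defines "\<alpha> \<equiv> \<lambda>F. cinner (u \<otimes>\<^sub>v u) F" and "\<beta> \<equiv> \<lambda>F. cinner (u \<otimes>\<^sub>v v) F" and "\<gamma> \<equiv> \<lambda>F. cinner (v \<otimes>\<^sub>v v) F"
  shows "cinner F (competitor s u v \<eta> \<tau> G) = of_real (1 / 2) * (cnj (\<alpha> F) * \<alpha> G)
    + of_real (\<eta> / 2) * (cnj (\<beta> F) * \<beta> G) + of_real ((1 - \<eta>) / 2) * (cnj (\<gamma> F) * \<gamma> G)
    - of_real \<tau> * (cnj (\<alpha> F - s * \<beta> F) * (\<gamma> G - s * \<beta> G) + cnj (\<gamma> F - s * \<beta> F) * (\<alpha> G - s * \<beta> G))"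
  unfolding competitor_def Let_def finite_rank_Cons finite_rank_Nil \<alpha>_def \<beta>_def \<gamma>_def
  by (simp add: tensor_diff_left tensor_diff_right cinner_simps cinner_commute[of F] algebra_simps)

text \<open>The three diagonal weights dominate the cross term once \<open>\<tau>\<close> is small;
  the two upper bounds on \<open>\<tau>\<close> say how small. The perturbation drops out of both
  marginals because <v, u - s v> and <u, v - s u> vanish.\<close>

lemma competitor_coupling:
  fixes u v :: "real L2"
  assumes u: "cinner u u = 1" and v: "cinner v v = 1" and uv: "cinner u v = of_real s"
    and s: "0 \<le> s" "s \<le> 1"
    and \<eta>: "0 < \<eta>" "\<eta> < 1" and \<tau>: "0 \<le> \<tau>" "\<tau> \<le> \<eta> / 8" "\<tau> \<le> (1 - \<eta>) / 4"
    and R: "R = (\<lambda>f. ((1 + \<eta>) / 2) *\<^sub>R ket_bra u f + ((1 - \<eta>) / 2) *\<^sub>R ket_bra v f)"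
    and S: "S = (\<lambda>f. (1 / 2) *\<^sub>R ket_bra u f + (1 / 2) *\<^sub>R ket_bra v f)"
  shows "coupling R S (competitor s u v \<eta> \<tau>)"
proof -
  let ?Q = "competitor s u v \<eta> \<tau>"
  have vu: "cinner v u = of_real s"
    using cinner_commute[of v u] by (simp add: uv)
  have R': "R = finite_rank [(((1 + \<eta>) / 2) *\<^sub>R u, u), (((1 - \<eta>) / 2) *\<^sub>R v, v)]"
    by (simp add: R finite_rank_Cons finite_rank_Nil ket_bra_def fun_eq_iff scaleR_scaleC_commute)
  have S': "S = finite_rank [((1 / 2) *\<^sub>R u, u), ((1 / 2) *\<^sub>R v, v)]"
    by (simp add: S finite_rank_Cons finite_rank_Nil ket_bra_def fun_eq_iff scaleR_scaleC_commute)
  have sc: "T (r *\<^sub>R x) = r *\<^sub>R T x" if "bounded_op T"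
    for T :: "'x::euclidean_space L2 \<Rightarrow> 'y::euclidean_space L2" and r x
    using that by (simp add: scaleR_scaleC bounded_op_scaleC)
  have neg: "T (- x) = - T x" if "bounded_op T"
    for T :: "'x::euclidean_space L2 \<Rightarrow> 'y::euclidean_space L2" and x
    using that by (simp add: uminus_scaleC bounded_op_scaleC)
  have left: "\<exists>t. has_trace ((M \<otimes>\<^sub>o id) \<circ> ?Q) t \<and> has_trace (M \<circ> R) t" if M: "bounded_op M" for M :: "real L2 \<Rightarrow> real L2"
  proof -
    note ten = tensor_op_id_right[OF M]
    have "has_trace ((M \<otimes>\<^sub>o id) \<circ> ?Q) (of_real ((1 + \<eta>) / 2) * cinner u (M u) + of_real ((1 - \<eta>) / 2) * cinner v (M v))"
      unfolding competitor_def Let_def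
      by (rule has_trace_comp_finite_rankI[OF ten(1)]) (simp add: sc[OF ten(1)] neg[OF ten(1)] ten(2) cinner_simps cinner_tensor u v uv vu algebra_simps add_divide_distrib)
    moreover have "has_trace (M \<circ> R) (of_real ((1 + \<eta>) / 2) * cinner u (M u) + of_real ((1 - \<eta>) / 2) * cinner v (M v))"
      unfolding R' by (rule has_trace_comp_finite_rankI[OF M]) (simp add: sc[OF M] cinner_simps)
    ultimately show ?thesis
      by blast
  qed
  have right: "\<exists>t. has_trace ((id \<otimes>\<^sub>o M) \<circ> ?Q) t \<and> has_trace (M \<circ> S) t" if M: "bounded_op M" for M :: "real L2 \<Rightarrow> real L2"
  proof -
    note ten = tensor_op_id_left[OF M]
    have "has_trace ((id \<otimes>\<^sub>o M) \<circ> ?Q) (of_real (1 / 2) * cinner u (M u) + of_real (1 / 2) * cinner v (M v))"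
      unfolding competitor_def Let_def
      by (rule has_trace_comp_finite_rankI[OF ten(1)]) (simp add: sc[OF ten(1)] neg[OF ten(1)] ten(2) cinner_simps cinner_tensor u v uv vu, simp add: field_simps)
    moreover have "has_trace (M \<circ> S) (of_real (1 / 2) * cinner u (M u) + of_real (1 / 2) * cinner v (M v))"
      unfolding S' by (rule has_trace_comp_finite_rankI[OF M]) (simp add: sc[OF M] cinner_simps)
    ultimately show ?thesis
      by blast
  qed
  have "cinner F (?Q G) = cinner (?Q F) G" for F G
    unfolding cinner_commute[of "?Q F" G] competitor_form by (simp add: algebra_simps)
  moreover have "0 \<le> Re (cinner F (?Q F))" for F
  proof -
    define \<alpha> where "\<alpha> = cinner (u \<otimes>\<^sub>v u) F"
    define \<beta> where "\<beta> = cinner (u \<otimes>\<^sub>v v) F"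
    define \<gamma> where "\<gamma> = cinner (v \<otimes>\<^sub>v v) F"
    have cross: "2 * Re (cnj x * y) \<le> (cmod x)\<^sup>2 + (cmod y)\<^sup>2" for x y :: complex
    proof -
      have "0 \<le> (cmod (x - y))\<^sup>2"
        by simp
      also have "(cmod (x - y))\<^sup>2 = (cmod x)\<^sup>2 + (cmod y)\<^sup>2 - 2 * Re (cnj x * y)"
        unfolding cmod_power2 by (simp add: power2_eq_square algebra_simps)
      finally show ?thesis
        by simp
    qed
    have par: "(cmod (x - s * y))\<^sup>2 \<le> 2 * (cmod x)\<^sup>2 + 2 * (cmod y)\<^sup>2" for x y :: complex
    proof -
      have "cmod (x - s * y) \<le> cmod x + s * cmod y"
        using norm_triangle_ineq4[of x "s * y"] s by (simp add: norm_mult)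
      also have "\<dots> \<le> cmod x + cmod y"
        using s by (simp add: mult_left_le_one_le)
      finally have "(cmod (x - s * y))\<^sup>2 \<le> (cmod x + cmod y)\<^sup>2"
        by (intro power_mono) auto
      also have "\<dots> \<le> 2 * (cmod x)\<^sup>2 + 2 * (cmod y)\<^sup>2"
        using sum_squares_bound[of "cmod x" "cmod y"] by (simp add: power2_sum)
      finally show ?thesis .
    qed
    have sq: "cnj x * x = of_real ((cmod x)\<^sup>2)" for x
      by (simp only: complex_norm_square mult.commute)
    have Re_eq: "Re (cinner F (?Q F)) = 1 / 2 * (cmod \<alpha>)\<^sup>2 + \<eta> / 2 * (cmod \<beta>)\<^sup>2 + (1 - \<eta>) / 2 * (cmod \<gamma>)\<^sup>2
        - \<tau> * (2 * Re (cnj (\<alpha> - s * \<beta>) * (\<gamma> - s * \<beta>)))"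
    proof -
      define X where "X = cnj (\<alpha> - s * \<beta>) * (\<gamma> - s * \<beta>)"
      have X: "cnj (\<gamma> - s * \<beta>) * (\<alpha> - s * \<beta>) = cnj X"
        by (simp add: X_def)
      show ?thesis
        unfolding competitor_form \<alpha>_def[symmetric] \<beta>_def[symmetric] \<gamma>_def[symmetric] sq X X_def[symmetric]
        by (simp del: of_real_power)
    qed
    \<comment> \<open>The cross term is at most a sum of two squares, and each of them loses a
      factor 2 when expanded. Positivity then asks for 2 tau <= 1/2, 4 tau <= eta/2 and 2 tau <= (1
      - eta)/2, which the two bounds on \<open>\<tau>\<close> provide.\<close>
    have "\<tau> * (2 * Re (cnj (\<alpha> - s * \<beta>) * (\<gamma> - s * \<beta>))) \<le> \<tau> * (2 * (cmod \<alpha>)\<^sup>2 + 4 * (cmod \<beta>)\<^sup>2 + 2 * (cmod \<gamma>)\<^sup>2)"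
      using cross[of "\<alpha> - s * \<beta>" "\<gamma> - s * \<beta>"] par[of \<alpha> \<beta>] par[of \<gamma> \<beta>] \<tau>(1) by (intro mult_left_mono) linarith+
    also have "\<dots> = (2 * \<tau>) * (cmod \<alpha>)\<^sup>2 + (4 * \<tau>) * (cmod \<beta>)\<^sup>2 + (2 * \<tau>) * (cmod \<gamma>)\<^sup>2"
      by (simp add: algebra_simps)
    also have "\<dots> \<le> 1 / 2 * (cmod \<alpha>)\<^sup>2 + \<eta> / 2 * (cmod \<beta>)\<^sup>2 + (1 - \<eta>) / 2 * (cmod \<gamma>)\<^sup>2"
      using \<eta> \<tau> by (intro add_mono mult_right_mono) auto
    finally show ?thesis
      unfolding Re_eq by simp
  qed
  moreover have "has_trace ?Q 1"
    unfolding competitor_def Let_def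
    by (rule has_trace_finite_rankI) (simp add: cinner_simps cinner_tensor u v uv vu field_simps)
  moreover have "bounded_op ?Q"
    unfolding competitor_def Let_def by (rule bounded_op_finite_rank)
  ultimately show ?thesis
    using left right unfolding coupling_def density_matrix_def by blast
qed

theorem mainTheorem3:
  fixes hbar a \<eta> :: real
    and R S :: "real L2 \<Rightarrow> real L2"
    and Q :: "(real \<times> real) L2 \<Rightarrow> (real \<times> real) L2"
  assumes "hbar > 0" and "a > 0" and "0 < \<eta>" and "\<eta> < 1"
    and R: "R = (\<lambda>f. ((1 + \<eta>) / 2) *\<^sub>R ket_bra (coherent hbar (a, 0)) f
                   + ((1 - \<eta>) / 2) *\<^sub>R ket_bra (coherent hbar (- a, 0)) f)"
    and S: "S = (\<lambda>f. (1 / 2) *\<^sub>R ket_bra (coherent hbar (a, 0)) f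
                   + (1 / 2) *\<^sub>R ket_bra (coherent hbar (- a, 0)) f)"
    and "coupling R S Q"
    and "transport_cost hbar Q = (MK2 hbar R S)\<^sup>2"
  shows "\<not> is_toeplitz hbar Q"
proof
  assume toep: "is_toeplitz hbar Q"
  define u where "u = coherent hbar (a, 0)"
  define v where "v = coherent hbar (- a, 0)"
  define s where "s = exp (- (a - - a)\<^sup>2 / (4 * hbar))"
  \<comment> \<open>The largest value for which \<open>competitor_coupling\<close> guarantees
    positivity.\<close>
  define \<tau> where "\<tau> = min (\<eta> / 8) ((1 - \<eta>) / 4)"
  define Q' where "Q' = competitor s u v \<eta> \<tau>"
  have \<tau>_le: "\<tau> \<le> \<eta> / 8" "\<tau> \<le> (1 - \<eta>) / 4"
    unfolding \<tau>_def by (rule min.cobounded1, rule min.cobounded2)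
  have s: "0 < s" "s \<le> 1" and \<tau>: "0 < \<tau>"
    using assms(1-4) by (simp_all add: s_def \<tau>_def)
  have uv: "cinner u u = 1" "cinner v v = 1" "cinner u v = of_real s"
    using cinner_coherent_real[OF assms(1), of a "- a"]
    by (simp_all add: u_def v_def s_def cinner_self norm_coherent[OF assms(1)])
  have "coupling R S Q'"
    unfolding Q'_def
    by (rule competitor_coupling[OF uv _ s(2) assms(3,4) _ _ _ R[folded u_def v_def] S[folded u_def v_def]])
      (use s \<tau> \<tau>_le in simp_all)
  then have "(INF Q\<in>{Q. coupling R S Q}. transport_cost hbar Q) \<le> transport_cost hbar Q'"
    by (intro INF_lower) simp
  moreover have "(ennreal_sqrt x)\<^sup>2 = x" for x
    by (cases x) (auto simp: ennreal_sqrt_def ennreal_power)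
  ultimately have le: "transport_cost hbar Q \<le> transport_cost hbar Q'"
    using assms(8) by (simp add: MK2_def)
  obtain B l where B: "orthonormal_basis B" and l: "\<And>e. e \<in> B \<Longrightarrow> 0 \<le> l e"
    and cost: "cost_op hbar = diag_op B (\<lambda>e. (l e)\<^sup>2)"
    by (rule cost_op_diagonal[OF assms(1)]) blast
  define D where "D = diag_op B l"
  have sqrt: "sqrt_op (cost_op hbar) = D"
    unfolding cost D_def by (rule sqrt_op_diag_op[OF B l])
  note app = app_op_diag_op[OF B, of _ l, folded D_def]
  note sym = diag_op_sym[OF B, of _ _ l, folded D_def]
  note prod = coherent_product_sqrt_cost[OF assms(1) B cost, folded D_def]
  obtain y where y: "(u \<otimes>\<^sub>v v, y) \<in> D" "y \<in> Domain D" "norm y = \<bar>a - - a\<bar>"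
    unfolding u_def v_def by (rule prod)
  \<comment> \<open>When the two centres agree, the image under the square root has norm
    zero.\<close>
  have zero: "(u \<otimes>\<^sub>v u, 0) \<in> D" "(v \<otimes>\<^sub>v v, 0) \<in> D"
    using prod[of a a] prod[of "- a" "- a"] by (auto simp: u_def v_def)
  \<comment> \<open>The symmetry of \<open>D\<close> moves it onto the product states, where its
    values are 0, 0 and \<open>y\<close>.\<close>
  have overlap: "cinner (u \<otimes>\<^sub>v u) (app_op D e) = 0" "cinner (v \<otimes>\<^sub>v v) (app_op D e) = 0"
    "cinner (u \<otimes>\<^sub>v v) (app_op D e) = cinner y e" if "e \<in> Domain D" for e
    using sym[OF app[OF that] zero(1)] sym[OF app[OF that] zero(2)] sym[OF app[OF that] y(1)] by simp_all
  define c where "c = (norm y)\<^sup>2"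
  have c: "c > 0"
    using y(3) assms(2) by (simp add: c_def)
  have "transport_cost hbar Q' \<le> ennreal ((\<eta> / 2 - 2 * \<tau> * s\<^sup>2) * c)"
    unfolding transport_cost_def trace_sandwich_def sqrt Let_def
  proof (rule SUP_least, rule ennreal_leI)
    fix F assume "F \<in> {F. finite F \<and> orthonormal F \<and> F \<subseteq> Domain D}"
    then have F: "finite F" "orthonormal F" "F \<subseteq> Domain D"
      by auto
    have "Re (cinner (app_op D e) (Q' (app_op D e))) = (\<eta> / 2 - 2 * \<tau> * s\<^sup>2) * (cmod (cinner e y))\<^sup>2" if "e \<in> F" for e
    proof -
      have e: "e \<in> Domain D"
        using that F by blast
      have "cinner (app_op D e) (Q' (app_op D e)) = of_real (\<eta> / 2 - 2 * \<tau> * s\<^sup>2) * (cnj (cinner y e) * cinner y e)"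
        unfolding Q'_def competitor_form overlap[OF e] by (simp add: algebra_simps power2_eq_square)
      also have "cnj (cinner y e) * cinner y e = of_real ((cmod (cinner e y))\<^sup>2)"
        unfolding complex_norm_square cinner_commute[of e y] by simp
      finally show ?thesis
        by (simp only: of_real_mult[symmetric] Re_complex_of_real)
    qed
    then have "(\<Sum>e\<in>F. Re (cinner (app_op D e) (Q' (app_op D e)))) = (\<eta> / 2 - 2 * \<tau> * s\<^sup>2) * (\<Sum>e\<in>F. (cmod (cinner e y))\<^sup>2)"
      by (simp add: sum_distrib_left)
    also have "\<dots> \<le> (\<eta> / 2 - 2 * \<tau> * s\<^sup>2) * c"
    proof (rule mult_left_mono)
      show "(\<Sum>e\<in>F. (cmod (cinner e y))\<^sup>2) \<le> c"
        unfolding c_def by (rule bessel[OF F(2,1)])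
      have "\<tau> * s\<^sup>2 \<le> \<eta> / 8 * 1"
        using s \<tau> \<tau>_le by (intro mult_mono) (auto simp: power_le_one)
      then show "0 \<le> \<eta> / 2 - 2 * \<tau> * s\<^sup>2"
        using assms(3) by simp
    qed
    finally show "(\<Sum>e\<in>F. Re (cinner (app_op D e) (Q' (app_op D e)))) \<le> (\<eta> / 2 - 2 * \<tau> * s\<^sup>2) * c" .
  qed
  \<comment> \<open>Strictness rests on s > 0, the nonorthogonality of u and v, together with
    \<open>\<tau> > 0\<close> and \<open>y\<close> being nonzero.\<close>
  also have "\<dots> < ennreal (\<eta> / 2 * c)"
    using c s \<tau> assms(3) by (intro ennreal_lessI) (auto simp: algebra_simps)
  also have "\<dots> \<le> transport_cost hbar Q"
  proof -
    \<comment> \<open>The unit vector for which |<y, e>|^2 attains |y|^2. The weight in the lower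
      bound is (1 + eta)/2 - 1/2 = eta/2.\<close>
    define e where "e = inverse (norm y) *\<^sub>R y"
    have y0: "norm y > 0"
      using y(3) assms(2) by simp
    have "orthonormal {e}"
      using y0 by (intro orthonormal_singleton) (simp add: e_def)
    moreover have e: "e \<in> Domain D"
      using y(2) diag_op_scale[of y _ B l "of_real (inverse (norm y))"] unfolding D_def e_def scaleR_scaleC by blast
    ultimately have "ennreal (\<Sum>e\<in>{e}. Re (cinner (app_op D e) (Q (app_op D e)))) \<le> transport_cost hbar Q"
      unfolding transport_cost_def trace_sandwich_def sqrt Let_def by (intro SUP_upper) simp
    moreover have "\<eta> / 2 * c \<le> Re (cinner (app_op D e) (Q (app_op D e)))"
    proof -
      have "cinner y e = of_real (norm y)"
        using y0 by (simp add: e_def cinner_simps cinner_self power2_eq_square)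
      then have "(cmod (cinner (u \<otimes>\<^sub>v v) (app_op D e)))\<^sup>2 = c"
        by (simp add: overlap(3)[OF e] c_def)
      then show ?thesis
        using toeplitz_coupling_lower_bound[OF assms(1,2) R S assms(7) toep, of "app_op D e"]
        by (simp add: u_def v_def diff_divide_distrib[symmetric])
    qed
    ultimately show ?thesis
      by (auto intro: order_trans[OF ennreal_leI])
  qed
  finally show False
    using le by simp
qed

end
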